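(* Let $s'\in(0,\tfrac12)$ and $s\in(s'+\tfrac12,1)$. Let $u_0\in L^2(0,1)\setminus\dot H^{s'}(0,1)$ and $f\in\dot H^s(0,1)$. Let $q,\tilde q\in\mathcal{A}\cap\dot H^s(0,1)$ and $T,\tilde T>0$, and let $u=u(q)$, $\tilde u=u(\tilde q)$ be the solutions of problem (Q) with potentials $q,\tilde q$ respectively (same $u_0,f,a_0,a_1$). If $u(T)=\tilde u(\tilde T)$ in $(0,1)$, then $T=\tilde T$.
   Context: Let $\Omega=(0,1)$, $\alpha\in(0,1)$, $c_0>0$, and $\mathcal{A}=\{q\in L^\infty(0,1):0\le q\le c_0\}$. Let $a_0,a_1>0$ be constants and $u_0,f$ given time-independent functions. Problem (Q): $\partial_t^\alpha u-\partial_{xx}u+qu=f$ in $(0,1)\times(0,\infty)$, $u(0,t)=a_0$, $u(1,t)=a_1$, $u(\cdot,0)=u_0$, where $\partial_t^\alpha u(t)=\frac1{\Gamma(1-\alpha)}\int_0^t(t-s)^{-\alpha}u'(s)\,ds$ is the Caputo derivative. For $q\in\mathcal{A}$, $A_q=-\partial_{xx}+q$ with zero Dirichlet conditions on $L^2(0,1)$ has eigenpairs $(\lambda_n(q),\varphi_n(q))$ with $\{\varphi_n(q)\}$ orthonormal; $F_q(t)v=\sum_nE_{\alpha,1}(-\lambda_n(q)t^\alpha)(v,\varphi_n(q))\varphi_n(q)$ with $E_{\alpha,\beta}(z)=\sum_{k\ge0}z^k/\Gamma(k\alpha+\beta)$; $\phi_q$ solves $-\phi''+q\phi=0$ on $(0,1)$,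 $\phi(0)=a_0,\phi(1)=a_1$. The solution of (Q) is $u(t)=F_q(t)u_0+(I-F_q(t))\phi_q+(I-F_q(t))A_q^{-1}f$. For $s\in[0,1]$, $\dot H^s(0,1)=\{v\in L^2(0,1):\sum_n(n\pi)^{2s}(v,\sqrt2\sin(n\pi x))^2<\infty\}$ (the norm is equivalent to $(\sum_n\lambda_n(q)^s(v,\varphi_n(q))^2)^{1/2}$ for any $q\in\mathcal{A}$). *)

theory Defs
  imports "HOL-Analysis.Analysis"
begin

text \<open>Functions on (0,1) are represented as real => real; only values on (0,1) (resp. [0,1]) matter.\<close>

definition L2_01 :: "(real \<Rightarrow> real) \<Rightarrow> bool" where
  "L2_01 v \<longleftrightarrow> set_borel_measurable lborel {0<..<1} v \<and>
                 set_integrable lborel {0<..<1} (\<lambda>x. (v x)^2)"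

definition ip01 :: "(real \<Rightarrow> real) \<Rightarrow> (real \<Rightarrow> real) \<Rightarrow> real" where
  "ip01 v w = (LBINT x:{0<..<1}. v x * w x)"

definition ae_eq01 :: "(real \<Rightarrow> real) \<Rightarrow> (real \<Rightarrow> real) \<Rightarrow> bool" where
  "ae_eq01 v w \<longleftrightarrow> (AE x in lborel. x \<in> {0<..<1} \<longrightarrow> v x = w x)"

definition Hdot :: "real \<Rightarrow> (real \<Rightarrow> real) \<Rightarrow> bool" where
  "Hdot s v \<longleftrightarrow> L2_01 v \<and>
     summable (\<lambda>n. (real (Suc n) * pi) powr (2 * s) *
                    (ip01 v (\<lambda>x. sqrt 2 * sin (real (Suc n) * pi * x)))^2)"

definition admissible :: "real \<Rightarrow> (real \<Rightarrow> real) \<Rightarrow> bool" where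
  "admissible c0 q \<longleftrightarrow> set_borel_measurable lborel {0<..<1} q \<and>
     (AE x in lborel. x \<in> {0<..<1} \<longrightarrow> 0 \<le> q x \<and> q x \<le> c0)"

definition mittag_leffler :: "real \<Rightarrow> real \<Rightarrow> real \<Rightarrow> real" where
  "mittag_leffler a b z = (\<Sum>k. z ^ k / Gamma (real k * a + b))"

text \<open>\<open>y\<close> is a (strong, \<open>H^2\<close>) solution of \<open>-y'' + q y = h\<close> on [0,1], written in
  integrated form: \<open>y(x) = y(0) + \<integral>_0^x (c + \<integral>_0^t (q y - h))\<close> for some constant \<open>c = y'(0)\<close>.\<close>
definition ode_sol :: "(real \<Rightarrow> real) \<Rightarrow> (real \<Rightarrow> real) \<Rightarrow> (real \<Rightarrow> real) \<Rightarrow> bool" where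
  "ode_sol q h y \<longleftrightarrow> continuous_on {0..1} y \<and>
     (\<exists>c. \<forall>x\<in>{0..1}. y x = y 0 +
        (LBINT t=ereal 0..ereal x. c + (LBINT z=ereal 0..ereal t. q z * y z - h z)))"

definition dirichlet_eigensystem ::
  "(real \<Rightarrow> real) \<Rightarrow> (nat \<Rightarrow> real) \<Rightarrow> (nat \<Rightarrow> real \<Rightarrow> real) \<Rightarrow> bool" where
  "dirichlet_eigensystem q lam phi \<longleftrightarrow>
     (\<forall>n. L2_01 (phi n) \<and> ode_sol q (\<lambda>x. lam n * phi n x) (phi n) \<and>
          phi n 0 = 0 \<and> phi n 1 = 0) \<and>
     (\<forall>m n. ip01 (phi m) (phi n) = (if m = n then 1 else 0)) \<and>
     (\<forall>v. L2_01 v \<longrightarrow> (\<forall>n. ip01 v (phi n) = 0) \<longrightarrow> ae_eq01 v (\<lambda>_. 0))"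

definition L2_series :: "(nat \<Rightarrow> real) \<Rightarrow> (nat \<Rightarrow> real \<Rightarrow> real) \<Rightarrow> (real \<Rightarrow> real) \<Rightarrow> bool" where
  "L2_series c phi w \<longleftrightarrow> L2_01 w \<and>
     ((\<lambda>N. LBINT x:{0<..<1}. (w x - (\<Sum>n<N. c n * phi n x))^2) \<longlonglongrightarrow> 0)"

definition F_op :: "real \<Rightarrow> (nat \<Rightarrow> real) \<Rightarrow> (nat \<Rightarrow> real \<Rightarrow> real) \<Rightarrow> real \<Rightarrow>
                    (real \<Rightarrow> real) \<Rightarrow> (real \<Rightarrow> real) \<Rightarrow> bool" where
  "F_op \<alpha> lam phi t v w \<longleftrightarrow>
     L2_series (\<lambda>n. mittag_leffler \<alpha> 1 (- lam n * t powr \<alpha>) * ip01 v (phi n)) phi w"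

definition phi_q :: "(real \<Rightarrow> real) \<Rightarrow> real \<Rightarrow> real \<Rightarrow> (real \<Rightarrow> real) \<Rightarrow> bool" where
  "phi_q q a0 a1 p \<longleftrightarrow> ode_sol q (\<lambda>_. 0) p \<and> p 0 = a0 \<and> p 1 = a1"

definition Ainv :: "(real \<Rightarrow> real) \<Rightarrow> (real \<Rightarrow> real) \<Rightarrow> (real \<Rightarrow> real) \<Rightarrow> bool" where
  "Ainv q f g \<longleftrightarrow> ode_sol q f g \<and> g 0 = 0 \<and> g 1 = 0"

definition sol_at :: "real \<Rightarrow> (real \<Rightarrow> real) \<Rightarrow> (nat \<Rightarrow> real) \<Rightarrow> (nat \<Rightarrow> real \<Rightarrow> real) \<Rightarrow>
     real \<Rightarrow> real \<Rightarrow> (real \<Rightarrow> real) \<Rightarrow> (real \<Rightarrow> real) \<Rightarrow> real \<Rightarrow> (real \<Rightarrow> real) \<Rightarrow> bool" where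
  "sol_at \<alpha> q lam phi a0 a1 u0 f t w \<longleftrightarrow>
     (\<exists>p g w1 w2 w3. phi_q q a0 a1 p \<and> Ainv q f g \<and>
        F_op \<alpha> lam phi t u0 w1 \<and> F_op \<alpha> lam phi t p w2 \<and> F_op \<alpha> lam phi t g w3 \<and>
        ae_eq01 w (\<lambda>x. w1 x + (p x - w2 x) + (g x - w3 x)))"

end

theory Submission
  imports Defs "HOL-Complex_Analysis.Cauchy_Integral_Theorem" "HOL-Probability.Sinc_Integral"
begin

text \<open>Put \<open>\<kappa>(T) = 1 / (\<Gamma>(1 - \<alpha>) T\<^sup>\<alpha>)\<close>. As \<open>E\<^bsub>\<alpha>,1\<^esub>(-x) = 1 / (\<Gamma>(1 - \<alpha>) x) + O(x\<^sup>-\<^sup>2)\<close>, applying \<open>-\<partial>\<^sub>x\<^sub>x + q\<close>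
  to \<open>u(T)\<close> yields \<open>f + \<kappa>(T) u\<^sub>0\<close> up to a function whose sine coefficients are \<open>O(1/m)\<close>. Subtracting the
  identities for the two problems, which share the final state \<open>w\<close>, gives
  \<open>(q - q') w = (\<kappa>(T) - \<kappa>(T')) u\<^sub>0 + r\<close> with sine coefficients of \<open>r\<close> of order \<open>1/m\<close>. For \<open>s' < 1/2\<close> such an
  \<open>r\<close> is of class \<open>s'\<close>. The cosine coefficients of \<open>w\<close> are \<open>O(k\<^sup>-\<^sup>2)\<close>, so multiplication by \<open>w\<close> acts on sine
  coefficients as a convolution with a summable sequence and keeps \<open>q\<close> and \<open>q'\<close> in class \<open>s'\<close>. Hence \<open>T \<noteq> T'\<close>
  would put \<open>u\<^sub>0\<close> into class \<open>s'\<close>. All identities are obtained by testing with \<open>sin (m \<pi> x)\<close>.\<close>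

section \<open>The Hankel integral on vertical lines\<close>

text \<open>Three obstacles shape the argument. The two potentials have unrelated eigenfunctions, so
  the final states cannot be compared coefficient by coefficient in an eigenbasis;
  \<open>sin (m \<pi> x)\<close> belongs to the operator domain for both potentials, and Green's
  identity moves either operator onto it. The terms with \<open>(m \<pi>)^2\<close>, the boundary
  term and the coefficient of \<open>f\<close> then agree in both problems and drop out of the
  difference. The state does not vanish at the endpoints, so its sine coefficients decay only like
  \<open>1/m\<close>; its even reflection has no jump, which is why it is expanded in cosines, and a
  sine times a cosine is again a combination of sines. The same endpoint values limit the error to
  order \<open>1/m\<close>, since the multiplier acts on the initial value minus the stationary
  part, and the latter takes the values \<open>a0\<close> and \<open>a1\<close>. Finally,
  \<open>E\<close> is given by a series that alternates on the negative axis and whose individual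
  terms grow there, so its leading behaviour is read off from a contour integral.\<close>

lemma integrable_inverse_one_plus_square: "integrable lborel (\<lambda>u::real. K / (1 + u\<^sup>2))"
proof -
  have "integrable lborel (\<lambda>u::real. inverse (1 + u\<^sup>2))"
    using integrable_inverse_1_plus_square by (simp add: set_integrable_def)
  then have "integrable lborel (\<lambda>u::real. K * inverse (1 + u\<^sup>2))"
    by (rule integrable_mult_right)
  then show ?thesis by (simp add: divide_inverse)
qed

text \<open>One term of the exponential series gives
  \<open>(1 + t)^(n + 2) \<le> fact (n + 2) * exp (1 + t)\<close>, and \<open>1 + t - t^2\<close>
  stays below \<open>2\<close>. The two surplus powers of \<open>1 + t\<close> pay for the factor
  \<open>1 + t^2\<close>.\<close>

lemma power_mult_exp_neg_square_le:
  fixes t :: real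
  assumes "0 \<le> t"
  shows "(1 + t) ^ n * exp (- t\<^sup>2) \<le> fact (n + 2) * exp 2 / (1 + t\<^sup>2)"
proof -
  have "(1 + t) ^ (n + 2) / fact (n + 2) \<le> exp (1 + t)"
  proof -
    have "(\<Sum>k\<in>{n+2}. inverse (fact k) *\<^sub>R (1 + t) ^ k) \<le> (\<Sum>k. inverse (fact k) *\<^sub>R (1 + t) ^ k)"
      by (intro sum_le_suminf summable_exp_generic) (use assms in auto)
    then show ?thesis by (simp add: exp_def divide_inverse mult.commute)
  qed
  then have "(1 + t) ^ (n + 2) \<le> fact (n + 2) * exp (1 + t)"
    by (simp add: divide_le_eq mult.commute)
  then have "(1 + t) ^ (n + 2) * exp (- t\<^sup>2) \<le> fact (n + 2) * exp (1 + t) * exp (- t\<^sup>2)"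
    by (intro mult_right_mono) auto
  also have "\<dots> = fact (n + 2) * exp (1 + t - t\<^sup>2)" by (simp add: exp_diff exp_minus divide_inverse)
  also have "\<dots> \<le> fact (n + 2) * exp 2"
  proof -
    have "0 \<le> (t - 1/2)\<^sup>2" by simp
    then have "1 + t - t\<^sup>2 \<le> 2" by (simp add: power2_eq_square algebra_simps)
    then show ?thesis by simp
  qed
  finally have 1: "(1 + t) ^ (n + 2) * exp (- t\<^sup>2) \<le> fact (n + 2) * exp 2" .
  have "(1 + t) ^ n * exp (- t\<^sup>2) * (1 + t\<^sup>2) \<le> (1 + t) ^ n * exp (- t\<^sup>2) * (1 + t)\<^sup>2"
    using assms by (intro mult_left_mono) (auto simp: power2_sum)
  also have "\<dots> \<le> fact (n + 2) * exp 2" using 1 by (simp add: power_add mult_ac power2_eq_square)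
  finally show ?thesis by (simp add: le_divide_eq add_pos_nonneg)
qed

section \<open>Vertical lines of integration and their displacement\<close>

text \<open>Cauchy's theorem on a tall rectangle, in terms of a primitive: the half-plane is convex,
  so \<open>F\<close> has a primitive \<open>G\<close>, each truncated vertical integral is a
  difference of two corner values of \<open>G\<close>, and what separates the two lines is the
  increment of \<open>G\<close> along the horizontal sides, which vanishes as the height
  grows.\<close>

lemma integral_vertical_line_shift:
  fixes F :: "complex \<Rightarrow> complex"
  assumes hol: "F holomorphic_on {w. 0 < Re w}" and a: "0 < a" and ab: "a \<le> b"
    and bnd: "\<And>w. a \<le> Re w \<Longrightarrow> Re w \<le> b \<Longrightarrow> norm (F w) \<le> K / (1 + (Im w)\<^sup>2)"
  shows "(LINT u|lborel. F (Complex a u)) = (LINT u|lborel. F (Complex b u))"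
proof -
  have cvx: "convex {w. 0 < Re w}" "open {w. 0 < Re w}"
    by (auto simp: convex_halfspace_Re_gt open_halfspace_Re_gt)
  obtain G where G: "\<And>w. 0 < Re w \<Longrightarrow> (G has_field_derivative F w) (at w)"
    using holomorphic_convex_primitive'[OF cvx hol] cvx(2) by (metis at_within_open mem_Collect_eq)
  have contF: "continuous_on {w. 0 < Re w} F" using hol by (rule holomorphic_on_imp_continuous_on)
  have contL: "continuous_on UNIV (\<lambda>u. F (Complex c u))" if "0 < c" for c
    using that by (intro continuous_on_compose2[OF contF]) (auto simp: Complex_eq intro!: continuous_intros)
  have int: "integrable lborel (\<lambda>u. F (Complex c u))" if "a \<le> c" "c \<le> b" for c
  proof (rule Bochner_Integration.integrable_bound[OF integrable_inverse_one_plus_square[of K]])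
    show "(\<lambda>u. F (Complex c u)) \<in> borel_measurable lborel"
      using contL[of c] that a by (simp add: borel_measurable_continuous_onI)
    show "AE u in lborel. norm (F (Complex c u)) \<le> norm (K / (1 + u\<^sup>2))"
      using bnd[of "Complex c u" for u] that by (intro AE_I2) (auto intro!: order_trans[OF _ divide_right_mono[OF abs_ge_self]])
  qed
  have FTC: "(LINT u:{-R..R}|lborel. F (Complex c u)) = (G (Complex c R) - G (Complex c (-R))) / \<i>"
    if "0 < c" "0 \<le> R" for c R
  proof -
    have "(LBINT u=-R..R. F (Complex c u)) = G (Complex c R) / \<i> - G (Complex c (-R)) / \<i>"
    proof (rule interval_integral_FTC_finite)
      show "continuous_on {min (-R) R..max (-R) R} (\<lambda>u. F (Complex c u))"
        using contL[OF that(1)] continuous_on_subset by blast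
      fix x
      have "((\<lambda>u. G (of_real c + \<i> * of_real u)) has_vector_derivative \<i> * F (of_real c + \<i> * of_real x)) (at x)"
        apply (rule field_vector_diff_chain_at[of "\<lambda>u. of_real c + \<i> * of_real u" \<i> x G, unfolded o_def, simplified])
         apply (auto intro!: derivative_eq_intros)[1]
        using G[of "of_real c + \<i> * of_real x"] that by simp
      then have "((\<lambda>u. G (Complex c u) / \<i>) has_vector_derivative (\<i> * F (Complex c x)) / \<i>) (at x)"
        unfolding Complex_eq divide_inverse by (rule has_vector_derivative_mult_left)
      then show "((\<lambda>u. G (Complex c u) / \<i>) has_vector_derivative F (Complex c x)) (at x within {min (-R) R..max (-R) R})"
        by (simp add: has_vector_derivative_at_within)
    qed
    then show ?thesis using that
      by (simp add: interval_integral_Icc algebra_simps)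
  qed
  have lim: "(\<lambda>n. LINT u:{-real n..real n}|lborel. F (Complex c u)) \<longlonglongrightarrow> (LINT u|lborel. F (Complex c u))"
    if "a \<le> c" "c \<le> b" for c
    unfolding set_lebesgue_integral_def
  proof (rule integral_dominated_convergence[where w="\<lambda>u. norm (F (Complex c u))"])
    show "integrable lborel (\<lambda>u. norm (F (Complex c u)))" using int[OF that] by simp
    show "(\<lambda>u. indicat_real {- real i..real i} u *\<^sub>R F (Complex c u)) \<in> borel_measurable lborel" for i
      using int[OF that] by (intro borel_measurable_scaleR) auto
    show "AE u in lborel. (\<lambda>i. indicat_real {- real i..real i} u *\<^sub>R F (Complex c u)) \<longlonglongrightarrow> F (Complex c u)"
    proof (rule AE_I2)
      fix u :: real
      obtain N where N: "\<bar>u\<bar> \<le> real N" using real_arch_simple by blast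
      have "\<forall>\<^sub>F i in sequentially. indicat_real {- real i..real i} u *\<^sub>R F (Complex c u) = F (Complex c u)"
        using eventually_ge_at_top[of N]
      proof eventually_elim
        case (elim i)
        then have "real N \<le> real i" by simp
        with N have "u \<in> {- real i..real i}" by auto
        then show ?case by simp
      qed
      then show "(\<lambda>i. indicat_real {- real i..real i} u *\<^sub>R F (Complex c u)) \<longlonglongrightarrow> F (Complex c u)"
        by (rule tendsto_eventually)
    qed
  qed (use int[OF that] in \<open>auto split: split_indicator\<close>)
  \<comment> \<open>On a horizontal segment the imaginary part is fixed, so the bound on
    \<open>F\<close> is constant there and the mean value inequality applies with length
    \<open>b - a\<close>.\<close>
  have mv: "norm (G (Complex b u) - G (Complex a u)) \<le> K / (1 + u\<^sup>2) * (b - a)" for u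
  proof -
    define S where "S = closed_segment (Complex a u) (Complex b u)"
    have S: "a \<le> Re z \<and> Re z \<le> b \<and> Im z = u" if z: "z \<in> S" for z
    proof -
      obtain t where t: "0 \<le> t" "t \<le> 1" "z = (1 - t) *\<^sub>R Complex a u + t *\<^sub>R Complex b u"
        using z unfolding S_def in_segment by metis
      have e: "Re z = a + t * (b - a)" "Im z = u" unfolding t(3) by (auto simp: algebra_simps)
      have "0 \<le> t * (b - a)" "t * (b - a) \<le> 1 * (b - a)" using t ab mult_right_mono[of t 1 "b - a"] by simp_all
      with e show ?thesis by simp
    qed
    have "norm (G (Complex b u) - G (Complex a u)) \<le> K / (1 + u\<^sup>2) * norm (Complex b u - Complex a u)"
    proof (rule field_differentiable_bound[where S = S and f' = F])
      fix z assume z: "z \<in> S"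
      show "(G has_field_derivative F z) (at z within S)"
        using G[of z] S[OF z] a by (simp add: has_field_derivative_at_within)
      show "norm (F z) \<le> K / (1 + u\<^sup>2)" using bnd[of z] S[OF z] by simp
    qed (auto simp: S_def)
    also have "norm (Complex b u - Complex a u) = b - a" using ab
      by (simp add: complex_diff complex_norm)
    finally show ?thesis .
  qed
  have "(\<lambda>n. (LINT u:{-real n..real n}|lborel. F (Complex b u)) - (LINT u:{-real n..real n}|lborel. F (Complex a u))) \<longlonglongrightarrow> 0"
  proof (rule Lim_null_comparison)
    show "\<forall>\<^sub>F n in sequentially. norm ((LINT u:{-real n..real n}|lborel. F (Complex b u)) - (LINT u:{-real n..real n}|lborel. F (Complex a u)))
       \<le> 2 * (b - a) * (K / (1 + (real n)\<^sup>2))"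
    proof (rule always_eventually, rule allI)
      fix n :: nat
      have "norm ((LINT u:{-real n..real n}|lborel. F (Complex b u)) - (LINT u:{-real n..real n}|lborel. F (Complex a u)))
        = norm (((G (Complex b n) - G (Complex a n)) - (G (Complex b (-n)) - G (Complex a (-n)))) / \<i>)"
        using a ab by (simp add: FTC diff_divide_distrib algebra_simps)
      also have "\<dots> \<le> norm (G (Complex b n) - G (Complex a n)) + norm (G (Complex b (-n)) - G (Complex a (-n)))"
        unfolding norm_divide by (simp add: norm_triangle_ineq4)
      also have "\<dots> \<le> K / (1 + (real n)\<^sup>2) * (b - a) + K / (1 + (real n)\<^sup>2) * (b - a)"
        using add_mono[OF mv[of "real n"] mv[of "- real n"]] by simp
      also have "\<dots> = 2 * (b - a) * (K / (1 + (real n)\<^sup>2))" by algebra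
      finally show "norm ((LINT u:{-real n..real n}|lborel. F (Complex b u)) - (LINT u:{-real n..real n}|lborel. F (Complex a u)))
       \<le> 2 * (b - a) * (K / (1 + (real n)\<^sup>2))" .
    qed
    show "(\<lambda>n. 2 * (b - a) * (K / (1 + (real n)\<^sup>2))) \<longlonglongrightarrow> 0"
    proof -
      have "(\<lambda>n. K / (1 + (real n)\<^sup>2)) \<longlonglongrightarrow> 0"
        by (rule real_tendsto_divide_at_top[OF tendsto_const])
          (intro filterlim_tendsto_add_at_top[OF tendsto_const] filterlim_pow_at_top filterlim_real_sequentially, simp)
      from tendsto_mult_right_zero[OF this] show ?thesis .
    qed
  qed
  moreover have "(\<lambda>n. (LINT u:{-real n..real n}|lborel. F (Complex b u)) - (LINT u:{-real n..real n}|lborel. F (Complex a u)))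
     \<longlonglongrightarrow> (LINT u|lborel. F (Complex b u)) - (LINT u|lborel. F (Complex a u))"
    using ab by (intro tendsto_diff lim) auto
  ultimately show ?thesis using LIMSEQ_unique by fastforce
qed

text \<open>Growth is measured in powers of \<open>1 + \<bar>Im w\<bar>\<close> because a Gaussian
  factor absorbs it later. The disjunction in the premise admits the imaginary axis itself
  (\<open>c = 0\<close>) for nonnegative exponents, as the limit of the line towards that axis
  requires; a negative exponent needs the distance \<open>c\<close> from the origin.\<close>

lemma norm_powr_le_linear_power:
  fixes c b a :: real
  assumes "0 < c \<or> 0 \<le> a" "0 \<le> c" "0 \<le> b"
  obtains L n where "0 \<le> L"
    "\<And>w. c \<le> Re w \<Longrightarrow> Re w \<le> b \<Longrightarrow> norm w powr a \<le> L * (1 + \<bar>Im w\<bar>) ^ n"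
proof (cases "0 \<le> a")
  case True
  define n where "n = nat \<lceil>a\<rceil>"
  have an: "a \<le> real n" by (simp add: n_def real_nat_ceiling_ge)
  show ?thesis
  proof (rule that[of "(1 + b) ^ n" n])
    fix w assume w: "c \<le> Re w" "Re w \<le> b"
    have "norm w \<le> (1 + b) * (1 + \<bar>Im w\<bar>)"
      using cmod_le[of w] w assms by (simp add: algebra_simps) (smt (verit) mult_nonneg_nonneg abs_ge_zero)
    then have "norm w powr a \<le> ((1 + b) * (1 + \<bar>Im w\<bar>)) powr a"
      using True by (intro powr_mono2) auto
    also have "\<dots> \<le> ((1 + b) * (1 + \<bar>Im w\<bar>)) powr real n"
    proof (rule powr_mono[OF an])
      have "1 * 1 \<le> (1 + b) * (1 + \<bar>Im w\<bar>)" using assms by (intro mult_mono) auto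
      then show "1 \<le> (1 + b) * (1 + \<bar>Im w\<bar>)" by simp
    qed
    also have "\<dots> = (1 + b) ^ n * (1 + \<bar>Im w\<bar>) ^ n"
      using assms by (subst powr_realpow) (auto simp: power_mult_distrib intro!: mult_pos_pos)
    finally show "norm w powr a \<le> (1 + b) ^ n * (1 + \<bar>Im w\<bar>) ^ n" .
  qed (use assms in auto)
next
  case False
  show ?thesis
  proof (rule that[of "c powr a" 0])
    fix w assume w: "c \<le> Re w" "Re w \<le> b"
    have "c \<le> norm w" using w complex_Re_le_cmod[of w] by linarith
    then show "norm w powr a \<le> c powr a * (1 + \<bar>Im w\<bar>) ^ 0"
      using False assms powr_mono2'[of a c "norm w"] by auto
  qed simp
qed

text \<open>The modulus of \<open>exp (w^2)\<close> is \<open>exp (Re^2 - Im^2)\<close>: Gaussian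
  along vertical lines, uniformly over a strip of bounded real part.\<close>

lemma norm_exp_square_powr_le:
  fixes c b a :: real
  assumes "0 < c \<or> 0 \<le> a" "0 \<le> c" "0 \<le> b"
  shows "\<exists>K\<ge>0. \<forall>w. c \<le> Re w \<longrightarrow> Re w \<le> b \<longrightarrow>
    norm (exp (w\<^sup>2)) * norm w powr a \<le> K / (1 + (Im w)\<^sup>2)"
proof -
  obtain L n where Ln: "0 \<le> L"
    "\<And>w. c \<le> Re w \<Longrightarrow> Re w \<le> b \<Longrightarrow> norm w powr a \<le> L * (1 + \<bar>Im w\<bar>) ^ n"
    using norm_powr_le_linear_power[OF assms] by metis
  show ?thesis
  proof (intro exI[of _ "exp (b\<^sup>2) * L * (fact (n + 2) * exp 2)"] conjI allI impI)
    fix w assume w: "c \<le> Re w" "Re w \<le> b"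
    have "(Re w)\<^sup>2 \<le> b\<^sup>2" using w assms by (intro power_mono) auto
    then have "norm (exp (w\<^sup>2)) \<le> exp (b\<^sup>2) * exp (- (\<bar>Im w\<bar>)\<^sup>2)"
      by (simp add: norm_exp_eq_Re power2_eq_square flip: exp_add)
    then have "norm (exp (w\<^sup>2)) * norm w powr a \<le> exp (b\<^sup>2) * exp (- (\<bar>Im w\<bar>)\<^sup>2) * (L * (1 + \<bar>Im w\<bar>) ^ n)"
      using Ln(2)[OF w] by (intro mult_mono) auto
    also have "\<dots> = exp (b\<^sup>2) * L * ((1 + \<bar>Im w\<bar>) ^ n * exp (- (\<bar>Im w\<bar>)\<^sup>2))" by simp
    also have "\<dots> \<le> exp (b\<^sup>2) * L * (fact (n + 2) * exp 2 / (1 + \<bar>Im w\<bar>\<^sup>2))"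
      using Ln(1) by (intro mult_left_mono power_mult_exp_neg_square_le) auto
    finally show "norm (exp (w\<^sup>2)) * norm w powr a \<le> exp (b\<^sup>2) * L * (fact (n + 2) * exp 2) / (1 + (Im w)\<^sup>2)"
      by simp
  qed (use Ln in auto)
qed

lemma continuous_on_vertical_line:
  assumes "F holomorphic_on {w. 0 < Re w}" "0 < c"
  shows "continuous_on UNIV (\<lambda>u. F (Complex c u))"
  using assms
  by (intro continuous_on_compose2[OF holomorphic_on_imp_continuous_on[OF assms(1)]])
    (auto simp: Complex_eq intro!: continuous_intros)

lemma integrable_vertical_line:
  fixes F :: "complex \<Rightarrow> complex"
  assumes "F holomorphic_on {w. 0 < Re w}" "0 < c"
    and "\<And>w. Re w = c \<Longrightarrow> norm (F w) \<le> L * (norm (exp (w\<^sup>2)) * norm w powr a)" "0 \<le> L"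
  shows "integrable lborel (\<lambda>u. F (Complex c u))"
proof -
  obtain K where K: "0 \<le> K"
    "\<And>w. c \<le> Re w \<Longrightarrow> Re w \<le> c \<Longrightarrow> norm (exp (w\<^sup>2)) * norm w powr a \<le> K / (1 + (Im w)\<^sup>2)"
    using norm_exp_square_powr_le[of c a c] assms(2) by (meson less_imp_le order_refl zero_le_one order_trans)
  show ?thesis
  proof (rule Bochner_Integration.integrable_bound[OF integrable_inverse_one_plus_square[of "L * K"]])
    show "(\<lambda>u. F (Complex c u)) \<in> borel_measurable lborel"
      using continuous_on_vertical_line[OF assms(1,2)] by (simp add: borel_measurable_continuous_onI)
    show "AE u in lborel. norm (F (Complex c u)) \<le> norm (L * K / (1 + u\<^sup>2))"
    proof (rule AE_I2)
      fix u
      have "norm (F (Complex c u)) \<le> L * (K / (1 + u\<^sup>2))"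
        using assms(3)[of "Complex c u"] mult_left_mono[OF K(2)[of "Complex c u"] assms(4)] by simp
      then show "norm (F (Complex c u)) \<le> norm (L * K / (1 + u\<^sup>2))"
        using assms K by simp
    qed
  qed
qed

text \<open>The growth bound holds in the whole half-plane, while an integrable majorant is obtained
  strip by strip; \<open>K\<close> is therefore chosen anew for each pair of lines.\<close>

lemma integral_vertical_line_indep:
  fixes F :: "complex \<Rightarrow> complex"
  assumes "F holomorphic_on {w. 0 < Re w}" "0 < c" "0 < c'"
    and "\<And>w. 0 < Re w \<Longrightarrow> norm (F w) \<le> L * (norm (exp (w\<^sup>2)) * norm w powr a)" "0 \<le> L"
  shows "(LINT u|lborel. F (Complex c u)) = (LINT u|lborel. F (Complex c' u))"
proof -
  have *: "(LINT u|lborel. F (Complex c u)) = (LINT u|lborel. F (Complex c' u))"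
    if cc: "c \<le> c'" "0 < c" for c c'
  proof -
    obtain K where K: "0 \<le> K"
      "\<And>w. c \<le> Re w \<Longrightarrow> Re w \<le> c' \<Longrightarrow> norm (exp (w\<^sup>2)) * norm w powr a \<le> K / (1 + (Im w)\<^sup>2)"
      using norm_exp_square_powr_le[of c a c'] cc by (meson less_imp_le order_refl zero_le_one order_trans)
    show ?thesis
    proof (rule integral_vertical_line_shift[OF assms(1) cc(2,1)])
      fix w assume w: "c \<le> Re w" "Re w \<le> c'"
      then show "norm (F w) \<le> (L * K) / (1 + (Im w)\<^sup>2)"
        using assms(4)[of w] mult_left_mono[OF K(2)[OF w] assms(5)] cc by simp
    qed
  qed
  show ?thesis
  proof (cases "c \<le> c'")
    case True then show ?thesis using * assms(2) by blast
  next
    case False then show ?thesis using *[of c' c] assms(3) by simp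
  qed
qed

text \<open>Hankel's contour integral for the reciprocal Gamma function after the substitution \<open>s = w\<^sup>2\<close>, which
  turns the contour into a vertical line on which the integrand has Gaussian decay.\<close>

definition hankel_line :: "real \<Rightarrow> real \<Rightarrow> complex" where
  "hankel_line c a = (LINT u|lborel. exp ((Complex c u)\<^sup>2) * Complex c u powr of_real a)"

lemma holomorphic_exp_square_powr:
  "(\<lambda>w. exp (w\<^sup>2) * w powr of_real a) holomorphic_on {w. 0 < Re w}"
  by (intro holomorphic_intros) (auto simp: complex_nonpos_Reals_iff)

lemma norm_exp_square_powr:
  fixes w :: complex
  shows "norm (exp (w\<^sup>2) * w powr of_real a) = norm (exp (w\<^sup>2)) * norm w powr a"
  by (simp add: norm_mult norm_powr_real_powr')

lemma integrable_hankel_line: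
  "0 < c \<Longrightarrow> integrable lborel (\<lambda>u. exp ((Complex c u)\<^sup>2) * Complex c u powr of_real a)"
  by (rule integrable_vertical_line[OF holomorphic_exp_square_powr, where L = 1 and a = a])
    (auto simp: norm_exp_square_powr)

lemma hankel_line_indep: "0 < c \<Longrightarrow> 0 < c' \<Longrightarrow> hankel_line c a = hankel_line c' a"
  unfolding hankel_line_def
  by (rule integral_vertical_line_indep[OF holomorphic_exp_square_powr, where L = 1 and a = a])
    (auto simp: norm_exp_square_powr)

section \<open>Evaluation of the Hankel integral\<close>

text \<open>The combined integrand is the derivative of \<open>exp (w^2) * w powr a\<close>, which
  vanishes at both ends of the line. With \<open>a = - 2 z\<close> this is the functional equation
  \<open>rGamma z = z * rGamma (z + 1)\<close> in disguise.\<close>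

lemma hankel_line_recurrence:
  assumes c: "0 < c"
  shows "2 * hankel_line c (a + 1) + of_real a * hankel_line c (a - 1) = 0"
proof -
  define G where "G w = exp (w\<^sup>2) * w powr of_real a" for w :: complex
  define g where "g w = 2 * (exp (w\<^sup>2) * w powr of_real (a + 1)) + of_real a * (exp (w\<^sup>2) * w powr of_real (a - 1))" for w :: complex
  have dG: "(G has_field_derivative g w) (at w)" if "0 < Re w" for w
  proof -
    have nz: "w \<noteq> 0" "w \<notin> \<real>\<^sub>\<le>\<^sub>0" using that by (auto simp: complex_nonpos_Reals_iff)
    have p: "w powr (of_real a + 1) = w powr of_real a * w" "w powr (1 + of_real a) = w powr of_real a * w"
      using nz by (simp_all add: powr_add)
    show ?thesis unfolding G_def g_def using nz
      by (auto intro!: derivative_eq_intros simp: p algebra_simps)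
  qed
  have int: "integrable lborel (\<lambda>u. g (Complex c u))"
    unfolding g_def by (intro Bochner_Integration.integrable_add integrable_mult_right integrable_hankel_line[OF c])
  obtain K where K: "0 \<le> K"
    "\<And>w. c \<le> Re w \<Longrightarrow> Re w \<le> c \<Longrightarrow> norm (exp (w\<^sup>2)) * norm w powr a \<le> K / (1 + (Im w)\<^sup>2)"
    using norm_exp_square_powr_le[of c a c] c by (meson less_imp_le order_refl zero_le_one order_trans)
  have lim: "((\<lambda>u. G (Complex c u)) \<longlongrightarrow> 0) F" if "F \<le> at_infinity" for F
  proof (rule Lim_null_comparison)
    show "\<forall>\<^sub>F u in F. norm (G (Complex c u)) \<le> K / (1 + u\<^sup>2)"
      using K(2)[of "Complex c u" for u] by (simp add: G_def norm_exp_square_powr)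
    have "LIM u F. norm (u::real) :> at_top"
      using that filterlim_norm_at_top filterlim_mono by blast
    then have "LIM u F. (norm (u::real))\<^sup>2 :> at_top"
      by (intro filterlim_pow_at_top) auto
    then have "LIM u F. 1 + (u::real)\<^sup>2 :> at_top"
      by (intro filterlim_tendsto_add_at_top[OF tendsto_const]) simp
    then show "((\<lambda>u. K / (1 + u\<^sup>2)) \<longlongrightarrow> 0) F"
      by (rule real_tendsto_divide_at_top[OF tendsto_const])
  qed
  have "(LBINT u=-\<infinity>..\<infinity>. g (Complex c u)) = 0 / \<i> - 0 / \<i>"
  proof (rule interval_integral_FTC_integrable)
    fix x :: real
    show "((\<lambda>u. G (Complex c u) / \<i>) has_vector_derivative g (Complex c x)) (at x)"
    proof -
      have "((\<lambda>u. G (of_real c + \<i> * of_real u)) has_vector_derivative \<i> * g (of_real c + \<i> * of_real x)) (at x)"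
        apply (rule field_vector_diff_chain_at[of "\<lambda>u. of_real c + \<i> * of_real u" \<i> x G, unfolded o_def, simplified])
         apply (auto intro!: derivative_eq_intros)[1]
        using dG[of "of_real c + \<i> * of_real x"] c by simp
      then have "((\<lambda>u. G (Complex c u) / \<i>) has_vector_derivative (\<i> * g (Complex c x)) / \<i>) (at x)"
        unfolding Complex_eq divide_inverse by (rule has_vector_derivative_mult_left)
      then show ?thesis by simp
    qed
    have "g holomorphic_on {w. 0 < Re w}" unfolding g_def
      by (intro holomorphic_intros) (auto simp: complex_nonpos_Reals_iff)
    then show "isCont (\<lambda>u. g (Complex c u)) x"
      using continuous_on_vertical_line[of g c] c by (simp add: continuous_on_eq_continuous_at)
    show "set_integrable lborel (einterval (-\<infinity>) \<infinity>) (\<lambda>u. g (Complex c u))"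
      using int by (simp add: set_integrable_def)
    show "(((\<lambda>u. G (Complex c u) / \<i>) \<circ> real_of_ereal) \<longlongrightarrow> 0 / \<i>) (at_right (-\<infinity>))"
      unfolding ereal_tendsto_simps by (intro tendsto_intros lim at_bot_le_at_infinity) simp
    show "(((\<lambda>u. G (Complex c u) / \<i>) \<circ> real_of_ereal) \<longlongrightarrow> 0 / \<i>) (at_left \<infinity>)"
      unfolding ereal_tendsto_simps by (intro tendsto_intros lim at_top_le_at_infinity) simp
  qed simp
  then have "(LINT u|lborel. g (Complex c u)) = 0"
    by (simp add: interval_lebesgue_integral_def set_lebesgue_integral_def)
  moreover have "(LINT u|lborel. g (Complex c u)) = 2 * hankel_line c (a + 1) + of_real a * hankel_line c (a - 1)"
    unfolding g_def hankel_line_def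
    by (subst Bochner_Integration.integral_add)
      (intro integrable_mult_right integrable_hankel_line[OF c], intro integrable_mult_right integrable_hankel_line[OF c],
       simp only: integral_mult_right_zero)
  ultimately show ?thesis by simp
qed

text \<open>Euler's integral under \<open>t = u^2\<close>: the half-line carries half of the Gamma
  value and evenness supplies the other half.\<close>

lemma has_bochner_integral_exp_neg_square_abs_powr:
  assumes "0 \<le> a"
  shows "has_bochner_integral lborel (\<lambda>u::real. exp (- u\<^sup>2) * \<bar>u\<bar> powr a) (Gamma ((a + 1) / 2))"
proof -
  define f where "f t = t powr ((a + 1) / 2 - 1) / exp t" for t :: real
  have eq: "f (u\<^sup>2) * (2 * u) = 2 * (exp (- u\<^sup>2) * \<bar>u\<bar> powr a)" if "0 < u" for u :: real
  proof -
    have "(u\<^sup>2) powr ((a + 1) / 2 - 1) * u = u powr a"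
    proof -
      have "(u\<^sup>2) powr ((a + 1) / 2 - 1) = (u powr 2) powr ((a + 1) / 2 - 1)"
        using that by simp
      also have "\<dots> = u powr (2 * ((a + 1) / 2 - 1))" by (rule powr_powr)
      also have "2 * ((a + 1) / 2 - 1) = a - 1" by (simp add: field_simps)
      finally have "(u\<^sup>2) powr ((a + 1) / 2 - 1) * u = u powr (a - 1) * u powr 1"
        using that by simp
      also have "\<dots> = u powr a" by (subst powr_add[symmetric]) simp
      finally show ?thesis .
    qed
    then show ?thesis using that by (simp add: f_def exp_minus field_simps)
  qed
  obtain K where K: "0 \<le> K"
    "\<And>w. 0 \<le> Re w \<Longrightarrow> Re w \<le> 0 \<Longrightarrow> norm (exp (w\<^sup>2)) * norm w powr a \<le> K / (1 + (Im w)\<^sup>2)"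
    using norm_exp_square_powr_le[of 0 a 0] assms by (meson less_imp_le order_refl zero_le_one order_trans)
  have int: "integrable lborel (\<lambda>u::real. exp (- u\<^sup>2) * \<bar>u\<bar> powr a)"
  proof (rule Bochner_Integration.integrable_bound[OF integrable_inverse_one_plus_square[of K]])
    show "AE u in lborel. norm (exp (- u\<^sup>2) * \<bar>u\<bar> powr a) \<le> norm (K / (1 + u\<^sup>2))"
    proof (rule AE_I2)
      fix u :: real
      have "(Complex 0 u)\<^sup>2 = of_real (- u\<^sup>2)" by (simp add: complex_eq_iff power2_eq_square)
      then have "norm (exp ((Complex 0 u)\<^sup>2)) = exp (- u\<^sup>2)" by (simp del: of_real_minus of_real_power)
      then show "norm (exp (- u\<^sup>2) * \<bar>u\<bar> powr a) \<le> norm (K / (1 + u\<^sup>2))"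
        using K(2)[of "Complex 0 u"] K(1) by (simp add: complex_norm)
    qed
  qed simp
  have int2: "set_integrable lborel (einterval 0 \<infinity>) (\<lambda>u. f (u\<^sup>2) * (2 * u))"
  proof -
    have "integrable lborel (\<lambda>u. indicat_real {0<..} u *\<^sub>R (2 * (exp (- u\<^sup>2) * \<bar>u\<bar> powr a)))"
      by (intro integrable_mult_indicator integrable_mult_right int) simp
    moreover have "(\<lambda>u. indicat_real {0<..} u *\<^sub>R (2 * (exp (- u\<^sup>2) * \<bar>u\<bar> powr a))) = (\<lambda>u. indicat_real {0<..} u *\<^sub>R (f (u\<^sup>2) * (2 * u)))"
      using eq by (auto simp: fun_eq_iff split: split_indicator)
    ultimately show ?thesis by (simp add: set_integrable_def zero_ereal_def)
  qed
  have sub: "set_integrable lborel (einterval 0 \<infinity>) f"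
    "(LBINT t=0..\<infinity>. f t) = (LBINT u=0..\<infinity>. f (u\<^sup>2) * (2 * u))"
  proof -
    have "((ereal \<circ> (\<lambda>u. u\<^sup>2) \<circ> real_of_ereal) \<longlongrightarrow> ereal (0\<^sup>2)) (at_right (ereal 0))"
      unfolding ereal_tendsto_simps by (intro tendsto_intros)
    then have A: "((ereal \<circ> (\<lambda>u. u\<^sup>2) \<circ> real_of_ereal) \<longlongrightarrow> 0) (at_right 0)"
      by (simp add: zero_ereal_def)
    have B: "((ereal \<circ> (\<lambda>u. u\<^sup>2) \<circ> real_of_ereal) \<longlongrightarrow> \<infinity>) (at_left \<infinity>)"
      unfolding ereal_tendsto_simps by (intro filterlim_pow_at_top filterlim_ident) simp
    note * = interval_integral_substitution_nonneg[OF _ _ _ _ _ _ A B int2]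
    have d: "((\<lambda>u. u\<^sup>2) has_real_derivative 2 * x) (at x)" for x :: real
      by (auto intro!: derivative_eq_intros)
    have co: "isCont f (x\<^sup>2)" if "0 < ereal x" for x :: real
      using that unfolding f_def by (intro continuous_intros) auto
    have nn: "0 \<le> f t" for t by (simp add: f_def)
    show "set_integrable lborel (einterval 0 \<infinity>) f"
      by (rule *) (use d co nn in auto)
    show "(LBINT t=0..\<infinity>. f t) = (LBINT u=0..\<infinity>. f (u\<^sup>2) * (2 * u))"
      by (rule *) (use d co nn in auto)
  qed
  have "(f has_integral Gamma ((a + 1) / 2)) {0..}"
    unfolding f_def using assms by (intro Gamma_integral_real) auto
  then have "(f has_integral Gamma ((a + 1) / 2)) {0<..}"
    by (subst (asm) has_integral_spike_set_eq[where T = "{0<..}"]) (auto intro: negligible_subset[of "{0}"])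
  then have "integral {0<..} f = Gamma ((a + 1) / 2)" by (rule integral_unique)
  moreover have "(LBINT t=0..\<infinity>. f t) = integral {0<..} f"
    using set_borel_integral_eq_integral(2)[OF sub(1)] by (simp add: interval_lebesgue_integral_def zero_ereal_def)
  moreover have "(LBINT u=0..\<infinity>. f (u\<^sup>2) * (2 * u)) = 2 * (LINT u|lborel. indicat_real {0..} u *\<^sub>R (exp (- u\<^sup>2) * \<bar>u\<bar> powr a))"
  proof -
    have "indicat_real {0<..} u *\<^sub>R (f (u\<^sup>2) * (2 * u)) = 2 * (indicat_real {0..} u *\<^sub>R (exp (- u\<^sup>2) * \<bar>u\<bar> powr a))" for u
      by (cases "u > 0"; cases "u = 0") (auto simp: eq)
    note e = this
    have "(LBINT u=0..\<infinity>. f (u\<^sup>2) * (2 * u)) = (LINT u|lborel. 2 * (indicat_real {0..} u *\<^sub>R (exp (- u\<^sup>2) * \<bar>u\<bar> powr a)))"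
      unfolding interval_lebesgue_integral_def set_lebesgue_integral_def
      by (simp add: zero_ereal_def e[unfolded real_scaleR_def] del: integral_mult_right_zero integral_mult_right mult_cancel_left)
    then show ?thesis by simp
  qed
  ultimately have v: "(LINT u|lborel. indicat_real {0..} u *\<^sub>R (exp (- u\<^sup>2) * \<bar>u\<bar> powr a)) = Gamma ((a + 1) / 2) / 2"
    using sub(2) by simp
  have "has_bochner_integral lborel (\<lambda>u. indicat_real {0..} u *\<^sub>R (exp (- u\<^sup>2) * \<bar>u\<bar> powr a)) (Gamma ((a + 1) / 2) / 2)"
    unfolding v[symmetric] by (intro has_bochner_integral_integrable integrable_mult_indicator int) simp
  from has_bochner_integral_even_function[OF this] show ?thesis by simp
qed

text \<open>For a nonnegative exponent the majorant survives down to real part \<open>0\<close>, so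
  the line can be pushed onto the imaginary axis, where \<open>exp (w^2)\<close> is
  \<open>exp (- u^2)\<close> and \<open>w powr a\<close> has phase \<open>\<pi> a / 2\<close> or
  \<open>- \<pi> a / 2\<close>. Both phases have the same cosine.\<close>

lemma Re_hankel_line_nonneg_exponent:
  assumes a: "0 \<le> a" and c: "0 < c"
  shows "Re (hankel_line c a) = cos (pi * a / 2) * Gamma ((a + 1) / 2)"
proof -
  define F where "F w = exp (w\<^sup>2) * w powr of_real a" for w :: complex
  obtain K where K: "0 \<le> K"
    "\<And>w. 0 \<le> Re w \<Longrightarrow> Re w \<le> 1 \<Longrightarrow> norm (exp (w\<^sup>2)) * norm w powr a \<le> K / (1 + (Im w)\<^sup>2)"
    using norm_exp_square_powr_le[of 0 a 1] a by (meson less_imp_le order_refl zero_le_one order_trans)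
  have ReI: "Re (hankel_line d a) = (LINT u|lborel. Re (F (Complex d u)))" if "0 < d" for d
    unfolding hankel_line_def F_def
    by (rule integral_bounded_linear[OF bounded_linear_Re integrable_hankel_line[OF that], symmetric])
  have lv: "Re (F (Complex 0 u)) = cos (pi * a / 2) * (exp (- u\<^sup>2) * \<bar>u\<bar> powr a)" if "u \<noteq> 0" for u
  proof -
    have nz: "Complex 0 u \<noteq> 0" using that by (simp add: complex_eq_iff)
    have arg: "Arg (Complex 0 u) = (if 0 < u then pi / 2 else - pi / 2)"
      using that pi_gt_zero by (intro Arg_unique'[where r = "\<bar>u\<bar>"]) (auto simp: complex_eq_iff simp del: pi_gt_zero)
    have "Ln (Complex 0 u) = Complex (ln \<bar>u\<bar>) (if 0 < u then pi / 2 else - pi / 2)"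
      using nz arg by (auto simp: complex_eq_iff Arg_eq_Im_Ln complex_norm)
    then have "Complex 0 u powr of_real a = exp (Complex (a * ln \<bar>u\<bar>) (a * (if 0 < u then pi / 2 else - pi / 2)))"
      using nz by (simp add: powr_def complex_eq_iff Re_exp Im_exp)
    moreover have "(Complex 0 u)\<^sup>2 = of_real (- u\<^sup>2)" by (simp add: complex_eq_iff power2_eq_square)
    then have "exp ((Complex 0 u)\<^sup>2) = of_real (exp (- u\<^sup>2))" by (simp only: exp_of_real)
    ultimately show ?thesis using that
      by (auto simp: F_def Re_exp powr_def mult.commute)
  qed
  have "(\<lambda>n. LINT u|lborel. Re (F (Complex (inverse (real (Suc n))) u))) \<longlonglongrightarrow>
     (LINT u|lborel. cos (pi * a / 2) * (exp (- u\<^sup>2) * \<bar>u\<bar> powr a))"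
  proof (rule integral_dominated_convergence[where w="\<lambda>u. K / (1 + u\<^sup>2)"])
    show "integrable lborel (\<lambda>u. K / (1 + u\<^sup>2))" by (rule integrable_inverse_one_plus_square)
    show "(\<lambda>u. Re (F (Complex (inverse (real (Suc i))) u))) \<in> borel_measurable lborel" for i
      unfolding F_def using integrable_hankel_line[of "inverse (real (Suc i))" a]
      by (intro borel_measurable_integrable integrable_Re) auto
    show "AE u in lborel. (\<lambda>n. Re (F (Complex (inverse (real (Suc n))) u)))
        \<longlonglongrightarrow> cos (pi * a / 2) * (exp (- u\<^sup>2) * \<bar>u\<bar> powr a)"
      \<comment> \<open>The origin is the only point of the imaginary axis on the branch cut of
        \<open>powr\<close>, and it is a null set.\<close>
      using AE_lborel_singleton[of "0::real"]
    proof eventually_elim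
      case (elim u)
      have "(\<lambda>n. F (Complex (inverse (real (Suc n))) u)) \<longlonglongrightarrow> F (Complex 0 u)"
        unfolding F_def
        by (intro tendsto_intros tendsto_Complex LIMSEQ_inverse_real_of_nat tendsto_powr_complex)
          (use elim in \<open>auto simp: complex_nonpos_Reals_iff\<close>)
      then show ?case using lv[of u] elim tendsto_Re by fastforce
    qed
    show "AE u in lborel. norm (Re (F (Complex (inverse (real (Suc i))) u))) \<le> K / (1 + u\<^sup>2)" for i
    proof (rule AE_I2)
      fix u
      have "norm (Re (F (Complex (inverse (real (Suc i))) u))) \<le> norm (F (Complex (inverse (real (Suc i))) u))"
        by (simp add: abs_Re_le_cmod)
      also have "\<dots> \<le> K / (1 + u\<^sup>2)"
        using K(2)[of "Complex (inverse (real (Suc i))) u"] by (simp add: F_def norm_exp_square_powr inverse_le_1_iff)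
      finally show "norm (Re (F (Complex (inverse (real (Suc i))) u))) \<le> K / (1 + u\<^sup>2)" .
    qed
  qed simp
  moreover have "(LINT u|lborel. Re (F (Complex (inverse (real (Suc n))) u))) = Re (hankel_line c a)" for n
    using ReI[of "inverse (real (Suc n))"] hankel_line_indep[OF c, of "inverse (real (Suc n))" a] by simp
  moreover have "(LINT u|lborel. cos (pi * a / 2) * (exp (- u\<^sup>2) * \<bar>u\<bar> powr a)) = cos (pi * a / 2) * Gamma ((a + 1) / 2)"
    using has_bochner_integral_integral_eq[OF has_bochner_integral_exp_neg_square_abs_powr[OF a]] by simp
  ultimately show ?thesis by (simp add: LIMSEQ_const_iff)
qed

text \<open>With \<open>s = w^2\<close> and \<open>dw = i du\<close>, Hankel's formula for
  \<open>rGamma z\<close>, namely \<open>1 / (2 \<pi> i)\<close> times the integral of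
  \<open>exp s * s powr (- z)\<close>, becomes this identity; the exponent \<open>1 - 2 z\<close>
  includes the Jacobian \<open>2 w\<close>. Near zero it follows from the reflection formula, and
  the recurrence carries it to larger \<open>z\<close>.\<close>

lemma Re_hankel_line_eq_rGamma:
  assumes c: "0 < c" and z: "0 < z"
  shows "Re (hankel_line c (1 - 2 * z)) = pi * rGamma z"
proof -
  define h where "h z = Re (hankel_line c (1 - 2 * z))" for z
  have step: "h z = z * h (z + 1)" for z
  proof -
    have e: "- 2 * z + 1 = 1 - 2 * z" "- 2 * z - 1 = 1 - 2 * (z + 1)" by auto
    show ?thesis
      using hankel_line_recurrence[OF c, of "- 2 * z", THEN arg_cong[where f = Re]]
      unfolding e h_def by simp
  qed
  have r: "rGamma (complex_of_real z) = of_real (rGamma z)" for z :: real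
    by (simp add: rGamma_inverse_Gamma Gamma_complex_of_real)
  have refl: "rGamma z * rGamma (1 - z) = sin (pi * z) / pi" for z :: real
  proof -
    have "complex_of_real (rGamma z * rGamma (1 - z)) = rGamma (of_real z) * rGamma (1 - of_real z)"
      using r[of z] r[of "1 - z"] by simp
    also have "\<dots> = of_real (sin (pi * z) / pi)"
      using rGamma_reflection_complex[of "of_real z"] by (simp add: sin_of_real flip: of_real_mult)
    finally show ?thesis by (simp only: of_real_eq_iff)
  qed
  \<comment> \<open>Here the exponent \<open>1 - 2 z\<close> is nonnegative, so the value on the
    imaginary axis is available. The interval has length \<open>1\<close>, the step of the
    recurrence.\<close>
  have base: "h z = pi * rGamma z" if "- 1/2 \<le> z" "z \<le> 1/2" for z
  proof -
    have "h z = cos (pi * (1 - 2 * z) / 2) * Gamma (1 - z)"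
    proof -
      have e: "(1 - 2 * z + 1) / 2 = 1 - z" by simp
      have "h z = cos (pi * (1 - 2 * z) / 2) * Gamma ((1 - 2 * z + 1) / 2)"
        unfolding h_def using that c by (intro Re_hankel_line_nonneg_exponent) auto
      then show ?thesis unfolding e .
    qed
    also have "cos (pi * (1 - 2 * z) / 2) = sin (pi * z)"
      by (simp add: sin_cos_eq algebra_simps diff_divide_distrib)
    also have "sin (pi * z) = pi * (rGamma z * rGamma (1 - z))" using refl[of z] by simp
    also have "\<dots> * Gamma (1 - z) = pi * rGamma z * (rGamma (1 - z) * Gamma (1 - z))" by simp
    also have "rGamma (1 - z) * Gamma (1 - z) = 1"
    proof -
      have "0 < Gamma (1 - z)" using that by (intro Gamma_real_pos) simp
      then show ?thesis by (simp add: rGamma_inverse_Gamma)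
    qed
    finally show ?thesis by simp
  qed
  have shift: "h z = pi * rGamma z" if "h (z - 1) = pi * rGamma (z - 1)" "z \<noteq> 1" for z
  proof -
    have "(z - 1) * h z = (z - 1) * (pi * rGamma z)"
      using step[of "z - 1"] rGamma_plus1[of "z - 1"] that(1) by (simp add: mult.left_commute)
    then show ?thesis using that(2) by simp
  qed
  have base1: "h z = pi * rGamma z" if "1/2 \<le> z" "z \<le> 3/2" "z \<noteq> 1" for z
    using shift[OF base[of "z - 1"]] that by simp
  \<comment> \<open>At \<open>z = 1\<close> the recurrence carries no information because its factor vanishes.\<close>
  have one: "h 1 = pi * rGamma 1"
  proof -
    define b where "b n = 1 + inverse (real (Suc (Suc n)))" for n
    have b: "1 \<le> b n" "b n \<le> 3/2" "b n \<noteq> 1" for n by (auto simp: b_def field_simps)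
    have blim: "b \<longlonglongrightarrow> 1"
      unfolding b_def using tendsto_add[OF tendsto_const[of 1] LIMSEQ_Suc[OF LIMSEQ_inverse_real_of_nat]] by simp
    have "(\<lambda>n. hankel_line 1 (1 - 2 * b n)) \<longlonglongrightarrow> hankel_line 1 (1 - 2 * 1)"
      unfolding hankel_line_def
    \<comment> \<open>On the line \<open>Re w = 1\<close> the modulus of \<open>w\<close> is at
      least \<open>1\<close>, so the negative exponents \<open>1 - 2 * b n\<close> are dominated by
      the exponent \<open>0\<close>.\<close>
    proof (rule integral_dominated_convergence[where w="\<lambda>u. norm (exp ((Complex 1 u)\<^sup>2) * Complex 1 u powr of_real 0)"])
      show "integrable lborel (\<lambda>u. norm (exp ((Complex 1 u)\<^sup>2) * Complex 1 u powr of_real 0))"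
        by (intro integrable_norm integrable_hankel_line) simp
      show "AE u in lborel. (\<lambda>n. exp ((Complex 1 u)\<^sup>2) * Complex 1 u powr of_real (1 - 2 * b n))
         \<longlonglongrightarrow> exp ((Complex 1 u)\<^sup>2) * Complex 1 u powr of_real (1 - 2 * 1)"
        by (intro AE_I2 tendsto_intros tendsto_powr_complex blim) (auto simp: complex_nonpos_Reals_iff)
      show "AE u in lborel. norm (exp ((Complex 1 u)\<^sup>2) * Complex 1 u powr of_real (1 - 2 * b n))
         \<le> norm (exp ((Complex 1 u)\<^sup>2) * Complex 1 u powr of_real 0)" for n
      proof (rule AE_I2)
        fix u
        have "1 \<le> norm (Complex 1 u)" using complex_Re_le_cmod[of "Complex 1 u"] by simp
        then have "norm (Complex 1 u) powr (1 - 2 * b n) \<le> norm (Complex 1 u) powr 0"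
          using b[of n] by (intro powr_mono) auto
        then show "norm (exp ((Complex 1 u)\<^sup>2) * Complex 1 u powr of_real (1 - 2 * b n))
          \<le> norm (exp ((Complex 1 u)\<^sup>2) * Complex 1 u powr of_real 0)"
          unfolding norm_exp_square_powr by (intro mult_left_mono) auto
      qed
    qed (rule borel_measurable_integrable[OF integrable_hankel_line]; simp)+
    then have "(\<lambda>n. Re (hankel_line 1 (1 - 2 * b n))) \<longlonglongrightarrow> Re (hankel_line 1 (1 - 2 * 1))"
      by (rule tendsto_Re)
    then have "(\<lambda>n. h (b n)) \<longlonglongrightarrow> h 1"
      unfolding h_def using hankel_line_indep[OF c, of 1] by simp
    moreover have "h (b n) = pi * rGamma (b n)" for n using base1[of "b n"] b[of n] by simp
    moreover have "(\<lambda>n. pi * rGamma (b n)) \<longlonglongrightarrow> pi * rGamma 1"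
      by (intro tendsto_intros continuous_on_tendsto_compose[OF continuous_on_rGamma[of UNIV] blim]) auto
    ultimately show ?thesis using LIMSEQ_unique by fastforce
  qed
  have "h z = pi * rGamma z" if "0 < z" "z \<le> real n + 1" for z n
    using that
  proof (induction n arbitrary: z)
    case 0
    then show ?case using base[of z] base1[of z] one by (cases "z \<le> 1/2"; cases "z = 1") auto
  next
    case (Suc n)
    show ?case
    proof (cases "z \<le> real n + 1")
      case True then show ?thesis using Suc by simp
    next
      case False
      then have "h (z - 1) = pi * rGamma (z - 1)" using Suc.IH[of "z - 1"] Suc.prems by simp
      then show ?thesis using shift[of z] False by simp
    qed
  qed
  then show ?thesis using z real_arch_simple[of z] unfolding h_def by (meson add_increasing2 zero_le_one)
qed

section \<open>The Mittag-Leffler function on the negative axis\<close>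

text \<open>The argument of \<open>w\<close> is below \<open>\<pi> / 2\<close> in modulus, so
  \<open>w powr (2 a)\<close> stays in the sector of half-angle \<open>\<pi> a\<close>, which omits
  the negative axis; \<open>x * sin (\<pi> a)\<close> is the distance of \<open>- x\<close> from the
  line carrying an edge of that sector.\<close>

lemma norm_powr_add_of_real_ge:
  assumes a: "0 < a" "a < 1" and w: "0 < Re w" and x: "0 < x"
  shows "x * sin (pi * a) \<le> norm (w powr of_real (2 * a) + of_real x)"
proof -
  define r where "r = norm w powr (2 * a)"
  define t where "t = 2 * a * Arg w"
  have nz: "w \<noteq> 0" using w by auto
  have "\<bar>Arg w\<bar> < pi / 2" using Arg_Re_pos[of w] w by blast
  then have "2 * a * \<bar>Arg w\<bar> \<le> 2 * a * (pi / 2)" using a by (intro mult_left_mono) auto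
  then have t: "\<bar>t\<bar> \<le> pi * a" using a by (simp add: t_def abs_mult mult.commute)
  have "cos (pi * a) \<le> cos \<bar>t\<bar>"
    using t a by (intro cos_monotone_0_pi_le) auto
  then have ct: "cos (pi * a) \<le> cos t" by simp
  have rcis: "w powr of_real (2 * a) = of_real r * exp (\<i> * of_real t)"
  proof -
    have "Ln w = of_real (ln (norm w)) + \<i> * of_real (Arg w)"
      using nz by (simp add: complex_eq_iff Arg_eq_Im_Ln)
    then have "w powr of_real (2 * a) = exp (of_real (2 * a * ln (norm w)) + \<i> * of_real t)"
      using nz by (simp add: powr_def t_def algebra_simps)
    also have "\<dots> = of_real r * exp (\<i> * of_real t)"
      using nz by (simp add: exp_add r_def powr_def flip: exp_of_real)
    finally show ?thesis .
  qed
  have r0: "0 \<le> r" by (simp add: r_def)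
  have "(x * sin (pi * a))\<^sup>2 \<le> (r + x * cos (pi * a))\<^sup>2 + (x * sin (pi * a))\<^sup>2" by simp
  also have "\<dots> = r\<^sup>2 + 2 * (r * x) * cos (pi * a) + x\<^sup>2"
    using sin_cos_squared_add[of "pi * a"] by algebra
  also have "\<dots> \<le> r\<^sup>2 + 2 * (r * x) * cos t + x\<^sup>2"
    using ct r0 x by (intro add_mono mult_left_mono) auto
  also have "\<dots> = (r * cos t + x)\<^sup>2 + (r * sin t)\<^sup>2"
    using sin_cos_squared_add[of t] by algebra
  also have "\<dots> = (norm (w powr of_real (2 * a) + of_real x))\<^sup>2"
    unfolding rcis cmod_power2 by (simp add: Re_exp Im_exp)
  finally show ?thesis by (rule power2_le_imp_le) simp
qed

text \<open>Far to the right the quotient is a geometric series in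
  \<open>- x * w powr (- 2 a)\<close>; integrating it termwise produces the reciprocal Gamma values
  of the power series. The denominator has no zero in the half-plane, so the line can be brought
  back to \<open>Re w = 1\<close>, independently of \<open>x\<close>.\<close>

lemma mittag_leffler_eq_line_integral:
  assumes a: "0 < a" "a < 1" and x: "0 < x"
  shows "pi * mittag_leffler a 1 (- x) =
    Re (LINT u|lborel. exp ((Complex 1 u)\<^sup>2) * Complex 1 u powr of_real (2 * a - 1) /
      (Complex 1 u powr of_real (2 * a) + of_real x))"
proof -
  define G where "G w = exp (w\<^sup>2) * w powr of_real (2 * a - 1) / (w powr of_real (2 * a) + of_real x)" for w :: complex
  have s: "0 < sin (pi * a)" using a by (intro sin_gt_zero) auto
  have den: "w powr of_real (2 * a) + of_real x \<noteq> 0" if "0 < Re w" for w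
    using norm_powr_add_of_real_ge[OF a that x] mult_pos_pos[OF x s] by auto
  have hol: "G holomorphic_on {w. 0 < Re w}"
    unfolding G_def using den by (intro holomorphic_intros) (auto simp: complex_nonpos_Reals_iff)
  have bnd: "norm (G w) \<le> 1 / (x * sin (pi * a)) * (norm (exp (w\<^sup>2)) * norm w powr (2 * a - 1))" if w: "0 < Re w" for w
  proof -
    have "0 < norm (w powr of_real (2 * a) + of_real x)"
      using den[OF w] by simp
    have "norm (G w) = norm (exp (w\<^sup>2)) * norm w powr (2 * a - 1) / norm (w powr of_real (2 * a) + of_real x)"
      unfolding G_def norm_divide norm_exp_square_powr ..
    also have "\<dots> \<le> norm (exp (w\<^sup>2)) * norm w powr (2 * a - 1) / (x * sin (pi * a))"
      using norm_powr_add_of_real_ge[OF a w x] mult_pos_pos[OF x s]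
      \<open>0 < norm (w powr _ + _)\<close>
x s
      by (intro divide_left_mono mult_pos_pos) auto
    finally show ?thesis by simp
  qed
  \<comment> \<open>Chosen so that \<open>c powr (2 a) = 2 x\<close>: the ratio of the geometric
    series then has modulus at most \<open>1/2\<close> on the whole line.\<close>
  define c where "c = (2 * x) powr (1 / (2 * a))"
  have c: "0 < c" using x by (simp add: c_def)
  define tm where [abs_def]: "tm k u = of_real ((- x) ^ k) * (exp ((Complex c u)\<^sup>2) * Complex c u powr of_real (1 - 2 * (real k * a + 1)))" for k u
  define y where "y u = of_real (- x) * Complex c u powr of_real (- 2 * a)" for u
  have ny: "norm (y u) \<le> 1/2" for u
  proof -
    have "c \<le> norm (Complex c u)" using complex_Re_le_cmod[of "Complex c u"] by simp
    then have "norm (Complex c u) powr (- 2 * a) \<le> c powr (- 2 * a)"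
      using a c by (intro powr_mono2') auto
    also have "\<dots> = (2 * x) powr (1 / (2 * a) * (- 2 * a))" unfolding c_def by (rule powr_powr)
    also have "1 / (2 * a) * (- 2 * a) = - 1" using a by simp
    also have "(2 * x) powr - 1 = 1 / (2 * x)" using x by (simp add: powr_minus_divide)
    finally have "x * norm (Complex c u) powr (- 2 * a) \<le> x * (1 / (2 * x))"
      using x by (intro mult_left_mono) auto
    then show ?thesis using x by (simp add: y_def norm_mult norm_powr_real_powr')
  qed
  have term_eq: "tm k u = exp ((Complex c u)\<^sup>2) * Complex c u powr of_real (- 1) * y u ^ k" for k u
  proof -
    have nz: "Complex c u \<noteq> 0" using c by (auto simp: complex_eq_iff)
    have "Complex c u powr of_real (1 - 2 * (real k * a + 1)) = Complex c u powr (of_real (- 1) + of_nat k * of_real (- 2 * a))"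
      by (simp add: algebra_simps)
    also have "\<dots> = Complex c u powr of_real (- 1) * (Complex c u powr of_real (- 2 * a)) ^ k"
      using nz by (simp only: powr_add powr_times_real) (simp add: powr_def exp_of_nat_mult algebra_simps flip: exp_of_nat_mult)
    finally have e: "Complex c u powr of_real (1 - 2 * (real k * a + 1)) =
      Complex c u powr of_real (- 1) * (Complex c u powr of_real (- 2 * a)) ^ k" .
    show ?thesis unfolding tm_def y_def e power_mult_distrib of_real_power by (simp only: mult_ac)
  qed
  have norm_term: "norm (tm k u) \<le> (1/2) ^ k * norm (exp ((Complex c u)\<^sup>2) * Complex c u powr of_real (- 1))" for k u
    unfolding term_eq norm_mult norm_power using ny[of u]
    by (subst mult.commute, intro mult_right_mono power_mono) auto
  have int: "integrable lborel (tm k)" for k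
    unfolding tm_def by (intro integrable_mult_right integrable_hankel_line[OF c])
  have sums: "(\<lambda>k. tm k u) sums G (Complex c u)" for u
  proof -
    have nz: "Complex c u \<noteq> 0" using c by (auto simp: complex_eq_iff)
    have "(\<lambda>k. exp ((Complex c u)\<^sup>2) * Complex c u powr of_real (- 1) * y u ^ k) sums
      (exp ((Complex c u)\<^sup>2) * Complex c u powr of_real (- 1) * (1 / (1 - y u)))"
      using ny[of u] by (intro sums_mult geometric_sums) auto
    moreover have "exp ((Complex c u)\<^sup>2) * Complex c u powr of_real (- 1) * (1 / (1 - y u)) = G (Complex c u)"
    proof -
      define p where "p = Complex c u powr of_real (2 * a)"
      have p: "p \<noteq> 0" using nz by (simp add: p_def)
      have "y u = - of_real x / p" by (simp add: y_def p_def powr_minus divide_inverse)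
      moreover have "Complex c u powr of_real (2 * a - 1) = p * Complex c u powr of_real (- 1)"
        using nz unfolding p_def by (simp add: powr_diff powr_minus divide_inverse)
      moreover have "p + of_real x \<noteq> 0" using den[of "Complex c u"] c by (simp add: p_def)
      moreover have "1 / (1 - y u) = p / (p + of_real x)"
        unfolding \<open>y u = - of_real x / p\<close> using p \<open>p + of_real x \<noteq> 0\<close> by (simp add: divide_simps)
      ultimately show ?thesis
        unfolding G_def p_def[symmetric] by (simp add: mult_ac)
    qed
    ultimately show ?thesis by (simp add: term_eq)
  qed
  have "(\<lambda>k. LINT u|lborel. tm k u) sums (LINT u|lborel. (\<Sum>k. tm k u))"
  proof (rule sums_integral[OF int])
    show "AE u in lborel. summable (\<lambda>k. norm (tm k u))"
      by (intro AE_I2 summable_comparison_test'[OF summable_mult2[OF summable_geometric[of "1/2::real"]], where N = 0])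
        (use norm_term in auto)
    show "summable (\<lambda>k. LINT u|lborel. norm (tm k u))"
    proof (rule summable_comparison_test'[OF summable_mult2[OF summable_geometric[of "1/2::real"]], where N = 0])
      fix k
      have "(LINT u|lborel. norm (tm k u)) \<le> (LINT u|lborel. (1/2) ^ k * norm (exp ((Complex c u)\<^sup>2) * Complex c u powr of_real (- 1)))"
        by (intro integral_mono integrable_norm int integrable_mult_right integrable_hankel_line[OF c] norm_term)
      then show "norm (LINT u|lborel. norm (tm k u)) \<le> (1/2) ^ k * (LINT u|lborel. norm (exp ((Complex c u)\<^sup>2) * Complex c u powr of_real (- 1)))"
        by simp
    qed simp
  qed
  then have "(\<lambda>k. Re (LINT u|lborel. tm k u)) sums Re (LINT u|lborel. G (Complex c u))"
    using sums_unique[OF sums] by (intro sums_Re) simp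
  moreover have "Re (LINT u|lborel. tm k u) = pi * ((- x) ^ k / Gamma (real k * a + 1))" for k
  proof -
    have "(LINT u|lborel. tm k u) = of_real ((- x) ^ k) * hankel_line c (1 - 2 * (real k * a + 1))"
      unfolding tm_def hankel_line_def by (rule integral_mult_right_zero)
    then have "Re (LINT u|lborel. tm k u) = (- x) ^ k * Re (hankel_line c (1 - 2 * (real k * a + 1)))"
      by (simp only: Re_complex_of_real times_complex.sel Im_complex_of_real mult_zero_left diff_zero)
    also have "Re (hankel_line c (1 - 2 * (real k * a + 1))) = pi * rGamma (real k * a + 1)"
      using a by (intro Re_hankel_line_eq_rGamma[OF c] add_nonneg_pos) auto
    finally show ?thesis by (simp add: rGamma_inverse_Gamma divide_inverse)
  qed
  ultimately have "(\<lambda>k. pi * ((- x) ^ k / Gamma (real k * a + 1))) sums Re (LINT u|lborel. G (Complex c u))"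
    by simp
  then have "(\<lambda>k. (- x) ^ k / Gamma (real k * a + 1)) sums (Re (LINT u|lborel. G (Complex c u)) / pi)"
    using sums_divide[of "\<lambda>k. pi * ((- x) ^ k / Gamma (real k * a + 1))" _ pi] by simp
  then have "mittag_leffler a 1 (- x) = Re (LINT u|lborel. G (Complex c u)) / pi"
    unfolding mittag_leffler_def by (rule sums_unique[symmetric])
  moreover have "(LINT u|lborel. G (Complex c u)) = (LINT u|lborel. G (Complex 1 u))"
    using mult_pos_pos[OF x s] by (intro integral_vertical_line_indep[OF hol c _ bnd]) auto
  ultimately show ?thesis by (simp add: G_def)
qed

text \<open>Write \<open>x / (P + x) = 1 - P / (P + x)\<close>. The constant part is the Hankel
  integral with exponent \<open>2 a - 1 = 1 - 2 (1 - a)\<close>, hence the Gamma value; the rest has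
  exponent \<open>4 a - 1\<close> over a denominator of modulus at least
  \<open>x * sin (\<pi> a)\<close>.\<close>

lemma mittag_leffler_asymptotics:
  assumes a: "0 < a" "a < 1"
  shows "\<exists>C\<ge>0. \<forall>x>0. \<bar>x * mittag_leffler a 1 (- x) - 1 / Gamma (1 - a)\<bar> \<le> C / x"
proof -
  have s: "0 < sin (pi * a)" using a by (intro sin_gt_zero) auto
  define I where "I = (LINT u|lborel. norm (exp ((Complex 1 u)\<^sup>2) * Complex 1 u powr of_real (4 * a - 1)))"
  have I: "0 \<le> I" by (simp add: I_def)
  have "\<bar>x * mittag_leffler a 1 (- x) - 1 / Gamma (1 - a)\<bar> \<le> I / (pi * sin (pi * a)) / x" if x: "0 < x" for x
  proof -
    define A where "A u = exp ((Complex 1 u)\<^sup>2) * Complex 1 u powr of_real (2 * a - 1)" for u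
    define P where "P u = Complex 1 u powr of_real (2 * a)" for u
    define D where "D u = exp ((Complex 1 u)\<^sup>2) * Complex 1 u powr of_real (4 * a - 1) / (P u + of_real x)" for u
    have den: "x * sin (pi * a) \<le> norm (P u + of_real x)" for u
      using norm_powr_add_of_real_ge[OF a _ x, of "Complex 1 u"] by (simp add: P_def)
    have den0: "P u + of_real x \<noteq> 0" for u using den[of u] mult_pos_pos[OF x s] by auto
    have intA: "integrable lborel A" unfolding A_def by (intro integrable_hankel_line) simp
    have normD: "norm (D u) \<le> 1 / (x * sin (pi * a)) * norm (exp ((Complex 1 u)\<^sup>2) * Complex 1 u powr of_real (4 * a - 1))" for u
    proof -
      have "norm (D u) \<le> norm (exp ((Complex 1 u)\<^sup>2) * Complex 1 u powr of_real (4 * a - 1)) / (x * sin (pi * a))"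
        unfolding D_def norm_divide using den[of u] mult_pos_pos[OF x s]
        by (intro divide_left_mono) (auto intro!: mult_pos_pos)
      then show ?thesis by simp
    qed
    have int4: "integrable lborel (\<lambda>u. 1 / (x * sin (pi * a)) * norm (exp ((Complex 1 u)\<^sup>2) * Complex 1 u powr of_real (4 * a - 1)))"
      by (intro integrable_mult_right integrable_norm integrable_hankel_line) simp
    have intD: "integrable lborel D"
    proof (rule Bochner_Integration.integrable_bound[OF int4])
      have "(\<lambda>w. exp (w\<^sup>2) * w powr of_real (4 * a - 1) / (w powr of_real (2 * a) + of_real x)) holomorphic_on {w. 0 < Re w}"
        using norm_powr_add_of_real_ge[OF a _ x] mult_pos_pos[OF x s]
        by (intro holomorphic_intros) (fastforce simp: complex_nonpos_Reals_iff)+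
      from continuous_on_vertical_line[OF this, of 1] show "D \<in> borel_measurable lborel"
        unfolding D_def P_def by (simp add: borel_measurable_continuous_onI)
      show "AE u in lborel. norm (D u) \<le> norm (1 / (x * sin (pi * a)) * norm (exp ((Complex 1 u)\<^sup>2) * Complex 1 u powr of_real (4 * a - 1)))"
        unfolding real_norm_def by (intro AE_I2 order_trans[OF normD abs_ge_self])
    qed
    have split: "of_real x * (A u / (P u + of_real x)) = A u - D u" for u
    proof -
      have nz: "Complex 1 u \<noteq> 0" by (auto simp: complex_eq_iff)
      have "Complex 1 u powr of_real (4 * a - 1) = Complex 1 u powr (of_real (2 * a - 1) + of_real (2 * a))"
        by (simp add: algebra_simps)
      then have "Complex 1 u powr of_real (4 * a - 1) = Complex 1 u powr of_real (2 * a - 1) * P u"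
        unfolding P_def by (simp only: powr_add)
      then have "D u = A u * P u / (P u + of_real x)" by (simp add: D_def A_def)
      then show ?thesis using den0[of u] by (simp add: field_simps)
    qed
    have "x * (pi * mittag_leffler a 1 (- x)) = Re (of_real x * (LINT u|lborel. A u / (P u + of_real x)))"
      unfolding mittag_leffler_eq_line_integral[OF a x] A_def P_def by simp
    also have "of_real x * (LINT u|lborel. A u / (P u + of_real x)) = (LINT u|lborel. A u) - (LINT u|lborel. D u)"
      using Bochner_Integration.integral_diff[OF intA intD]
      by (simp only: integral_mult_right_zero[symmetric] split)
    also have "(LINT u|lborel. A u) = hankel_line 1 (1 - 2 * (1 - a))"
      by (simp add: hankel_line_def A_def)
    finally have "x * (pi * mittag_leffler a 1 (- x)) = pi * rGamma (1 - a) - Re (LINT u|lborel. D u)"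
      using Re_hankel_line_eq_rGamma[of 1 "1 - a"] a by simp
    then have "pi * (x * mittag_leffler a 1 (- x) - 1 / Gamma (1 - a)) = - Re (LINT u|lborel. D u)"
      by (simp add: rGamma_inverse_Gamma algebra_simps divide_inverse)
    then have "\<bar>pi * (x * mittag_leffler a 1 (- x) - 1 / Gamma (1 - a))\<bar> \<le> norm (LINT u|lborel. D u)"
      by (simp add: abs_Re_le_cmod)
    also have "\<dots> \<le> (LINT u|lborel. 1 / (x * sin (pi * a)) * norm (exp ((Complex 1 u)\<^sup>2) * Complex 1 u powr of_real (4 * a - 1)))"
      using integral_norm_bound integral_mono[OF integrable_norm[OF intD] int4 normD] by (rule order_trans)
    also have "\<dots> = I / (x * sin (pi * a))" by (simp add: I_def)
    finally show ?thesis using x s unfolding abs_mult by (simp add: field_simps)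
  qed
  then show ?thesis using I s by (intro exI[of _ "I / (pi * sin (pi * a))"]) auto
qed

section \<open>Square-integrable and absolutely continuous functions on the unit interval\<close>

text \<open>Restricting the measure once instead of integrating over a set gives a probability
  space: bounded measurable functions are integrable, constants integrate to themselves, and a
  product measure is at hand for Fubini.\<close>

abbreviation M01 :: "real measure" where
  "M01 \<equiv> restrict_space lborel {0<..<1::real}"

interpretation M01: prob_space M01
  by (rule prob_space_restrict_space) auto

interpretation M01_pair: pair_sigma_finite M01 M01 ..

lemma space_M01 [simp]: "space M01 = {0<..<1}"
  by (simp add: space_restrict_space)

lemma measurable_M01_iff: "v \<in> borel_measurable M01 \<longleftrightarrow> set_borel_measurable lborel {0<..<1} v"
  for v :: "real \<Rightarrow> real"
  by (simp add: set_borel_measurable_def borel_measurable_restrict_space_iff)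

lemma integrable_M01_iff: "integrable M01 v \<longleftrightarrow> set_integrable lborel {0<..<1} v" for v :: "real \<Rightarrow> real"
  by (simp add: set_integrable_def integrable_restrict_space)

lemma integral_M01_eq: "(LINT x|M01. v x) = (LBINT x:{0<..<1}. v x)" for v :: "real \<Rightarrow> real"
  by (simp add: set_lebesgue_integral_def integral_restrict_space)

lemma L2_01_iff: "L2_01 v \<longleftrightarrow> v \<in> borel_measurable M01 \<and> integrable M01 (\<lambda>x. (v x)\<^sup>2)"
  by (simp add: L2_01_def measurable_M01_iff integrable_M01_iff)

lemma ip01_eq: "ip01 v w = (LINT x|M01. v x * w x)"
  by (simp add: ip01_def integral_M01_eq)

lemma ae_eq01_iff: "ae_eq01 v w \<longleftrightarrow> (AE x in M01. v x = w x)"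
  by (simp add: ae_eq01_def AE_restrict_space_iff)

lemma admissible_iff:
  "admissible c0 q \<longleftrightarrow> q \<in> borel_measurable M01 \<and> (AE x in M01. 0 \<le> q x \<and> q x \<le> c0)"
  by (simp add: admissible_def measurable_M01_iff AE_restrict_space_iff del: AE_conj_iff)

lemma measurable_M01_continuous:
  fixes y :: "real \<Rightarrow> real"
  assumes "continuous_on {0..1} y"
  shows "y \<in> borel_measurable M01"
proof -
  have "continuous_on {0<..<1} y" using assms by (rule continuous_on_subset) auto
  then show ?thesis unfolding measurable_M01_iff set_borel_measurable_def
    using borel_measurable_continuous_on_indicator[of "{0<..<1::real}" y] by simp
qed

lemma continuous_on_01_bounded:
  fixes y :: "real \<Rightarrow> real"
  assumes "continuous_on {0..1} y"
  obtains B where "0 \<le> B" "\<And>x. x \<in> {0..1} \<Longrightarrow> \<bar>y x\<bar> \<le> B"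
proof -
  have "bounded (y ` {0..1})"
    using assms by (intro compact_imp_bounded compact_continuous_image) auto
  then obtain B where "\<forall>x\<in>{0..1}. norm (y x) \<le> B" unfolding bounded_iff by auto
  then show ?thesis using that[of "\<bar>B\<bar>"] by force
qed

lemma integrable_M01_bounded:
  fixes v :: "real \<Rightarrow> real"
  assumes "v \<in> borel_measurable M01" "AE x in M01. \<bar>v x\<bar> \<le> B"
  shows "integrable M01 v"
  using assms by (intro M01.integrable_const_bound[of _ B]) auto

lemma integrable_M01_mult_bounded:
  fixes v k :: "real \<Rightarrow> real"
  assumes "integrable M01 k" "v \<in> borel_measurable M01" "AE x in M01. \<bar>v x\<bar> \<le> B"
  shows "integrable M01 (\<lambda>x. v x * k x)"
proof (rule Bochner_Integration.integrable_bound[of _ "\<lambda>x. B * k x"])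
  show "AE x in M01. norm (v x * k x) \<le> norm (B * k x)"
    using assms(3)
  proof eventually_elim
    case (elim x)
    then have "\<bar>v x\<bar> * \<bar>k x\<bar> \<le> \<bar>B\<bar> * \<bar>k x\<bar>" by (intro mult_right_mono) auto
    then show ?case by (simp add: abs_mult)
  qed
qed (use assms in auto)

lemma continuous_AE_bounded:
  fixes y :: "real \<Rightarrow> real"
  assumes "continuous_on {0..1} y"
  shows "\<exists>B\<ge>0. AE x in M01. \<bar>y x\<bar> \<le> B"
proof -
  obtain B where "0 \<le> B" "\<And>x. x \<in> {0..1} \<Longrightarrow> \<bar>y x\<bar> \<le> B" using continuous_on_01_bounded[OF assms] by metis
  then show ?thesis by (intro exI[of _ B]) (auto intro!: AE_I2)
qed

lemma integrable_M01_continuous: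
  fixes y :: "real \<Rightarrow> real"
  assumes "continuous_on {0..1} y"
  shows "integrable M01 y"
  using continuous_AE_bounded[OF assms] measurable_M01_continuous[OF assms] integrable_M01_bounded by blast

lemma integrable_M01_mult_continuous:
  fixes y k :: "real \<Rightarrow> real"
  assumes "integrable M01 k" "continuous_on {0..1} y"
  shows "integrable M01 (\<lambda>x. y x * k x)" "integrable M01 (\<lambda>x. k x * y x)"
proof -
  show "integrable M01 (\<lambda>x. y x * k x)"
    using continuous_AE_bounded[OF assms(2)] measurable_M01_continuous[OF assms(2)]
      integrable_M01_mult_bounded[OF assms(1)] by blast
  then show "integrable M01 (\<lambda>x. k x * y x)" by (simp add: mult.commute)
qed

lemma L2_01_continuous: "continuous_on {0..1} y \<Longrightarrow> L2_01 y"
  unfolding L2_01_iff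
  by (intro conjI measurable_M01_continuous integrable_M01_continuous continuous_intros)

lemma L2_01_mult_integrable: "L2_01 v \<Longrightarrow> L2_01 w \<Longrightarrow> integrable M01 (\<lambda>x. v x * w x)"
proof -
  assume vw: "L2_01 v" "L2_01 w"
  have "integrable M01 (\<lambda>x. (v x)\<^sup>2 + (w x)\<^sup>2)" using vw by (auto simp: L2_01_iff)
  then show "integrable M01 (\<lambda>x. v x * w x)"
  proof (rule Bochner_Integration.integrable_bound)
    show "AE x in M01. norm (v x * w x) \<le> norm ((v x)\<^sup>2 + (w x)\<^sup>2)"
    proof (rule AE_I2)
      fix x
      have "0 \<le> (\<bar>v x\<bar> - \<bar>w x\<bar>)\<^sup>2" and nn: "0 \<le> \<bar>v x\<bar> * \<bar>w x\<bar>" by auto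
      then have "2 * (\<bar>v x\<bar> * \<bar>w x\<bar>) \<le> (v x)\<^sup>2 + (w x)\<^sup>2" by (simp add: power2_diff)
      then have "\<bar>v x\<bar> * \<bar>w x\<bar> \<le> (v x)\<^sup>2 + (w x)\<^sup>2" using nn by linarith
      then show "norm (v x * w x) \<le> norm ((v x)\<^sup>2 + (w x)\<^sup>2)"
        by (simp add: abs_mult)
    qed
  qed (use vw in \<open>auto simp: L2_01_iff\<close>)
qed

lemma L2_01_add: "L2_01 v \<Longrightarrow> L2_01 w \<Longrightarrow> L2_01 (\<lambda>x. v x + w x)"
  using L2_01_mult_integrable[of v w] by (auto simp: L2_01_iff power2_sum mult.assoc)

lemma L2_01_cmult: "L2_01 v \<Longrightarrow> L2_01 (\<lambda>x. c * v x)"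
  by (auto simp: L2_01_iff power_mult_distrib)

lemma L2_01_diff: "L2_01 v \<Longrightarrow> L2_01 w \<Longrightarrow> L2_01 (\<lambda>x. v x - w x)"
  using L2_01_add[of v "\<lambda>x. (- 1) * w x"] L2_01_cmult[of w "- 1"] by simp

lemma L2_01_sum: "(\<And>i. i \<in> I \<Longrightarrow> L2_01 (v i)) \<Longrightarrow> L2_01 (\<lambda>x. \<Sum>i\<in>I. v i x)"
proof (induction I rule: infinite_finite_induct)
  case (insert i I) then show ?case by (simp add: L2_01_add)
qed (auto intro: L2_01_continuous)

lemma L2_01_integrable: "L2_01 v \<Longrightarrow> integrable M01 v"
  using L2_01_mult_integrable[of v "\<lambda>_. 1"] L2_01_continuous[of "\<lambda>_. 1"] by simp

lemma L2_01_admissible_mult: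
  assumes "admissible c0 q" "L2_01 v"
  shows "L2_01 (\<lambda>x. q x * v x)"
proof -
  have "integrable M01 (\<lambda>x. (q x)\<^sup>2 * (v x)\<^sup>2)"
  proof (rule integrable_M01_mult_bounded[where B = "c0\<^sup>2"])
    show "AE x in M01. \<bar>(q x)\<^sup>2\<bar> \<le> c0\<^sup>2"
      using conjunct2[OF assms(1)[unfolded admissible_iff]] by (rule eventually_mono) (auto intro: power_mono)
  qed (use assms in \<open>auto simp: L2_01_iff admissible_iff\<close>)
  then show ?thesis using assms by (auto simp: L2_01_iff admissible_iff power_mult_distrib)
qed

lemma ip01_commute: "ip01 v w = ip01 w v"
  by (simp add: ip01_def mult.commute)

lemma ip01_add: "L2_01 u \<Longrightarrow> L2_01 v \<Longrightarrow> L2_01 w \<Longrightarrow> ip01 (\<lambda>x. u x + v x) w = ip01 u w + ip01 v w"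
  by (simp add: ip01_eq distrib_right L2_01_mult_integrable)

lemma ip01_diff: "L2_01 u \<Longrightarrow> L2_01 v \<Longrightarrow> L2_01 w \<Longrightarrow> ip01 (\<lambda>x. u x - v x) w = ip01 u w - ip01 v w"
  by (simp add: ip01_eq left_diff_distrib L2_01_mult_integrable)

lemma ip01_cmult: "ip01 (\<lambda>x. c * v x) w = c * ip01 v w"
  by (simp add: ip01_eq mult.assoc)

lemma ip01_sum:
  "(\<And>i. i \<in> I \<Longrightarrow> L2_01 (v i)) \<Longrightarrow> L2_01 w \<Longrightarrow> ip01 (\<lambda>x. \<Sum>i\<in>I. v i x) w = (\<Sum>i\<in>I. ip01 (v i) w)"
  by (simp add: ip01_eq sum_distrib_right L2_01_mult_integrable)

lemma ip01_self_nonneg: "0 \<le> ip01 v v"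
  by (simp add: ip01_eq)

text \<open>The square norm of \<open>t v - w\<close> is a nonnegative quadratic polynomial in
  \<open>t\<close>.\<close>

lemma ip01_cauchy_schwarz:
  assumes "L2_01 v" "L2_01 w"
  shows "\<bar>ip01 v w\<bar> \<le> sqrt (ip01 v v) * sqrt (ip01 w w)"
proof -
  have q: "0 \<le> ip01 v v * t\<^sup>2 - 2 * t * ip01 v w + ip01 w w" for t
  proof -
    have "0 \<le> ip01 (\<lambda>x. t * v x - w x) (\<lambda>x. t * v x - w x)" by (rule ip01_self_nonneg)
    also have "\<dots> = t * ip01 v (\<lambda>x. t * v x - w x) - ip01 w (\<lambda>x. t * v x - w x)"
      using assms by (simp only: ip01_diff L2_01_diff L2_01_cmult ip01_cmult)
    also have "ip01 v (\<lambda>x. t * v x - w x) = t * ip01 v v - ip01 v w"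
      unfolding ip01_commute[of v "\<lambda>x. t * v x - w x"]
      using assms by (simp only: ip01_diff L2_01_cmult ip01_cmult ip01_commute[of w v])
    also have "ip01 w (\<lambda>x. t * v x - w x) = t * ip01 v w - ip01 w w"
      unfolding ip01_commute[of w "\<lambda>x. t * v x - w x"]
      using assms by (simp only: ip01_diff L2_01_cmult ip01_cmult)
    also have "t * (t * ip01 v v - ip01 v w) - (t * ip01 v w - ip01 w w) = ip01 v v * t\<^sup>2 - 2 * t * ip01 v w + ip01 w w"
      by algebra
    finally show ?thesis .
  qed
  have "(ip01 v w)\<^sup>2 \<le> ip01 v v * ip01 w w"
  proof (cases "ip01 v v = 0")
    case True
    have "ip01 v w = 0"
    proof (rule ccontr)
      assume nz: "ip01 v w \<noteq> 0"
      \<comment> \<open>The polynomial is linear in \<open>t\<close> here, and this \<open>t\<close>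
        would give it the value \<open>- 1\<close>.\<close>
      define t where "t = (ip01 w w + 1) / (2 * ip01 v w)"
      have "2 * t * ip01 v w = ip01 w w + 1" using nz by (simp add: t_def)
      then show False using q[of t] True by simp
    qed
    then show ?thesis using True by simp
  next
    case False
    then have pos: "0 < ip01 v v" using ip01_self_nonneg[of v] by simp
    have "0 \<le> ip01 v v * (ip01 v w / ip01 v v)\<^sup>2 - 2 * (ip01 v w / ip01 v v) * ip01 v w + ip01 w w"
      by (rule q)
    also have "\<dots> = ip01 w w - (ip01 v w)\<^sup>2 / ip01 v v"
      using False by (simp add: power2_eq_square)
    finally show ?thesis using pos by (simp add: field_simps)
  qed
  then have "sqrt ((ip01 v w)\<^sup>2) \<le> sqrt (ip01 v v * ip01 w w)" by (rule real_sqrt_le_mono)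
  then show ?thesis by (simp add: real_sqrt_mult)
qed

lemma integral_abs_le_L2: "L2_01 v \<Longrightarrow> (LINT x|M01. \<bar>v x\<bar>) \<le> sqrt (ip01 v v)"
proof -
  assume v: "L2_01 v"
  have "L2_01 (\<lambda>x. \<bar>v x\<bar>)" using v by (auto simp: L2_01_iff)
  then have "\<bar>ip01 (\<lambda>x. \<bar>v x\<bar>) (\<lambda>_. 1)\<bar> \<le> sqrt (ip01 (\<lambda>x. \<bar>v x\<bar>) (\<lambda>x. \<bar>v x\<bar>)) * sqrt (ip01 (\<lambda>_. 1) (\<lambda>_. 1))"
    by (intro ip01_cauchy_schwarz L2_01_continuous[of "\<lambda>_. 1"]) auto
  then show ?thesis by (simp add: ip01_eq M01.prob_space[simplified])
qed

lemma ip01_cong_AE: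
  assumes "ae_eq01 v v'" "L2_01 v" "L2_01 v'" "L2_01 w"
  shows "ip01 v w = ip01 v' w"
  unfolding ip01_eq
  by (rule integral_cong_AE) (use assms in \<open>auto simp: L2_01_iff ae_eq01_iff elim!: eventually_mono\<close>)

section \<open>Absolutely continuous functions and integration by parts\<close>

text \<open>\<open>K\<close> is an indefinite Lebesgue integral of its density \<open>k\<close>. The
  variable upper limit is an indicator under the fixed measure \<open>M01\<close>, so that iterated
  integrals live on one product space.\<close>

definition abs_cont01 :: "(real \<Rightarrow> real) \<Rightarrow> (real \<Rightarrow> real) \<Rightarrow> bool" where
  "abs_cont01 K k \<longleftrightarrow> integrable M01 k \<and>
     (\<forall>t\<in>{0..1}. K t = K 0 + (LINT z|M01. indicator {..<t} z * k z))"

lemma abs_cont01I: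
  assumes "integrable M01 k" "\<And>t. t \<in> {0..1} \<Longrightarrow> K t = K 0 + (LINT z|M01. indicator {..<t} z * k z)"
  shows "abs_cont01 K k"
  unfolding abs_cont01_def using assms by blast

lemma abs_cont01D:
  assumes "abs_cont01 K k"
  shows "integrable M01 k" "t \<in> {0..1} \<Longrightarrow> K t = K 0 + (LINT z|M01. indicator {..<t} z * k z)"
proof -
  show "integrable M01 k" using assms unfolding abs_cont01_def by blast
  show "t \<in> {0..1} \<Longrightarrow> K t = K 0 + (LINT z|M01. indicator {..<t} z * k z)"
    using assms unfolding abs_cont01_def by blast
qed

lemma integrable_indicator_mult: "integrable M01 k \<Longrightarrow> integrable M01 (\<lambda>z. indicat_real {..<t} z * k z)"
  by (rule integrable_M01_mult_bounded[where B = 1]) (auto intro: measurable_restrict_space1 simp: indicator_def)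

lemma interval_integral_eq_M01:
  assumes "0 \<le> t" "t \<le> 1"
  shows "(LBINT z=ereal 0..ereal t. k z :: real) = (LINT z|M01. indicator {..<t} z * k z)"
proof -
  have "(LBINT z=ereal 0..ereal t. k z) = (LINT z|lborel. indicator {0<..<t} z *\<^sub>R k z)"
    using assms by (simp add: interval_lebesgue_integral_def set_lebesgue_integral_def)
  also have "\<dots> = (LINT z|lborel. indicator {0<..<1} z *\<^sub>R (indicator {..<t} z * k z))"
    using assms by (intro Bochner_Integration.integral_cong) (auto simp: indicator_def)
  also have "\<dots> = (LINT z|M01. indicator {..<t} z * k z)"
    by (simp add: integral_restrict_space)
  finally show ?thesis .
qed

lemma abs_cont01_continuous:
  assumes "abs_cont01 K k"
  shows "continuous_on {0..1} K"
proof -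
  have k: "integrable M01 k" using assms by (rule abs_cont01D)
  then have k': "set_integrable lborel {0<..<1} k" by (simp add: integrable_M01_iff)
  have "k integrable_on {0<..<1}" using set_borel_integral_eq_integral(1)[OF k'] .
  then have ki: "k integrable_on {0..1}" by (simp add: integrable_on_open_interval_real)
  have "K t = K 0 + integral {0..t} k" if t: "t \<in> {0..1}" for t
  proof -
    have "set_integrable lborel {0<..<t} k"
      using k' by (rule set_integrable_subset) (use t in auto)
    then have "(LBINT z:{0<..<t}. k z) = integral {0<..<t} k"
      by (rule set_borel_integral_eq_integral)
    also have "\<dots> = integral {0..t} k" by (simp add: integral_open_interval_real)
    finally have "(LINT z|M01. indicator {..<t} z * k z) = integral {0..t} k"
      using interval_integral_eq_M01[of t k] t by (simp add: interval_lebesgue_integral_def)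
    then show ?thesis using abs_cont01D(2)[OF assms t] by simp
  qed
  note eq = this
  have "continuous_on {0..1} (\<lambda>t. K 0 + integral {0..t} k)"
    by (intro continuous_intros indefinite_integral_continuous_1 ki)
  then show ?thesis using eq by (subst continuous_on_cong[OF refl eq])
qed

lemma abs_cont01_at_1:
  assumes "abs_cont01 K k"
  shows "K 1 = K 0 + (LINT z|M01. k z)"
proof -
  have "K 1 = K 0 + (LINT z|M01. indicator {..<1} z * k z)" by (rule abs_cont01D(2)[OF assms]) simp
  also have "(LINT z|M01. indicator {..<1} z * k z) = (LINT z|M01. k z)"
    by (intro Bochner_Integration.integral_cong) auto
  finally show ?thesis .
qed

lemma abs_cont01_diff_le:
  assumes "abs_cont01 K k" "t \<in> {0..1}"
  shows "\<bar>K t - K 0\<bar> \<le> (LINT z|M01. \<bar>k z\<bar>)"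
proof -
  have k: "integrable M01 k" using assms(1) by (rule abs_cont01D)
  have "\<bar>K t - K 0\<bar> = \<bar>LINT z|M01. indicator {..<t} z * k z\<bar>" using abs_cont01D(2)[OF assms] by linarith
  also have "\<dots> \<le> (LINT z|M01. \<bar>indicator {..<t} z * k z\<bar>)" by (rule integral_abs_bound)
  also have "\<dots> \<le> (LINT z|M01. \<bar>k z\<bar>)"
    by (intro integral_mono integrable_abs integrable_indicator_mult k) (auto split: split_indicator)
  finally show ?thesis .
qed

lemma abs_cont01_linear:
  assumes "abs_cont01 K k" "abs_cont01 L l"
  shows "abs_cont01 (\<lambda>x. a * K x + b * L x) (\<lambda>x. a * k x + b * l x)"
proof -
  have i: "integrable M01 k" "integrable M01 l" using assms[THEN abs_cont01D(1)] .
  have "a * K t + b * L t = a * K 0 + b * L 0 + (LINT z|M01. indicator {..<t} z * (a * k z + b * l z))"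
    if t: "t \<in> {0..1}" for t
  proof -
    have "(LINT z|M01. indicator {..<t} z * (a * k z + b * l z)) =
      (LINT z|M01. a * (indicator {..<t} z * k z) + b * (indicator {..<t} z * l z))"
      by (simp add: algebra_simps)
    also have "\<dots> = a * (LINT z|M01. indicator {..<t} z * k z) + b * (LINT z|M01. indicator {..<t} z * l z)"
      using integrable_indicator_mult[OF i(1), of t] integrable_indicator_mult[OF i(2), of t] by simp
    finally have "a * K 0 + b * L 0 + (LINT z|M01. indicator {..<t} z * (a * k z + b * l z)) =
      a * (K 0 + (LINT z|M01. indicator {..<t} z * k z)) + b * (L 0 + (LINT z|M01. indicator {..<t} z * l z))"
      by (simp add: distrib_left)
    also have "\<dots> = a * K t + b * L t"
      unfolding abs_cont01D(2)[OF assms(1) t, symmetric] abs_cont01D(2)[OF assms(2) t, symmetric] ..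
    finally show ?thesis ..
  qed
  then show ?thesis by (intro abs_cont01I) (use i in simp)
qed

lemma abs_cont01_zero: "abs_cont01 (\<lambda>_. 0) (\<lambda>_. 0)"
  by (simp add: abs_cont01_def)

lemma abs_cont01_sum:
  "(\<And>n. n \<in> I \<Longrightarrow> abs_cont01 (K n) (k n)) \<Longrightarrow> abs_cont01 (\<lambda>x. \<Sum>n\<in>I. a n * K n x) (\<lambda>x. \<Sum>n\<in>I. a n * k n x)"
proof (induction I rule: infinite_finite_induct)
  case (insert i I)
  then show ?case using abs_cont01_linear[of "K i" "k i" "\<lambda>x. \<Sum>n\<in>I. a n * K n x" "\<lambda>x. \<Sum>n\<in>I. a n * k n x" "a i" 1]
    by simp
qed (auto simp: abs_cont01_zero)

lemma abs_cont01_C1: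
  assumes "continuous_on {0..1} f'" "\<And>x. (f has_real_derivative f' x) (at x)"
  shows "abs_cont01 f f'"
proof -
  have "f t = f 0 + (LINT z|M01. indicator {..<t} z * f' z)" if t: "t \<in> {0..1}" for t
  proof -
    have "(LBINT z=ereal 0..ereal t. f' z) = f t - f 0"
    proof (rule interval_integral_FTC_finite)
      show "continuous_on {min 0 t..max 0 t} f'" using assms(1) by (rule continuous_on_subset) (use t in auto)
      show "(f has_vector_derivative f' x) (at x within {min 0 t..max 0 t})" for x
        using assms(2)[of x] by (simp add: has_real_derivative_iff_has_vector_derivative has_vector_derivative_at_within)
    qed
    then show ?thesis using interval_integral_eq_M01[of t f'] t by simp
  qed
  then show ?thesis by (intro abs_cont01I integrable_M01_continuous[OF assms(1)])
qed

text \<open>Writing both functions as indefinite integrals turns the claim into Fubini for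
  \<open>k z * l t\<close> over the triangle \<open>z < t\<close>; it works at the level of
  integrable densities, without pointwise derivatives.\<close>

lemma integral_by_parts01:
  assumes Kk: "abs_cont01 K k" and Ll: "abs_cont01 L l"
  shows "(LINT t|M01. K t * l t) = K 1 * L 1 - K 0 * L 0 - (LINT z|M01. k z * L z)"
proof -
  have k: "integrable M01 k" and l: "integrable M01 l" using assms[THEN abs_cont01D(1)] .
  have [measurable]: "k \<in> borel_measurable M01" "l \<in> borel_measurable M01" using k l by auto
  define H where "H t z = indicat_real {..<t} z * k z * l t" for t z :: real
  have Hm[measurable]: "(\<lambda>(t, z). H t z) \<in> borel_measurable (M01 \<Otimes>\<^sub>M M01)"
  proof -
    have eq: "(\<lambda>(t, z). H t z) = (\<lambda>p. (if snd p < fst p then 1 else 0) * k (snd p) * l (fst p))"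
      by (auto simp: H_def fun_eq_iff indicator_def)
    have [measurable]: "(\<lambda>x. x) \<in> M01 \<rightarrow>\<^sub>M borel" by (rule measurable_M01_continuous) (auto intro: continuous_intros)
    have [measurable]: "(\<lambda>p. snd p) \<in> M01 \<Otimes>\<^sub>M M01 \<rightarrow>\<^sub>M borel" "(\<lambda>p. fst p) \<in> M01 \<Otimes>\<^sub>M M01 \<rightarrow>\<^sub>M borel"
      using measurable_compose[OF measurable_snd, of "\<lambda>x. x" M01 borel M01] measurable_compose[OF measurable_fst, of "\<lambda>x. x" M01 borel M01] by auto
    show ?thesis unfolding eq by measurable
  qed
  have "integrable (M01 \<Otimes>\<^sub>M M01) (\<lambda>(t, z). H t z)"
  proof (rule M01_pair.Fubini_integrable[OF Hm])
    show "AE t in M01. integrable M01 (\<lambda>z. case (t, z) of (t, z) \<Rightarrow> H t z)"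
      using integrable_indicator_mult[OF k] by (auto simp: H_def)
    have "integrable M01 (\<lambda>t. \<bar>l t\<bar> * (LINT z|M01. \<bar>k z\<bar>))"
      using l by (intro integrable_mult_left integrable_abs)
    then show "integrable M01 (\<lambda>t. LINT z|M01. norm (case (t, z) of (t, z) \<Rightarrow> H t z))"
    proof (rule Bochner_Integration.integrable_bound)
      show "(\<lambda>t. LINT z|M01. norm (case (t, z) of (t, z) \<Rightarrow> H t z)) \<in> borel_measurable M01" by measurable
      show "AE t in M01. norm (LINT z|M01. norm (case (t, z) of (t, z) \<Rightarrow> H t z)) \<le> norm (\<bar>l t\<bar> * (LINT z|M01. \<bar>k z\<bar>))"
      proof (rule AE_I2)
        fix t
        have "(LINT z|M01. norm (H t z)) \<le> (LINT z|M01. \<bar>l t\<bar> * \<bar>k z\<bar>)"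
          unfolding H_def by (intro integral_mono integrable_norm integrable_mult_right integrable_mult_left integrable_indicator_mult k integrable_abs)
            (auto split: split_indicator simp: abs_mult)
        then show "norm (LINT z|M01. norm (case (t, z) of (t, z) \<Rightarrow> H t z)) \<le> norm (\<bar>l t\<bar> * (LINT z|M01. \<bar>k z\<bar>))"
          by (simp add: abs_mult)
      qed
    qed
  qed
  from M01_pair.Fubini_integral[OF this]
  have fub: "(LINT z|M01. (LINT t|M01. H t z)) = (LINT t|M01. (LINT z|M01. H t z))" .
  have inner1: "(LINT z|M01. H t z) = K t * l t - K 0 * l t" if "t \<in> {0<..<1}" for t
  proof -
    have "(LINT z|M01. H t z) = (LINT z|M01. indicator {..<t} z * k z) * l t" unfolding H_def by simp
    also have "(LINT z|M01. indicator {..<t} z * k z) = K t - K 0" using abs_cont01D(2)[OF Kk, of t] that by auto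
    finally show ?thesis by (simp add: left_diff_distrib)
  qed
  have inner2: "(LINT t|M01. H t z) = L 1 * k z - k z * L z" if z: "z \<in> {0<..<1}" for z
  proof -
    have "(LINT t|M01. H t z) = (LINT t|M01. k z * (l t - indicator {..<z} t * l t))"
    proof (rule integral_cong_AE)
      \<comment> \<open>Off the diagonal, \<open>z < t\<close> is the negation of
        \<open>t < z\<close>, which lets the inner integral over \<open>t\<close> be expressed
        through \<open>L\<close>.\<close>
      have "AE t in M01. t \<noteq> z"
        using AE_lborel_singleton[of z] by (auto simp: AE_restrict_space_iff elim!: eventually_mono)
      then show "AE t in M01. H t z = k z * (l t - indicator {..<z} t * l t)"
        by (rule eventually_mono) (auto simp: H_def indicator_def)
      have "H t z = (1 - indicator {..<z} t - indicator {z} t) * k z * l t" for t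
        by (auto simp: H_def indicator_def)
      then have "(\<lambda>t. H t z) = (\<lambda>t. (1 - indicator {..<z} t - indicator {z} t) * k z * l t)" by auto
      moreover have [measurable]: "indicat_real {..<z} \<in> borel_measurable M01" "indicat_real {z} \<in> borel_measurable M01"
        by (auto intro!: measurable_restrict_space1)
      ultimately show "(\<lambda>t. H t z) \<in> borel_measurable M01" by simp
      show "(\<lambda>t. k z * (l t - indicator {..<z} t * l t)) \<in> borel_measurable M01"
        using borel_measurable_integrable[OF integrable_indicator_mult[OF l, of z]] by simp
    qed
    also have "\<dots> = k z * ((LINT t|M01. l t) - (LINT t|M01. indicator {..<z} t * l t))"
      using integrable_indicator_mult[OF l, of z] l by simp
    also have "(LINT t|M01. l t) = L 1 - L 0" using abs_cont01_at_1[OF Ll] by simp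
    also have "(LINT t|M01. indicator {..<z} t * l t) = L z - L 0" using abs_cont01D(2)[OF Ll, of z] z by auto
    finally show ?thesis by (simp add: right_diff_distrib)
  qed
  have cK: "continuous_on {0..1} K" and cL: "continuous_on {0..1} L" using assms abs_cont01_continuous by auto
  have "(LINT t|M01. K t * l t - K 0 * l t) = (LINT z|M01. L 1 * k z - k z * L z)"
    using fub Bochner_Integration.integral_cong[OF refl inner1, of M01] Bochner_Integration.integral_cong[OF refl inner2, of M01]
    by simp
  then have "(LINT t|M01. K t * l t) - K 0 * (LINT t|M01. l t) = L 1 * (LINT z|M01. k z) - (LINT z|M01. k z * L z)"
    using k l integrable_M01_mult_continuous[OF l cK] integrable_M01_mult_continuous[OF k cL] by simp
  then show ?thesis using abs_cont01_at_1[OF Kk] abs_cont01_at_1[OF Ll] by (simp add: algebra_simps)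
qed

section \<open>Dirichlet eigensystems\<close>

text \<open>The Sobolev class \<open>W^{2,1}\<close> with first derivative \<open>K\<close> and
  second derivative \<open>k\<close>; \<open>K\<close> is an explicit argument because its endpoint
  values enter Green's identity.\<close>

definition twice_abs_cont01 :: "(real \<Rightarrow> real) \<Rightarrow> (real \<Rightarrow> real) \<Rightarrow> (real \<Rightarrow> real) \<Rightarrow> bool" where
  "twice_abs_cont01 y K k \<longleftrightarrow> abs_cont01 y K \<and> abs_cont01 K k"

lemma green_identity01:
  assumes "twice_abs_cont01 y K k" "twice_abs_cont01 e e1 e2"
  shows "(LINT x|M01. y x * e2 x) - (LINT x|M01. k x * e x) = y 1 * e1 1 - y 0 * e1 0 - K 1 * e 1 + K 0 * e 0"
proof -
  have "(LINT x|M01. y x * e2 x) = y 1 * e1 1 - y 0 * e1 0 - (LINT x|M01. K x * e1 x)"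
    using assms by (intro integral_by_parts01) (auto simp: twice_abs_cont01_def)
  moreover have "(LINT x|M01. K x * e1 x) = K 1 * e 1 - K 0 * e 0 - (LINT x|M01. k x * e x)"
    using assms by (intro integral_by_parts01) (auto simp: twice_abs_cont01_def)
  ultimately show ?thesis by simp
qed

lemma twice_abs_cont01_continuous:
  assumes "twice_abs_cont01 y K k"
  shows "continuous_on {0..1} y" "continuous_on {0..1} K" "integrable M01 k"
  using assms abs_cont01_continuous abs_cont01D(1) unfolding twice_abs_cont01_def by blast+

lemma twice_abs_cont01_sin:
  "twice_abs_cont01 (\<lambda>x. sin (a * x)) (\<lambda>x. a * cos (a * x)) (\<lambda>x. - (a\<^sup>2) * sin (a * x))"
  unfolding twice_abs_cont01_def
  by (intro conjI abs_cont01_C1 continuous_intros) (auto intro!: derivative_eq_intros simp: power2_eq_square)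

lemma twice_abs_cont01_cos:
  "twice_abs_cont01 (\<lambda>x. cos (a * x)) (\<lambda>x. - a * sin (a * x)) (\<lambda>x. - (a\<^sup>2) * cos (a * x))"
  unfolding twice_abs_cont01_def
  by (intro conjI abs_cont01_C1 continuous_intros) (auto intro!: derivative_eq_intros simp: power2_eq_square)

section \<open>Decay of sine and cosine coefficients\<close>

lemma abs_integral_mult_le:
  fixes k e :: "real \<Rightarrow> real"
  assumes "integrable M01 k" "continuous_on {0..1} e" "\<And>x. x \<in> {0..1} \<Longrightarrow> \<bar>e x\<bar> \<le> B"
  shows "\<bar>LINT x|M01. k x * e x\<bar> \<le> B * (LINT x|M01. \<bar>k x\<bar>)"
proof -
  have "\<bar>LINT x|M01. k x * e x\<bar> \<le> (LINT x|M01. \<bar>k x * e x\<bar>)" by (rule integral_abs_bound)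
  also have "\<dots> \<le> (LINT x|M01. B * \<bar>k x\<bar>)"
  proof (rule integral_mono)
    show "integrable M01 (\<lambda>x. \<bar>k x * e x\<bar>)" using integrable_M01_mult_continuous(2)[OF assms(1,2)] by simp
    show "integrable M01 (\<lambda>x. B * \<bar>k x\<bar>)" using assms(1) by simp
    fix x assume "x \<in> space M01"
    then have "\<bar>e x\<bar> * \<bar>k x\<bar> \<le> B * \<bar>k x\<bar>" using assms(3)[of x] by (intro mult_right_mono) auto
    then show "\<bar>k x * e x\<bar> \<le> B * \<bar>k x\<bar>" by (simp add: abs_mult mult.commute)
  qed
  finally show ?thesis by simp
qed

text \<open>The derivative of the cosine vanishes at both endpoints, so no boundary value of
  \<open>y\<close> appears and the decay is quadratic without Dirichlet conditions; only the
  endpoint slopes are paid for.\<close>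

lemma cos_coeff_bound:
  assumes y: "twice_abs_cont01 y K k"
  shows "(real n * pi)\<^sup>2 * \<bar>ip01 y (\<lambda>x. cos (real n * pi * x))\<bar> \<le> \<bar>K 0\<bar> + \<bar>K 1\<bar> + (LINT x|M01. \<bar>k x\<bar>)"
proof -
  let ?a = "real n * pi"
  have k: "integrable M01 k" using twice_abs_cont01_continuous[OF y] by simp
  have "- (?a\<^sup>2) * ip01 y (\<lambda>x. cos (?a * x)) - (LINT x|M01. k x * cos (?a * x)) = - K 1 * cos ?a + K 0"
  proof -
    have "(LINT x|M01. y x * (- (?a\<^sup>2) * cos (?a * x))) = - (?a\<^sup>2) * ip01 y (\<lambda>x. cos (?a * x))"
      unfolding ip01_eq by (simp add: mult.left_commute[of _ "?a\<^sup>2"] flip: integral_mult_right_zero)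
    moreover have "sin ?a = 0" by (simp add: sin_npi)
    ultimately show ?thesis
      using green_identity01[OF y twice_abs_cont01_cos[of ?a]] by simp
  qed
  then have "?a\<^sup>2 * ip01 y (\<lambda>x. cos (?a * x)) = K 1 * cos ?a - K 0 - (LINT x|M01. k x * cos (?a * x))" by simp
  then have "\<bar>?a\<^sup>2 * ip01 y (\<lambda>x. cos (?a * x))\<bar> \<le> \<bar>K 1 * cos ?a\<bar> + \<bar>K 0\<bar> + \<bar>LINT x|M01. k x * cos (?a * x)\<bar>" by linarith
  also have "\<bar>K 1 * cos ?a\<bar> \<le> \<bar>K 1\<bar>" by (simp add: abs_mult mult_left_le)
  also have "\<bar>LINT x|M01. k x * cos (?a * x)\<bar> \<le> 1 * (LINT x|M01. \<bar>k x\<bar>)"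
    by (intro abs_integral_mult_le k continuous_intros) auto
  finally show ?thesis by (simp add: abs_mult)
qed

text \<open>Kept as an equation, since the endpoint term is the same for both potentials and has to
  cancel in the comparison.\<close>

lemma sin_coeff_eq:
  assumes y: "twice_abs_cont01 y K k"
  shows "(real n * pi)\<^sup>2 * ip01 y (\<lambda>x. sin (real n * pi * x)) =
    - (real n * pi) * (y 1 * cos (real n * pi) - y 0) - (LINT x|M01. k x * sin (real n * pi * x))"
proof -
  let ?a = "real n * pi"
  have "(LINT x|M01. y x * (- (?a\<^sup>2) * sin (?a * x))) = - (?a\<^sup>2) * ip01 y (\<lambda>x. sin (?a * x))"
    unfolding ip01_eq by (simp add: mult.left_commute[of _ "?a\<^sup>2"] flip: integral_mult_right_zero)
  moreover have "sin ?a = 0" by (simp add: sin_npi)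
  ultimately show ?thesis
    using green_identity01[OF y twice_abs_cont01_sin[of ?a]] by (simp add: algebra_simps)
qed

text \<open>Nonzero endpoint values cost one power of \<open>n\<close> compared with the cosine
  estimate.\<close>

lemma sin_coeff_bound:
  assumes y: "twice_abs_cont01 y K k"
  shows "(real n * pi)\<^sup>2 * \<bar>ip01 y (\<lambda>x. sin (real n * pi * x))\<bar> \<le>
    real n * pi * (\<bar>y 0\<bar> + \<bar>y 1\<bar>) + (LINT x|M01. \<bar>k x\<bar>)"
proof -
  let ?a = "real n * pi"
  have k: "integrable M01 k" using twice_abs_cont01_continuous[OF y] by simp
  have "?a\<^sup>2 * \<bar>ip01 y (\<lambda>x. sin (?a * x))\<bar> = \<bar>?a\<^sup>2 * ip01 y (\<lambda>x. sin (?a * x))\<bar>" by (simp add: abs_mult)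
  also have "\<dots> \<le> \<bar>?a * (y 1 * cos ?a - y 0)\<bar> + \<bar>LINT x|M01. k x * sin (?a * x)\<bar>"
    unfolding sin_coeff_eq[OF y] minus_mult_left[symmetric] by linarith
  also have "\<bar>?a * (y 1 * cos ?a - y 0)\<bar> \<le> ?a * (\<bar>y 0\<bar> + \<bar>y 1\<bar>)"
  proof -
    have "\<bar>y 1 * cos ?a\<bar> \<le> \<bar>y 1\<bar>" by (simp add: abs_mult mult_left_le)
    then have "\<bar>y 1 * cos ?a - y 0\<bar> \<le> \<bar>y 0\<bar> + \<bar>y 1\<bar>" by linarith
    then have "?a * \<bar>y 1 * cos ?a - y 0\<bar> \<le> ?a * (\<bar>y 0\<bar> + \<bar>y 1\<bar>)" by (intro mult_left_mono) auto
    then show ?thesis by (simp add: abs_mult)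
  qed
  also have "\<bar>LINT x|M01. k x * sin (?a * x)\<bar> \<le> 1 * (LINT x|M01. \<bar>k x\<bar>)"
    by (intro abs_integral_mult_le k continuous_intros) auto
  finally show ?thesis by simp
qed

text \<open>The derivative \<open>K\<close> has mean zero because \<open>y\<close> agrees at the
  endpoints, so \<open>K 0\<close> is minus the mean of \<open>K - K 0\<close> and is controlled by
  \<open>k\<close> alone.\<close>

lemma dirichlet_bounds:
  assumes y: "twice_abs_cont01 y K k" and bc: "y 0 = 0" "y 1 = 0"
  shows "t \<in> {0..1} \<Longrightarrow> \<bar>K t\<bar> \<le> 2 * (LINT x|M01. \<bar>k x\<bar>)" "t \<in> {0..1} \<Longrightarrow> \<bar>y t\<bar> \<le> 2 * (LINT x|M01. \<bar>k x\<bar>)"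
proof -
  let ?k = "LINT x|M01. \<bar>k x\<bar>"
  have yK: "abs_cont01 y K" and Kk: "abs_cont01 K k" using y by (auto simp: twice_abs_cont01_def)
  have K: "integrable M01 K" using yK by (rule abs_cont01D)
  have "(LINT x|M01. K x) = 0" using abs_cont01_at_1[OF yK] bc by simp
  then have "(LINT x|M01. K x - K 0) = - K 0" using K by (simp add: M01.prob_space[simplified])
  then have "\<bar>K 0\<bar> = \<bar>LINT x|M01. K x - K 0\<bar>" by simp
  also have "\<dots> \<le> (LINT x|M01. \<bar>K x - K 0\<bar>)" by (rule integral_abs_bound)
  also have "\<dots> \<le> (LINT x|M01. ?k)"
    using K by (intro integral_mono abs_cont01_diff_le[OF Kk]) auto
  finally have K0: "\<bar>K 0\<bar> \<le> ?k" by (simp add: M01.prob_space[simplified])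
  have Kt: "\<bar>K t\<bar> \<le> 2 * ?k" if "t \<in> {0..1}" for t
    using abs_cont01_diff_le[OF Kk that] K0 by linarith
  then show "t \<in> {0..1} \<Longrightarrow> \<bar>K t\<bar> \<le> 2 * ?k" .
  have "(LINT x|M01. \<bar>K x\<bar>) \<le> (LINT x|M01. 2 * ?k)"
    using K by (intro integral_mono Kt) auto
  then have "(LINT x|M01. \<bar>K x\<bar>) \<le> 2 * ?k" by (simp add: M01.prob_space[simplified])
  then show "t \<in> {0..1} \<Longrightarrow> \<bar>y t\<bar> \<le> 2 * ?k"
    using abs_cont01_diff_le[OF yK, of t] bc by simp
qed

text \<open>The integrated equation is read as two nested indefinite integrals; boundedness of
  \<open>q\<close> makes the inner density integrable.\<close>

lemma ode_sol_twice_abs_cont01: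
  assumes q: "admissible c0 q" and h: "integrable M01 h" and y: "ode_sol q h y"
  shows "\<exists>K. twice_abs_cont01 y K (\<lambda>z. q z * y z - h z)"
proof -
  obtain c where cont: "continuous_on {0..1} y" and
    eq: "\<And>x. x \<in> {0..1} \<Longrightarrow> y x = y 0 + (LBINT t=ereal 0..ereal x. c + (LBINT z=ereal 0..ereal t. q z * y z - h z))"
    using y unfolding ode_sol_def by blast
  define k where "k z = q z * y z - h z" for z
  define K where "K t = c + (LBINT z=ereal 0..ereal t. k z)" for t
  have "L2_01 (\<lambda>z. q z * y z)" by (rule L2_01_admissible_mult[OF q L2_01_continuous[OF cont]])
  then have k: "integrable M01 k" unfolding k_def using h by (auto intro: L2_01_integrable)
  have Kk: "abs_cont01 K k"
  proof (rule abs_cont01I[OF k])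
    fix t :: real assume t: "t \<in> {0..1}"
    have "K 0 = c" by (simp add: K_def interval_lebesgue_integral_def set_lebesgue_integral_def)
    moreover have "K t = c + (LINT z|M01. indicator {..<t} z * k z)"
      using interval_integral_eq_M01[of t k] t unfolding K_def by simp
    ultimately show "K t = K 0 + (LINT z|M01. indicator {..<t} z * k z)" by simp
  qed
  have "abs_cont01 y K"
  proof (rule abs_cont01I)
    show "integrable M01 K" using abs_cont01_continuous[OF Kk] by (rule integrable_M01_continuous)
    fix t :: real assume t: "t \<in> {0..1}"
    have "y t = y 0 + (LBINT t=ereal 0..ereal t. K t)" using eq[OF t] unfolding K_def k_def .
    then show "y t = y 0 + (LINT z|M01. indicator {..<t} z * K z)"
      using interval_integral_eq_M01[of t K] t by simp
  qed
  with Kk show ?thesis unfolding twice_abs_cont01_def k_def by blast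
qed

lemma uniform_limit_ip01:
  assumes v: "integrable M01 v" and S: "\<And>N. continuous_on {0..1} (S N)"
    and lim: "uniform_limit {0..1} S g sequentially"
  shows "continuous_on {0..1} g" "(\<lambda>N. ip01 v (S N)) \<longlonglongrightarrow> ip01 v g"
proof -
  show g: "continuous_on {0..1} g"
    by (rule uniform_limit_theorem[OF _ lim]) (use S in auto)
  show "(\<lambda>N. ip01 v (S N)) \<longlonglongrightarrow> ip01 v g"
  proof (rule LIMSEQ_I)
    fix r :: real assume r: "0 < r"
    define I where "I = (LINT x|M01. \<bar>v x\<bar>)"
    have I: "0 \<le> I" by (simp add: I_def)
    have "0 < r / (I + 1)" using r I by simp
    then obtain N0 where N0: "\<And>N x. N \<ge> N0 \<Longrightarrow> x \<in> {0..1} \<Longrightarrow> dist (S N x) (g x) < r / (I + 1)"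
      using lim unfolding uniform_limit_sequentially_iff by meson
    have "norm (ip01 v (S N) - ip01 v g) < r" if N: "N \<ge> N0" for N
    proof -
      have "ip01 v (S N) - ip01 v g = (LINT x|M01. v x * (S N x - g x))"
        unfolding ip01_eq using integrable_M01_mult_continuous(2)[OF v S] integrable_M01_mult_continuous(2)[OF v g]
        by (simp add: right_diff_distrib)
      also have "\<bar>\<dots>\<bar> \<le> r / (I + 1) * I"
        unfolding I_def[symmetric] using N0[OF N] S g
        by (subst I_def, intro abs_integral_mult_le[OF v] continuous_intros) (auto simp: dist_real_def less_imp_le)
      also have "\<dots> < r" using r I by (simp add: field_simps)
      finally show ?thesis by simp
    qed
    then show "\<exists>no. \<forall>n\<ge>no. norm (ip01 v (S n) - ip01 v g) < r" by blast
  qed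
qed

section \<open>Finite eigenfunction sums for one potential\<close>

locale dirichlet_system =
  fixes c0 :: real and q :: "real \<Rightarrow> real" and lam :: "nat \<Rightarrow> real" and phi :: "nat \<Rightarrow> real \<Rightarrow> real"
  assumes c0: "0 < c0" and adm: "admissible c0 q" and es: "dirichlet_eigensystem q lam phi"
begin

lemma q_AE: "AE x in M01. 0 \<le> q x \<and> q x \<le> c0"
  using adm unfolding admissible_iff by blast

lemma phi_L2: "L2_01 (phi n)" and phi_0: "phi n 0 = 0" and phi_1: "phi n 1 = 0"
  and phi_ode: "ode_sol q (\<lambda>x. lam n * phi n x) (phi n)"
  and phi_orth: "ip01 (phi m) (phi n) = (if m = n then 1 else 0)"
  and phi_complete: "L2_01 v \<Longrightarrow> (\<And>n. ip01 v (phi n) = 0) \<Longrightarrow> ae_eq01 v (\<lambda>_. 0)"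
  using es unfolding dirichlet_eigensystem_def by blast+

lemma phi_cont: "continuous_on {0..1} (phi n)"
  using phi_ode[of n] by (simp add: ode_sol_def)

definition dphi :: "nat \<Rightarrow> real \<Rightarrow> real" where
  "dphi n = (SOME K. twice_abs_cont01 (phi n) K (\<lambda>z. q z * phi n z - lam n * phi n z))"

lemma phi_twice: "twice_abs_cont01 (phi n) (dphi n) (\<lambda>z. q z * phi n z - lam n * phi n z)"
proof -
  have "\<exists>K. twice_abs_cont01 (phi n) K (\<lambda>z. q z * phi n z - lam n * phi n z)"
    by (intro ode_sol_twice_abs_cont01[OF adm _ phi_ode] integrable_mult_right L2_01_integrable phi_L2)
  then show ?thesis unfolding dphi_def by (rule someI_ex)
qed

lemma integral_abs_q_mult_le:
  assumes "L2_01 v"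
  shows "(LINT x|M01. \<bar>q x * v x\<bar>) \<le> c0 * (LINT x|M01. \<bar>v x\<bar>)"
proof -
  have "(LINT x|M01. \<bar>q x * v x\<bar>) \<le> (LINT x|M01. c0 * \<bar>v x\<bar>)"
  proof (rule integral_mono_AE)
    show "integrable M01 (\<lambda>x. \<bar>q x * v x\<bar>)"
      using L2_01_integrable[OF L2_01_admissible_mult[OF adm assms]] by simp
    show "integrable M01 (\<lambda>x. c0 * \<bar>v x\<bar>)" using L2_01_integrable[OF assms] by simp
    show "AE x in M01. \<bar>q x * v x\<bar> \<le> c0 * \<bar>v x\<bar>"
      using q_AE by (rule eventually_mono) (auto simp: abs_mult intro: mult_right_mono)
  qed
  then show ?thesis by simp
qed

text \<open>Testing the equation with \<open>phi n\<close> gives \<open>lam n\<close> as the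
  Dirichlet energy plus a nonnegative potential term; \<open>phi n 0 = 0\<close> bounds the sup norm
  by the root of the energy, and the eigenfunction has norm \<open>1\<close>. The bound lets
  \<open>lam n\<close> be compared with its powers and makes the Mittag-Leffler arguments
  negative.\<close>

lemma lam_ge_1: "1 \<le> lam n"
proof -
  have a1: "abs_cont01 (phi n) (dphi n)" and a2: "abs_cont01 (dphi n) (\<lambda>z. q z * phi n z - lam n * phi n z)"
    using phi_twice[of n] by (auto simp: twice_abs_cont01_def)
  have dL2: "L2_01 (dphi n)" by (rule L2_01_continuous[OF abs_cont01_continuous[OF a2]])
  have "ip01 (dphi n) (dphi n) = - (LINT x|M01. (q x * phi n x - lam n * phi n x) * phi n x)"
    using integral_by_parts01[OF a2 a1] phi_0 phi_1 by (simp add: ip01_eq)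
  also have "(LINT x|M01. (q x * phi n x - lam n * phi n x) * phi n x) =
     (LINT x|M01. q x * phi n x * phi n x) - lam n * ip01 (phi n) (phi n)"
    using L2_01_mult_integrable[OF L2_01_admissible_mult[OF adm phi_L2] phi_L2] L2_01_mult_integrable[OF phi_L2 phi_L2]
    by (simp add: ip01_eq left_diff_distrib mult.assoc)
  also have "ip01 (phi n) (phi n) = 1" by (simp add: phi_orth)
  finally have "ip01 (dphi n) (dphi n) = lam n - (LINT x|M01. q x * phi n x * phi n x)" by simp
  moreover have "0 \<le> (LINT x|M01. q x * phi n x * phi n x)"
    by (rule integral_nonneg_AE) (use q_AE in \<open>auto elim!: eventually_mono simp: mult.assoc\<close>)
  ultimately have le: "ip01 (dphi n) (dphi n) \<le> lam n" by simp
  have sup: "\<bar>phi n x\<bar> \<le> sqrt (ip01 (dphi n) (dphi n))" if "x \<in> {0..1}" for x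
    using abs_cont01_diff_le[OF a1 that] integral_abs_le_L2[OF dL2] phi_0 by simp
  have "1 = (LINT x|M01. phi n x * phi n x)" using phi_orth[of n n] by (simp add: ip01_eq)
  also have "\<dots> \<le> (LINT x|M01. ip01 (dphi n) (dphi n))"
  proof (rule integral_mono)
    show "integrable M01 (\<lambda>x. phi n x * phi n x)" by (rule L2_01_mult_integrable[OF phi_L2 phi_L2])
    fix x assume "x \<in> space M01"
    then have "\<bar>phi n x\<bar> \<le> sqrt (ip01 (dphi n) (dphi n))" using sup by simp
    then have "(phi n x)\<^sup>2 \<le> (sqrt (ip01 (dphi n) (dphi n)))\<^sup>2" by (metis abs_ge_zero power2_abs power_mono)
    then show "phi n x * phi n x \<le> ip01 (dphi n) (dphi n)"
      using ip01_self_nonneg[of "dphi n"] by (simp add: power2_eq_square)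
  qed simp
  also have "\<dots> = ip01 (dphi n) (dphi n)" by (simp add: M01.prob_space[simplified])
  finally show ?thesis using le by simp
qed

text \<open>Index sets are arbitrary because the Cauchy criterion for the series uses blocks
  \<open>{m..<n}\<close> and not only initial segments.\<close>

definition psum :: "(nat \<Rightarrow> real) \<Rightarrow> nat set \<Rightarrow> real \<Rightarrow> real" where
  "psum a I x = (\<Sum>n\<in>I. a n * phi n x)"

lemma psum_cont: "continuous_on {0..1} (psum a I)"
  unfolding psum_def by (intro continuous_intros phi_cont)

lemma psum_L2: "L2_01 (psum a I)"
  by (rule L2_01_continuous[OF psum_cont])

lemma psum_bc: "psum a I 0 = 0" "psum a I 1 = 0"
  by (simp_all add: psum_def phi_0 phi_1)

lemma ip_psum: "L2_01 v \<Longrightarrow> ip01 (psum a I) v = (\<Sum>n\<in>I. a n * ip01 (phi n) v)"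
  unfolding psum_def by (subst ip01_sum) (auto intro: L2_01_cmult phi_L2 simp: ip01_cmult)

lemma ip_psum_phi: "finite I \<Longrightarrow> ip01 (psum a I) (phi m) = (if m \<in> I then a m else 0)"
  by (simp add: ip_psum phi_L2 phi_orth if_distrib cong: if_cong)

lemma ip_psum_self: "finite I \<Longrightarrow> ip01 (psum a I) (psum a I) = (\<Sum>n\<in>I. (a n)\<^sup>2)"
  by (subst ip_psum[OF psum_L2])
    (auto intro!: sum.cong simp: ip01_commute[of "phi _" "psum a I"] ip_psum_phi power2_eq_square)

lemma bessel:
  assumes v: "L2_01 v" and I: "finite I"
  shows "(\<Sum>n\<in>I. (ip01 v (phi n))\<^sup>2) \<le> ip01 v v"
proof -
  define P where "P = psum (\<lambda>n. ip01 v (phi n)) I"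
  define b where "b = (\<Sum>n\<in>I. (ip01 v (phi n))\<^sup>2)"
  have P: "L2_01 P" unfolding P_def by (rule psum_L2)
  have PP: "ip01 P P = b" unfolding P_def b_def by (rule ip_psum_self[OF I])
  have Pv: "ip01 P v = b" unfolding P_def b_def using v
    by (simp add: ip_psum ip01_commute[of "phi _" v] power2_eq_square)
  have "0 \<le> ip01 (\<lambda>x. v x - P x) (\<lambda>x. v x - P x)" by (rule ip01_self_nonneg)
  also have "\<dots> = ip01 v (\<lambda>x. v x - P x) - ip01 P (\<lambda>x. v x - P x)"
    using v P by (simp only: ip01_diff L2_01_diff)
  also have "ip01 v (\<lambda>x. v x - P x) = ip01 v v - b"
    unfolding ip01_commute[of v "\<lambda>x. v x - P x"] using v P Pv by (simp only: ip01_diff)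
  also have "ip01 P (\<lambda>x. v x - P x) = 0"
    unfolding ip01_commute[of P "\<lambda>x. v x - P x"] using v P Pv PP by (simp add: ip01_diff ip01_commute[of v P])
  finally show ?thesis by (simp add: b_def)
qed

lemma psum_twice:
  "\<exists>K. twice_abs_cont01 (psum a I) K (\<lambda>x. q x * psum a I x - psum (\<lambda>n. a n * lam n) I x)"
proof (intro exI)
  have e: "(\<lambda>x. q x * psum a I x - psum (\<lambda>n. a n * lam n) I x) = (\<lambda>x. \<Sum>n\<in>I. a n * (q x * phi n x - lam n * phi n x))"
    by (auto simp: psum_def sum_distrib_left sum_subtractf algebra_simps fun_eq_iff)
  show "twice_abs_cont01 (psum a I) (\<lambda>x. \<Sum>n\<in>I. a n * dphi n x) (\<lambda>x. q x * psum a I x - psum (\<lambda>n. a n * lam n) I x)"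
    unfolding e unfolding psum_def[abs_def] twice_abs_cont01_def
    using phi_twice unfolding twice_abs_cont01_def by (intro conjI abs_cont01_sum) auto
qed

text \<open>This is the \<open>L^1\<close> norm of the second derivative of the sum. As
  \<open>lam n \<ge> 1\<close>, the sums with coefficients \<open>a n\<close> and
  \<open>a n * lam n\<close> both have \<open>L^2\<close> norm at most \<open>B\<close>, and on a
  probability space the \<open>L^1\<close> norm is below the \<open>L^2\<close> norm. The result
  does not depend on the number of terms.\<close>

lemma psum_source_bound:
  assumes "finite I" "(\<Sum>n\<in>I. (a n * lam n)\<^sup>2) \<le> B\<^sup>2" "0 \<le> B"
  shows "(LINT x|M01. \<bar>q x * psum a I x - psum (\<lambda>n. a n * lam n) I x\<bar>) \<le> (c0 + 1) * B"
proof -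
  let ?S = "psum a I" and ?L = "psum (\<lambda>n. a n * lam n) I"
  have "(\<Sum>n\<in>I. (a n)\<^sup>2) \<le> (\<Sum>n\<in>I. (a n * lam n)\<^sup>2)"
  proof (rule sum_mono)
    fix n
    have "1 \<le> (lam n)\<^sup>2" using lam_ge_1[of n] by (simp add: one_le_power)
    then show "(a n)\<^sup>2 \<le> (a n * lam n)\<^sup>2" by (simp add: power_mult_distrib mult_le_cancel_left1)
  qed
  then have "(\<Sum>n\<in>I. (a n)\<^sup>2) \<le> B\<^sup>2" using assms by simp
  then have S: "(LINT x|M01. \<bar>?S x\<bar>) \<le> B"
    using integral_abs_le_L2[OF psum_L2, of a I] assms real_sqrt_le_mono[of "\<Sum>n\<in>I. (a n)\<^sup>2" "B\<^sup>2"] by (simp add: ip_psum_self)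
  have L: "(LINT x|M01. \<bar>?L x\<bar>) \<le> B"
    using integral_abs_le_L2[OF psum_L2, of "\<lambda>n. a n * lam n" I] assms real_sqrt_le_mono[OF assms(2)] by (simp add: ip_psum_self)
  have qS: "integrable M01 (\<lambda>x. q x * ?S x)" by (intro L2_01_integrable L2_01_admissible_mult[OF adm] psum_L2)
  have iL: "integrable M01 ?L" by (intro L2_01_integrable psum_L2)
  have "(LINT x|M01. \<bar>q x * ?S x - ?L x\<bar>) \<le> (LINT x|M01. \<bar>q x * ?S x\<bar> + \<bar>?L x\<bar>)"
    using qS iL by (intro integral_mono) auto
  also have "\<dots> = (LINT x|M01. \<bar>q x * ?S x\<bar>) + (LINT x|M01. \<bar>?L x\<bar>)" using qS iL by simp
  also have "\<dots> \<le> c0 * (LINT x|M01. \<bar>?S x\<bar>) + B" using integral_abs_q_mult_le[OF psum_L2, of a I] L by (rule add_mono)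
  also have "\<dots> \<le> c0 * B + B" using S c0 by (intro add_mono mult_left_mono) auto
  finally show ?thesis by (simp add: algebra_simps)
qed

lemma psum_estimates:
  assumes "finite I" "(\<Sum>n\<in>I. (a n * lam n)\<^sup>2) \<le> B\<^sup>2" "0 \<le> B"
  shows "t \<in> {0..1} \<Longrightarrow> \<bar>psum a I t\<bar> \<le> 2 * ((c0 + 1) * B)"
    and "(real m * pi)\<^sup>2 * \<bar>ip01 (psum a I) (\<lambda>x. sin (real m * pi * x))\<bar> \<le> (c0 + 1) * B"
    and "(real m * pi)\<^sup>2 * \<bar>ip01 (psum a I) (\<lambda>x. cos (real m * pi * x))\<bar> \<le> 5 * ((c0 + 1) * B)"
proof -
  obtain K where K: "twice_abs_cont01 (psum a I) K (\<lambda>x. q x * psum a I x - psum (\<lambda>n. a n * lam n) I x)"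
    using psum_twice by blast
  note src = psum_source_bound[OF assms]
  show "t \<in> {0..1} \<Longrightarrow> \<bar>psum a I t\<bar> \<le> 2 * ((c0 + 1) * B)"
    using dirichlet_bounds(2)[OF K psum_bc] src by fastforce
  show "(real m * pi)\<^sup>2 * \<bar>ip01 (psum a I) (\<lambda>x. sin (real m * pi * x))\<bar> \<le> (c0 + 1) * B"
    using sin_coeff_bound[OF K, of m] src psum_bc[of a I] by simp
  \<comment> \<open>The two endpoint slopes contribute \<open>2\<close> each and the second
    derivative contributes \<open>1\<close>.\<close>
  show "(real m * pi)\<^sup>2 * \<bar>ip01 (psum a I) (\<lambda>x. cos (real m * pi * x))\<bar> \<le> 5 * ((c0 + 1) * B)"
    using cos_coeff_bound[OF K, of m] src dirichlet_bounds(1)[OF K psum_bc, of 0] dirichlet_bounds(1)[OF K psum_bc, of 1] by simp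
qed

text \<open>Symmetry of the operator: both functions vanish at the endpoints, so Green's identity
  leaves no boundary terms.\<close>

lemma ip_phi_domain:
  assumes e: "twice_abs_cont01 e e1 e2" "e 0 = 0" "e 1 = 0" and e2: "L2_01 e2"
  shows "lam n * ip01 (phi n) e = ip01 (phi n) (\<lambda>x. q x * e x - e2 x)"
proof -
  have eL2: "L2_01 e" using twice_abs_cont01_continuous(1)[OF e(1)] by (rule L2_01_continuous)
  have qe: "L2_01 (\<lambda>x. q x * e x)" by (rule L2_01_admissible_mult[OF adm eL2])
  have i: "integrable M01 (\<lambda>x. q x * phi n x * e x)" by (rule L2_01_mult_integrable[OF L2_01_admissible_mult[OF adm phi_L2] eL2])
  have "(LINT x|M01. phi n x * e2 x) = (LINT x|M01. (q x * phi n x - lam n * phi n x) * e x)"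
    using green_identity01[OF phi_twice[of n] e(1)] e phi_0 phi_1 by simp
  also have "\<dots> = (LINT x|M01. q x * phi n x * e x - lam n * (phi n x * e x))"
    by (simp add: left_diff_distrib mult.assoc)
  also have "\<dots> = (LINT x|M01. q x * phi n x * e x) - lam n * ip01 (phi n) e"
    using i L2_01_mult_integrable[OF phi_L2 eL2, of n] by (simp add: ip01_eq)
  finally have 1: "lam n * ip01 (phi n) e = (LINT x|M01. q x * phi n x * e x) - (LINT x|M01. phi n x * e2 x)" by simp
  have "ip01 (phi n) (\<lambda>x. q x * e x - e2 x) = ip01 (\<lambda>x. q x * e x) (phi n) - ip01 e2 (phi n)"
    unfolding ip01_commute[of "phi n"] using qe e2 phi_L2 by (simp add: ip01_diff)
  also have "ip01 (\<lambda>x. q x * e x) (phi n) = (LINT x|M01. q x * phi n x * e x)"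
    by (simp add: ip01_eq mult_ac)
  also have "ip01 e2 (phi n) = (LINT x|M01. phi n x * e2 x)" by (simp add: ip01_eq mult_ac)
  finally show ?thesis using 1 by simp
qed

text \<open>The eigenfunction series of a function in the domain of the operator converges uniformly, so its sum
  is continuous and no completeness of the space of square-integrable functions is needed.\<close>

lemma eigen_expansion:
  assumes e: "twice_abs_cont01 e e1 e2" "e 0 = 0" "e 1 = 0" and e2: "L2_01 e2" and v: "L2_01 v"
  shows "(\<lambda>N. \<Sum>n<N. ip01 v (phi n) * ip01 (phi n) e) \<longlonglongrightarrow> ip01 v e"
proof -
  define Ae where "Ae x = q x * e x - e2 x" for x
  define b where "b n = ip01 (phi n) e" for n
  define S where "S N = psum b {..<N}" for N
  have ce: "continuous_on {0..1} e" using twice_abs_cont01_continuous(1)[OF e(1)] .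
  have eL2: "L2_01 e" using ce by (rule L2_01_continuous)
  have AeL2: "L2_01 Ae" unfolding Ae_def by (intro L2_01_diff L2_01_admissible_mult[OF adm] eL2 e2)
  have bl: "b n * lam n = ip01 Ae (phi n)" for n
    using ip_phi_domain[OF e e2, of n] by (simp add: b_def Ae_def[abs_def] ip01_commute mult.commute)
  have summ: "summable (\<lambda>n. (b n * lam n)\<^sup>2)"
    unfolding bl by (rule summableI_nonneg_bounded[where x = "ip01 Ae Ae"]) (auto intro: bessel[OF AeL2])
  have "uniformly_convergent_on {0..1} S"
  proof (rule Cauchy_uniformly_convergent, rule uniformly_Cauchy_onI')
    fix r :: real assume r: "0 < r"
    \<comment> \<open>The sup estimate for a block is \<open>2 * ((c0 + 1) * B)\<close>, which
      becomes \<open>r / 2\<close>.\<close>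
    define B where "B = r / 4 / (c0 + 1)"
    have B: "0 < B" using r c0 by (simp add: B_def)
    obtain M where M: "\<And>m n. M \<le> m \<Longrightarrow> norm (\<Sum>i\<in>{m..<n}. (b i * lam i)\<^sup>2) < B\<^sup>2"
      using summ B unfolding summable_Cauchy by (metis zero_less_power)
    have "dist (S m x) (S n x) < r" if x: "x \<in> {0..1}" and mn: "M \<le> m" "m < n" for x m n
    proof -
      have "(\<Sum>i\<in>{m..<n}. (b i * lam i)\<^sup>2) \<le> B\<^sup>2" using M[of m n] mn by (simp add: sum_nonneg)
      then have "\<bar>psum b {m..<n} x\<bar> \<le> 2 * ((c0 + 1) * B)"
        using B x by (intro psum_estimates(1)) auto
      also have "(c0 + 1) * B = r / 4"
      proof -
        have "d * (r / 4 / d) = r / 4" if "d \<noteq> 0" for d :: real using that by simp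
        from this[of "c0 + 1"] show ?thesis unfolding B_def using c0 by argo
      qed
      also have "2 * (r / 4) < r" using r by simp
      also have "psum b {m..<n} x = S n x - S m x"
        using mn sum_diff_nat_ivl[of 0 m n "\<lambda>n. b n * phi n x"] by (simp add: S_def psum_def lessThan_atLeast0)
      finally show ?thesis by (simp add: dist_real_def abs_minus_commute)
    qed
    then show "\<exists>M. \<forall>x\<in>{0..1}. \<forall>m\<ge>M. \<forall>n>m. dist (S m x) (S n x) < r" by blast
  qed
  then obtain g where g: "uniform_limit {0..1} S g sequentially" unfolding uniformly_convergent_on_def by blast
  have Sc: "continuous_on {0..1} (S N)" for N unfolding S_def by (rule psum_cont)
  have gc: "continuous_on {0..1} g" by (rule uniform_limit_ip01(1)[OF L2_01_integrable[OF v] Sc g])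
  have gL2: "L2_01 g" by (rule L2_01_continuous[OF gc])
  have "ip01 (phi n) g = b n" for n
  proof -
    have "(\<lambda>N. ip01 (phi n) (S N)) \<longlonglongrightarrow> ip01 (phi n) g"
      by (rule uniform_limit_ip01(2)[OF L2_01_integrable[OF phi_L2] Sc g])
    moreover have "\<forall>\<^sub>F N in sequentially. ip01 (phi n) (S N) = b n"
      using eventually_gt_at_top[of n]
      by eventually_elim (simp add: S_def ip01_commute[of "phi n"] ip_psum_phi)
    then have "(\<lambda>N. ip01 (phi n) (S N)) \<longlonglongrightarrow> b n" by (rule tendsto_eventually)
    ultimately show ?thesis by (rule LIMSEQ_unique)
  qed
  \<comment> \<open>The uniform limit has the same coefficients as \<open>e\<close>; completeness of
    the eigenfunctions then identifies the two almost everywhere.\<close>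
  then have "ip01 (\<lambda>x. e x - g x) (phi n) = 0" for n
    using eL2 gL2 phi_L2 by (subst ip01_diff) (auto simp: ip01_commute[of e "phi n"] ip01_commute[of g "phi n"] b_def)
  then have "ae_eq01 (\<lambda>x. e x - g x) (\<lambda>_. 0)" by (intro phi_complete L2_01_diff eL2 gL2)
  then have "ae_eq01 e g" by (simp add: ae_eq01_iff)
  then have "ip01 v e = ip01 v g"
    unfolding ip01_commute[of v] using eL2 gL2 v by (rule ip01_cong_AE)
  moreover have "(\<lambda>N. ip01 v (S N)) \<longlonglongrightarrow> ip01 v g"
    by (rule uniform_limit_ip01(2)[OF L2_01_integrable[OF v] Sc g])
  moreover have "ip01 v (S N) = (\<Sum>n<N. ip01 v (phi n) * ip01 (phi n) e)" for N
    unfolding ip01_commute[of v "S N"] S_def by (simp add: ip_psum[OF v] b_def ip01_commute[of v] mult.commute)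
  ultimately show ?thesis by simp
qed

end

section \<open>Cosine series and multiplication\<close>

abbreviation sin_pi :: "nat \<Rightarrow> real \<Rightarrow> real" where "sin_pi m \<equiv> \<lambda>x. sin (real m * pi * x)"
abbreviation cos_pi :: "nat \<Rightarrow> real \<Rightarrow> real" where "cos_pi k \<equiv> \<lambda>x. cos (real k * pi * x)"

lemma continuous_sin_pi: "continuous_on S (sin_pi m)" and continuous_cos_pi: "continuous_on S (cos_pi k)"
  by (auto intro!: continuous_intros)

lemma integral_cos_of_int: "(LINT x|M01. cos (of_int i * pi * x)) = (if i = 0 then 1 else 0)"
proof (cases "i = 0")
  case True then show ?thesis by (simp add: M01.prob_space[simplified])
next
  case False
  let ?a = "of_int i * pi"
  have "abs_cont01 (\<lambda>x. sin (?a * x)) (\<lambda>x. ?a * cos (?a * x))"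
    using twice_abs_cont01_sin[of ?a] by (simp add: twice_abs_cont01_def)
  moreover have "sin ?a = 0" by (subst sin_times_pi_eq_0) simp
  ultimately have "?a * (LINT x|M01. cos (?a * x)) = 0"
    using abs_cont01_at_1[of "\<lambda>x. sin (?a * x)" "\<lambda>x. ?a * cos (?a * x)"] by simp
  then show ?thesis using False by simp
qed

lemma ip01_cos_pi: "ip01 (cos_pi j) (cos_pi k) = (if j = k then if k = 0 then 1 else 1/2 else 0)"
proof -
  have e: "cos_pi j x * cos_pi k x = (cos (of_int (int j - int k) * pi * x) + cos (of_int (int j + int k) * pi * x)) / 2" for x
    by (simp add: cos_times_cos algebra_simps)
  have "ip01 (cos_pi j) (cos_pi k) = ((LINT x|M01. cos (of_int (int j - int k) * pi * x)) + (LINT x|M01. cos (of_int (int j + int k) * pi * x))) / 2"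
    unfolding ip01_eq e
    by (subst Bochner_Integration.integral_add[symmetric]) (auto intro!: integrable_M01_continuous continuous_intros)
  then show ?thesis unfolding integral_cos_of_int by auto
qed

text \<open>Completeness of the cosines by the Weierstrass theorem: the substitution
  \<open>t = cos (\<pi> x)\<close> carries \<open>D\<close> to a continuous function on
  \<open>[-1, 1]\<close>, and all polynomials in \<open>cos (\<pi> x)\<close> are orthogonal to
  \<open>D\<close>.\<close>

lemma ip01_eq_0_of_cos_coeffs:
  assumes D: "continuous_on {0..1} D" and zero: "\<And>k. ip01 D (cos_pi k) = 0"
  shows "ip01 D D = 0"
proof -
  have Di: "integrable M01 D" by (rule integrable_M01_continuous[OF D])
  \<comment> \<open>The extra factor \<open>cos_pi k\<close> keeps the induction on the power going:
    one factor \<open>cos (\<pi> x)\<close> is absorbed by shifting \<open>k\<close> up and down by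
    one, and for \<open>k = 0\<close> it simply raises \<open>k\<close> to \<open>1\<close>.\<close>
  have pw: "ip01 D (\<lambda>x. cos (pi * x) ^ j * cos_pi k x) = 0" for j k
  proof (induction j arbitrary: k)
    case 0 then show ?case using zero[of k] by simp
  next
    case (Suc j)
    show ?case
    proof (cases k)
      case 0
      then show ?thesis using Suc[of 1] by (simp add: mult.commute)
    next
      case (Suc i)
      have e: "cos (pi * x) ^ Suc j * cos_pi k x = (cos (pi * x) ^ j * cos_pi (k + 1) x) / 2 + (cos (pi * x) ^ j * cos_pi i x) / 2" for x
      proof -
        have "cos (pi * x) * cos_pi k x = cos_pi (k + 1) x / 2 + cos_pi i x / 2"
          using cos_times_cos[of "real k * pi * x" "pi * x"] Suc by (simp add: algebra_simps add_divide_distrib)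
        then have "cos (pi * x) ^ j * (cos (pi * x) * cos_pi k x) = cos (pi * x) ^ j * (cos_pi (k + 1) x / 2 + cos_pi i x / 2)" by simp
        then show ?thesis by (simp only: power_Suc2 mult.assoc distrib_left times_divide_eq_right)
      qed
      have i1: "integrable M01 (\<lambda>x. D x * (cos (pi * x) ^ j * cos_pi l x))" for l
        by (intro integrable_M01_mult_continuous(2)[OF Di] continuous_intros)
      have "ip01 D (\<lambda>x. cos (pi * x) ^ Suc j * cos_pi k x) =
        ip01 D (\<lambda>x. cos (pi * x) ^ j * cos_pi (k + 1) x) / 2 + ip01 D (\<lambda>x. cos (pi * x) ^ j * cos_pi i x) / 2"
        unfolding e unfolding ip01_eq using i1[of "k + 1"] i1[of i] by (simp add: distrib_left)
      then show ?thesis using Suc.IH[of "k + 1"] Suc.IH[of i] by simp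
    qed
  qed
  have le: "ip01 D D \<le> r * (LINT x|M01. \<bar>D x\<bar>)" if r: "0 < r" for r
  proof -
    have arc: "continuous_on {-1..1} (\<lambda>t. D (arccos t / pi))"
    proof (rule continuous_on_compose2[OF D])
      show "continuous_on {-1..1} (\<lambda>t. arccos t / pi)"
        by (intro continuous_intros continuous_on_arccos') simp
      show "(\<lambda>t. arccos t / pi) ` {-1..1} \<subseteq> {0..1}"
        using arccos_lbound arccos_ubound by (auto simp: divide_le_eq_1)
    qed
    obtain p where p: "real_polynomial_function p" "\<And>t. t \<in> {-1..1} \<Longrightarrow> \<bar>D (arccos t / pi) - p t\<bar> < r"
      using Stone_Weierstrass_real_polynomial_function[OF compact_Icc arc r] by blast
    obtain a n where an: "p = (\<lambda>t. \<Sum>i\<le>n. a i * t ^ i)"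
      using p(1) unfolding real_polynomial_function_iff_sum by blast
    have pc: "continuous_on {0..1} (\<lambda>x. p (cos (pi * x)))" unfolding an by (intro continuous_intros)
    have "ip01 D (\<lambda>x. p (cos (pi * x))) = (\<Sum>i\<le>n. a i * ip01 D (\<lambda>x. cos (pi * x) ^ i * cos_pi 0 x))"
    proof -
      have "ip01 D (\<lambda>x. p (cos (pi * x))) = (LINT x|M01. (\<Sum>i\<le>n. a i * (D x * cos (pi * x) ^ i)))"
        unfolding ip01_eq an by (simp add: sum_distrib_left mult.left_commute)
      also have "\<dots> = (\<Sum>i\<le>n. (LINT x|M01. a i * (D x * cos (pi * x) ^ i)))"
        by (intro Bochner_Integration.integral_sum integrable_mult_right integrable_M01_mult_continuous(2)[OF Di] continuous_intros)
      finally show ?thesis by (simp add: ip01_eq)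
    qed
    then have p0: "ip01 D (\<lambda>x. p (cos (pi * x))) = 0" by (simp only: pw mult_zero_right sum.neutral_const)
    have "ip01 D D = ip01 D D - ip01 D (\<lambda>x. p (cos (pi * x)))" using p0 by simp
    also have "\<dots> = (LINT x|M01. D x * (D x - p (cos (pi * x))))"
      unfolding ip01_eq using integrable_M01_mult_continuous(2)[OF Di D] integrable_M01_mult_continuous(2)[OF Di pc]
      by (simp add: right_diff_distrib)
    also have "\<dots> \<le> \<bar>LINT x|M01. D x * (D x - p (cos (pi * x)))\<bar>" by simp
    also have "\<dots> \<le> r * (LINT x|M01. \<bar>D x\<bar>)"
    proof (rule abs_integral_mult_le[OF Di])
      show "continuous_on {0..1} (\<lambda>x. D x - p (cos (pi * x)))" by (intro continuous_intros D pc)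
      fix x :: real assume x: "x \<in> {0..1}"
      then have "arccos (cos (pi * x)) = pi * x" by (intro arccos_cos) auto
      then show "\<bar>D x - p (cos (pi * x))\<bar> \<le> r" using p(2)[of "cos (pi * x)"] by simp
    qed
    finally show ?thesis .
  qed
  define I where "I = (LINT x|M01. \<bar>D x\<bar>)"
  have I: "0 \<le> I" by (simp add: I_def)
  have "ip01 D D \<le> 0"
  proof (rule field_le_epsilon)
    fix r :: real assume r: "0 < r"
    have "ip01 D D \<le> r / (I + 1) * I" using le[of "r / (I + 1)", folded I_def] r I by simp
    also have "\<dots> \<le> r" using r I by (simp add: field_simps)
    finally show "ip01 D D \<le> 0 + r" by simp
  qed
  then show ?thesis using ip01_self_nonneg[of D] by simp
qed

lemma summable_Suc_powr: "s < -1 \<Longrightarrow> summable (\<lambda>k. real (Suc k) powr s)"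
  using summable_Suc_iff[of "\<lambda>k. real k powr s"] summable_real_powr_iff[of s] by simp

text \<open>Quadratic decay makes the series uniformly convergent, its sum has the coefficients of
  \<open>W\<close>, and completeness identifies the two. The factors \<open>1\<close> and
  \<open>2\<close> invert the square norms \<open>1\<close> and \<open>1/2\<close> of the
  cosines.\<close>

lemma cosine_series_ip01:
  assumes W: "continuous_on {0..1} W" and B: "\<And>k. \<bar>ip01 W (cos_pi k)\<bar> \<le> B * real (Suc k) powr (- 2)"
    and v: "L2_01 v"
  shows "(\<lambda>J. \<Sum>k<J. (if k = 0 then 1 else 2) * ip01 W (cos_pi k) * ip01 v (cos_pi k)) \<longlonglongrightarrow> ip01 v W"
proof -
  define c where "c k = (if k = 0 then 1 else 2) * ip01 W (cos_pi k)" for k :: nat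
  define g where "g x = (\<Sum>k. c k * cos_pi k x)" for x
  define S where "S J x = (\<Sum>k<J. c k * cos_pi k x)" for J x
  have cb: "\<bar>c k\<bar> \<le> 2 * B * real (Suc k) powr (- 2)" for k
    using B[of k] by (auto simp: c_def abs_mult)
  have ul: "uniform_limit {0..1} S g sequentially"
    unfolding S_def[abs_def] g_def[abs_def]
  proof (rule Weierstrass_m_test)
    show "summable (\<lambda>k. 2 * B * real (Suc k) powr (- 2))" by (intro summable_mult summable_Suc_powr) simp
    fix k and x :: real
    have "\<bar>c k * cos_pi k x\<bar> \<le> \<bar>c k\<bar> * 1" unfolding abs_mult by (intro mult_left_mono) auto
    then show "norm (c k * cos_pi k x) \<le> 2 * B * real (Suc k) powr (- 2)" using cb[of k] by simp
  qed
  have Sc: "continuous_on {0..1} (S J)" for J unfolding S_def[abs_def] by (intro continuous_intros)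
  have vi: "integrable M01 v" by (rule L2_01_integrable[OF v])
  have gc: "continuous_on {0..1} g" by (rule uniform_limit_ip01(1)[OF vi Sc ul])
  have ipS: "ip01 u (S J) = (\<Sum>k<J. c k * ip01 u (cos_pi k))" if "integrable M01 u" for u J
  proof -
    have "ip01 u (S J) = (LINT x|M01. (\<Sum>k<J. c k * (u x * cos_pi k x)))"
      unfolding ip01_eq S_def by (simp add: sum_distrib_left mult.left_commute)
    also have "\<dots> = (\<Sum>k<J. (LINT x|M01. c k * (u x * cos_pi k x)))"
      by (intro Bochner_Integration.integral_sum integrable_mult_right integrable_M01_mult_continuous(2)[OF that] continuous_cos_pi)
    finally show ?thesis by (simp add: ip01_eq)
  qed
  have "ip01 (cos_pi k) g = ip01 W (cos_pi k)" for k
  proof -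
    have ic: "integrable M01 (cos_pi k)" by (intro integrable_M01_continuous continuous_cos_pi)
    have "(\<lambda>J. ip01 (cos_pi k) (S J)) \<longlonglongrightarrow> ip01 (cos_pi k) g"
      by (rule uniform_limit_ip01(2)[OF ic Sc ul])
    moreover have "\<forall>\<^sub>F J in sequentially. ip01 (cos_pi k) (S J) = ip01 W (cos_pi k)"
      using eventually_gt_at_top[of k]
    proof eventually_elim
      case (elim J)
      have "ip01 (cos_pi k) (S J) = (\<Sum>l<J. c l * ip01 (cos_pi k) (cos_pi l))" by (rule ipS[OF ic])
      also have "\<dots> = (\<Sum>l<J. if l = k then ip01 W (cos_pi k) else 0)"
        by (intro sum.cong refl) (auto simp: ip01_cos_pi c_def)
      also have "\<dots> = ip01 W (cos_pi k)" using elim by simp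
      finally show ?case .
    qed
    then have "(\<lambda>J. ip01 (cos_pi k) (S J)) \<longlonglongrightarrow> ip01 W (cos_pi k)" by (rule tendsto_eventually)
    ultimately show ?thesis by (rule LIMSEQ_unique)
  qed
  then have z: "ip01 (\<lambda>x. W x - g x) (cos_pi k) = 0" for k
    using L2_01_continuous[OF W] L2_01_continuous[OF gc] L2_01_continuous[OF continuous_cos_pi]
    by (subst ip01_diff) (auto simp: ip01_commute[of g])
  have Dc: "continuous_on {0..1} (\<lambda>x. W x - g x)" by (intro continuous_intros W gc)
  have "ip01 (\<lambda>x. W x - g x) (\<lambda>x. W x - g x) = 0" by (rule ip01_eq_0_of_cos_coeffs[OF Dc z])
  then have "AE x in M01. (W x - g x) * (W x - g x) = 0"
    unfolding ip01_eq
    by (subst (asm) integral_nonneg_eq_0_iff_AE) (auto intro!: L2_01_mult_integrable L2_01_continuous Dc)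
  then have "ae_eq01 W g" unfolding ae_eq01_iff by (rule eventually_mono) simp
  then have "ip01 v W = ip01 v g"
    unfolding ip01_commute[of v] by (rule ip01_cong_AE) (intro L2_01_continuous W gc v)+
  then show ?thesis using uniform_limit_ip01(2)[OF vi Sc ul] unfolding ipS[OF vi] by (simp add: c_def)
qed

section \<open>Weighted convolution of sine coefficients\<close>

text \<open>A natural number, so that it can index a sine coefficient; for \<open>k > m\<close> the
  sine of the difference frequency changes sign, which is invisible to the absolute values estimated
  with it.\<close>

definition ndist :: "nat \<Rightarrow> nat \<Rightarrow> nat" where
  "ndist m k = (if k \<le> m then m - k else k - m)"

text \<open>Product-to-sum formula: multiplication by a cosine translates the sine frequency by
  \<open>k\<close> in both directions.\<close>

lemma abs_ip01_mult_cos_le: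
  assumes q: "L2_01 q"
  shows "\<bar>ip01 (\<lambda>x. q x * sin_pi m x) (cos_pi k)\<bar> \<le>
    (\<bar>ip01 q (sin_pi (m + k))\<bar> + \<bar>ip01 q (sin_pi (ndist m k))\<bar>) / 2"
proof -
  have e: "q x * sin_pi m x * cos_pi k x = q x * sin_pi (m + k) x / 2 + q x * sin ((real m - real k) * pi * x) / 2" for x
  proof -
    have "sin_pi m x * cos_pi k x = sin_pi (m + k) x / 2 + sin ((real m - real k) * pi * x) / 2"
    proof -
      have "real m * pi * x + real k * pi * x = real (m + k) * pi * x"
        "real m * pi * x - real k * pi * x = (real m - real k) * pi * x"
        by (simp_all add: algebra_simps)
      then show ?thesis using sin_times_cos[of "real m * pi * x" "real k * pi * x"]
        by (simp only: add_divide_distrib)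
    qed
    then show ?thesis by (simp only: mult.assoc distrib_left times_divide_eq_right)
  qed
  have i: "integrable M01 (\<lambda>x. q x * sin (a * pi * x))" for a
    by (intro integrable_M01_mult_continuous(2)[OF L2_01_integrable[OF q]] continuous_intros)
  define Z where "Z = (LINT x|M01. q x * sin ((real m - real k) * pi * x))"
  have "ip01 (\<lambda>x. q x * sin_pi m x) (cos_pi k) = ip01 q (sin_pi (m + k)) / 2 + Z / 2"
    unfolding ip01_eq e Z_def using i[of "real (m + k)"] i[of "real m - real k"] by simp
  moreover have "\<bar>Z\<bar> = \<bar>ip01 q (sin_pi (ndist m k))\<bar>"
  proof (cases "k \<le> m")
    case True then show ?thesis by (simp add: Z_def ndist_def ip01_eq of_nat_diff)
  next
    case False
    have "sin ((real m - real k) * pi * x) = - sin_pi (ndist m k) x" for x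
    proof -
      have "(real m - real k) * pi * x = - (real (ndist m k) * pi * x)"
        using False by (simp add: ndist_def of_nat_diff algebra_simps)
      then show ?thesis by (simp only: sin_minus)
    qed
    then show ?thesis by (simp add: Z_def ip01_eq)
  qed
  moreover have "\<bar>a / 2 + z / 2\<bar> \<le> (\<bar>a\<bar> + \<bar>z\<bar>) / 2" for a z :: real
    using abs_triangle_ineq[of "a / 2" "z / 2"] by (simp add: add_divide_distrib)
  ultimately show ?thesis by metis
qed

text \<open>Young's inequality for an \<open>l^1\<close> kernel acting on \<open>l^2\<close>, in
  finite sections with a bound free of \<open>M\<close> and \<open>J\<close>. The constant
  \<open>6\<close> is \<open>2 * 1 + 2 * 2\<close>: squaring a sum of two costs \<open>2\<close>,
  the shift \<open>m + k\<close> is injective in \<open>m\<close>, and \<open>ndist m k\<close>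
  takes each value at most twice.\<close>

lemma discrete_young:
  fixes b A :: "nat \<Rightarrow> real"
  assumes A: "\<And>k. 0 \<le> A k" "summable A" and b: "summable (\<lambda>j. (b j)\<^sup>2)"
  shows "(\<Sum>m<M. (\<Sum>k<J. A k * (b (m + k) + b (ndist m k)))\<^sup>2) \<le> 6 * (\<Sum>k. A k)\<^sup>2 * (\<Sum>j. (b j)\<^sup>2)"
proof -
  define a where "a = (\<Sum>k. A k)"
  define \<beta> where "\<beta> = (\<Sum>j. (b j)\<^sup>2)"
  have bet: "(\<Sum>j\<in>I. (b j)\<^sup>2) \<le> \<beta>" if "finite I" for I
    unfolding \<beta>_def using b that by (intro sum_le_suminf) auto
  have \<beta>0: "0 \<le> \<beta>" using bet[of "{}"] by simp
  have asum: "(\<Sum>k<J. A k) \<le> a" unfolding a_def using A by (intro sum_le_suminf) auto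
  have a0: "0 \<le> a" unfolding a_def using A by (intro suminf_nonneg)
  have inner: "(\<Sum>m<M. (b (m + k) + b (ndist m k))\<^sup>2) \<le> 6 * \<beta>" for k
  proof -
    have "(\<Sum>m<M. (b (m + k) + b (ndist m k))\<^sup>2) \<le> (\<Sum>m<M. 2 * (b (m + k))\<^sup>2 + 2 * (b (ndist m k))\<^sup>2)"
    proof (rule sum_mono)
      fix m
      have "0 \<le> (b (m + k) - b (ndist m k))\<^sup>2" by simp
      then show "(b (m + k) + b (ndist m k))\<^sup>2 \<le> 2 * (b (m + k))\<^sup>2 + 2 * (b (ndist m k))\<^sup>2"
        by (simp add: power2_sum power2_diff)
    qed
    also have "\<dots> = 2 * (\<Sum>m<M. (b (m + k))\<^sup>2) + 2 * (\<Sum>m<M. (b (ndist m k))\<^sup>2)"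
      by (simp add: sum.distrib sum_distrib_left)
    also have "(\<Sum>m<M. (b (m + k))\<^sup>2) = (\<Sum>j\<in>(\<lambda>m. m + k) ` {..<M}. (b j)\<^sup>2)"
      by (subst sum.reindex) (auto simp: inj_on_def)
    also have "\<dots> \<le> \<beta>" by (rule bet) simp
    also have "(\<Sum>m<M. (b (ndist m k))\<^sup>2) \<le> 2 * \<beta>"
    proof -
      have "(\<Sum>m<M. (b (ndist m k))\<^sup>2) = (\<Sum>m\<in>{..<M} \<inter> {k..}. (b (ndist m k))\<^sup>2) + (\<Sum>m\<in>{..<M} - {k..}. (b (ndist m k))\<^sup>2)"
        by (rule sum.Int_Diff) simp
      also have "(\<Sum>m\<in>{..<M} \<inter> {k..}. (b (ndist m k))\<^sup>2) = (\<Sum>j\<in>(\<lambda>m. ndist m k) ` ({..<M} \<inter> {k..}). (b j)\<^sup>2)"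
        by (subst sum.reindex) (auto simp: inj_on_def ndist_def)
      also have "\<dots> \<le> \<beta>" by (rule bet) simp
      also have "(\<Sum>m\<in>{..<M} - {k..}. (b (ndist m k))\<^sup>2) = (\<Sum>j\<in>(\<lambda>m. ndist m k) ` ({..<M} - {k..}). (b j)\<^sup>2)"
        by (subst sum.reindex) (auto simp: inj_on_def ndist_def)
      also have "\<dots> \<le> \<beta>" by (rule bet) simp
      finally show ?thesis by simp
    qed
    finally show ?thesis by simp
  qed
  have "(\<Sum>m<M. (\<Sum>k<J. A k * (b (m + k) + b (ndist m k)))\<^sup>2) \<le>
    (\<Sum>m<M. a * (\<Sum>k<J. A k * (b (m + k) + b (ndist m k))\<^sup>2))"
  proof (rule sum_mono)
    fix m
    let ?x = "\<lambda>k. b (m + k) + b (ndist m k)"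
    \<comment> \<open>Splitting each weight into two square roots prepares Cauchy-Schwarz: one root
      yields the total mass of \<open>A\<close>, the other stays with the convolved terms.\<close>
    have "(\<Sum>k<J. A k * ?x k)\<^sup>2 = (\<Sum>k<J. sqrt (A k) * (sqrt (A k) * ?x k))\<^sup>2"
      using A(1) by (simp add: mult.assoc[symmetric])
    also have "\<dots> \<le> (\<Sum>k<J. (sqrt (A k))\<^sup>2) * (\<Sum>k<J. (sqrt (A k) * ?x k)\<^sup>2)"
      by (rule Cauchy_Schwarz_ineq_sum)
    also have "\<dots> = (\<Sum>k<J. A k) * (\<Sum>k<J. A k * (?x k)\<^sup>2)"
      using A(1) by (simp add: power_mult_distrib)
    also have "\<dots> \<le> a * (\<Sum>k<J. A k * (?x k)\<^sup>2)"
      using A(1) asum by (intro mult_right_mono sum_nonneg) auto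
    finally show "(\<Sum>k<J. A k * ?x k)\<^sup>2 \<le> a * (\<Sum>k<J. A k * (?x k)\<^sup>2)" .
  qed
  also have "\<dots> = a * (\<Sum>k<J. A k * (\<Sum>m<M. (b (m + k) + b (ndist m k))\<^sup>2))"
    by (simp add: sum_distrib_left sum.swap[of _ "{..<M}"])
  also have "\<dots> \<le> a * (\<Sum>k<J. A k * (6 * \<beta>))"
    using A(1) inner a0 by (intro mult_left_mono sum_mono) auto
  also have "\<dots> = a * ((\<Sum>k<J. A k) * (6 * \<beta>))" by (simp add: sum_distrib_right)
  also have "\<dots> \<le> a * (a * (6 * \<beta>))"
    using asum a0 \<beta>0 by (intro mult_left_mono mult_right_mono) auto
  finally show ?thesis by (simp add: a_def \<beta>_def power2_eq_square mult_ac)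
qed

text \<open>The weight moves from \<open>m\<close> to \<open>j\<close> by
  \<open>m \<le> j + k \<le> (k + 1) j\<close> for \<open>j \<ge> 1\<close>; the resulting factor
  \<open>(k + 1)^s\<close> is taken out of the quadratic decay of the cosine coefficients, which
  leaves the exponent \<open>s - 2\<close>.\<close>

lemma weight_sum_le:
  assumes s: "0 \<le> s" and Q0: "Q 0 = 0" and B: "0 \<le> B"
    and w: "\<And>k. \<bar>c k\<bar> \<le> 2 * B * real (Suc k) powr (- 2)"
    and p: "\<And>k. \<bar>p k\<bar> \<le> (\<bar>Q (m + k)\<bar> + \<bar>Q (ndist m k)\<bar>) / 2"
  shows "\<bar>real m powr s * (\<Sum>k<J. c k * p k)\<bar> \<le>
    B * (\<Sum>k<J. real (Suc k) powr (s - 2) * (real (m + k) powr s * \<bar>Q (m + k)\<bar> + real (ndist m k) powr s * \<bar>Q (ndist m k)\<bar>))"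
proof -
  have wt: "real m powr s * \<bar>Q j\<bar> \<le> real (Suc k) powr s * (real j powr s * \<bar>Q j\<bar>)"
    if j: "j = m + k \<or> j = ndist m k" for j k
  proof (cases "j = 0")
    \<comment> \<open>The frequency \<open>j = 0\<close>, reached when \<open>k = m\<close>, has
      weight zero, so the claim rests on \<open>Q 0 = 0\<close>.\<close>
    case True then show ?thesis using Q0 by simp
  next
    case False
    have "m \<le> j + k" using j by (auto simp: ndist_def split: if_splits)
    also have "\<dots> \<le> Suc k * j" using False by (cases j) auto
    finally have "real m \<le> real (Suc k) * real j" by (metis of_nat_le_iff of_nat_mult)
    then have "real m powr s \<le> (real (Suc k) * real j) powr s" using s by (intro powr_mono2) auto
    also have "\<dots> = real (Suc k) powr s * real j powr s" by (simp add: powr_mult)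
    finally have "real m powr s * \<bar>Q j\<bar> \<le> real (Suc k) powr s * real j powr s * \<bar>Q j\<bar>" by (rule mult_right_mono) simp
    then show ?thesis by (simp only: mult.assoc)
  qed
  have "\<bar>real m powr s * (\<Sum>k<J. c k * p k)\<bar> = real m powr s * \<bar>\<Sum>k<J. c k * p k\<bar>" by (simp add: abs_mult)
  also have "\<dots> \<le> real m powr s * (\<Sum>k<J. \<bar>c k * p k\<bar>)" by (intro mult_left_mono sum_abs) simp
  also have "\<dots> = (\<Sum>k<J. real m powr s * (\<bar>c k\<bar> * \<bar>p k\<bar>))" by (simp add: sum_distrib_left abs_mult)
  also have "\<dots> \<le> (\<Sum>k<J. B * (real (Suc k) powr (s - 2) * (real (m + k) powr s * \<bar>Q (m + k)\<bar> + real (ndist m k) powr s * \<bar>Q (ndist m k)\<bar>)))"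
  proof (rule sum_mono)
    fix k
    have "\<bar>c k\<bar> * \<bar>p k\<bar> \<le> (2 * B * real (Suc k) powr (- 2)) * ((\<bar>Q (m + k)\<bar> + \<bar>Q (ndist m k)\<bar>) / 2)"
      using w[of k] p[of k] B by (intro mult_mono) auto
    then have "real m powr s * (\<bar>c k\<bar> * \<bar>p k\<bar>) \<le> real m powr s * ((2 * B * real (Suc k) powr (- 2)) * ((\<bar>Q (m + k)\<bar> + \<bar>Q (ndist m k)\<bar>) / 2))"
      by (rule mult_left_mono) simp
    also have "\<dots> = B * real (Suc k) powr (- 2) * (real m powr s * \<bar>Q (m + k)\<bar> + real m powr s * \<bar>Q (ndist m k)\<bar>)"
      by (simp add: field_simps)
    also have "\<dots> \<le> B * real (Suc k) powr (- 2) * (real (Suc k) powr s * (real (m + k) powr s * \<bar>Q (m + k)\<bar>) + real (Suc k) powr s * (real (ndist m k) powr s * \<bar>Q (ndist m k)\<bar>))"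
      using B by (intro mult_left_mono add_mono wt) auto
    also have "\<dots> = B * ((real (Suc k) powr (- 2) * real (Suc k) powr s) * (real (m + k) powr s * \<bar>Q (m + k)\<bar> + real (ndist m k) powr s * \<bar>Q (ndist m k)\<bar>))"
      by (simp only: distrib_left mult_ac)
    also have "real (Suc k) powr (- 2) * real (Suc k) powr s = real (Suc k) powr (s - 2)"
      by (subst powr_add[symmetric]) simp
    finally show "real m powr s * (\<bar>c k\<bar> * \<bar>p k\<bar>) \<le> B * (real (Suc k) powr (s - 2) * (real (m + k) powr s * \<bar>Q (m + k)\<bar> + real (ndist m k) powr s * \<bar>Q (ndist m k)\<bar>))" .
  qed
  finally show ?thesis by (simp add: sum_distrib_left)
qed

lemma L2_limit_ip01:
  assumes w: "L2_01 w" and W: "\<And>N. L2_01 (W N)" and v: "L2_01 v"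
    and lim: "(\<lambda>N. LINT x|M01. (w x - W N x)\<^sup>2) \<longlonglongrightarrow> 0"
  shows "(\<lambda>N. ip01 (W N) v) \<longlonglongrightarrow> ip01 w v"
proof -
  have "(\<lambda>N. ip01 w v - ip01 (W N) v) \<longlonglongrightarrow> 0"
  proof (rule Lim_null_comparison)
    show "\<forall>\<^sub>F N in sequentially. norm (ip01 w v - ip01 (W N) v) \<le> sqrt (LINT x|M01. (w x - W N x)\<^sup>2) * sqrt (ip01 v v)"
    proof (rule always_eventually, rule allI)
      fix N
      have "ip01 w v - ip01 (W N) v = ip01 (\<lambda>x. w x - W N x) v" using w W v by (simp add: ip01_diff)
      then show "norm (ip01 w v - ip01 (W N) v) \<le> sqrt (LINT x|M01. (w x - W N x)\<^sup>2) * sqrt (ip01 v v)"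
        using ip01_cauchy_schwarz[OF L2_01_diff[OF w W] v, of N] by (simp add: ip01_eq power2_eq_square)
    qed
    have "(\<lambda>N. sqrt (LINT x|M01. (w x - W N x)\<^sup>2) * sqrt (ip01 v v)) \<longlonglongrightarrow> sqrt 0 * sqrt (ip01 v v)"
      by (intro tendsto_intros lim)
    then show "(\<lambda>N. sqrt (LINT x|M01. (w x - W N x)\<^sup>2) * sqrt (ip01 v v)) \<longlonglongrightarrow> 0" by simp
  qed
  from tendsto_diff[OF tendsto_const[of "ip01 w v"] this] show ?thesis by simp
qed

text \<open>\<open>w\<close> is given as an \<open>L^2\<close> limit of continuous
  \<open>W N\<close>, while the cosine expansion works with continuous functions. The sums over
  \<open>m < M\<close> are therefore bounded for the truncated cosine series of \<open>W N\<close>;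
  the constant is uniform, so first \<open>J\<close> and then \<open>N\<close> can tend to infinity
  with \<open>M\<close> fixed.\<close>

lemma summable_sine_weight_mult:
  assumes s: "0 \<le> s" "s < 1" and q: "L2_01 q" and w: "L2_01 w"
    and Q: "summable (\<lambda>j. (real j powr s * ip01 q (sin_pi j))\<^sup>2)"
    and W: "\<And>N. continuous_on {0..1} (W N)"
    and B: "\<And>N k. \<bar>ip01 (W N) (cos_pi k)\<bar> \<le> B * real (Suc k) powr (- 2)"
    and lim: "(\<lambda>N. LINT x|M01. (w x - W N x)\<^sup>2) \<longlonglongrightarrow> 0"
  shows "summable (\<lambda>m. (real m powr s * ip01 w (\<lambda>x. q x * sin_pi m x))\<^sup>2)"
proof -
  define b where "b j = real j powr s * \<bar>ip01 q (sin_pi j)\<bar>" for j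
  define A where "A k = real (Suc k) powr (s - 2)" for k
  define C where "C = B\<^sup>2 * (6 * (\<Sum>k. A k)\<^sup>2 * (\<Sum>j. (b j)\<^sup>2))"
  have B0: "0 \<le> B" using order_trans[OF abs_ge_zero B[of 0 0]] by simp
  have A: "0 \<le> A k" "summable A" for k
  proof -
    show "0 \<le> A k" by (simp add: A_def)
    \<comment> \<open>The exponent \<open>s - 2\<close> is below \<open>- 1\<close> because
      \<open>s < 1\<close>.\<close>
    show "summable A" unfolding A_def[abs_def] by (rule summable_Suc_powr) (use s in simp)
  qed
  have b2: "summable (\<lambda>j. (b j)\<^sup>2)" using Q by (simp add: b_def power_mult_distrib)
  have qs: "L2_01 (\<lambda>x. q x * sin_pi m x)" for m
  proof -
    have "integrable M01 (\<lambda>x. (q x)\<^sup>2 * (sin_pi m x)\<^sup>2)"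
      using q by (intro integrable_M01_mult_continuous(2) continuous_intros) (auto simp: L2_01_iff)
    then show ?thesis using q measurable_M01_continuous[OF continuous_sin_pi, of m]
      unfolding L2_01_iff by (auto simp: power_mult_distrib)
  qed
  have bW: "(\<Sum>m<M. (real m powr s * ip01 (W N) (\<lambda>x. q x * sin_pi m x))\<^sup>2) \<le> C" for M N
  proof (rule LIMSEQ_le_const2)
    define c where "c k = (if k = 0 then 1 else 2) * ip01 (W N) (cos_pi k)" for k :: nat
    have cb: "\<bar>c k\<bar> \<le> 2 * B * real (Suc k) powr (- 2)" for k
      using B[of N k] by (auto simp: c_def abs_mult)
    define P where "P J m = (\<Sum>k<J. c k * ip01 (\<lambda>x. q x * sin_pi m x) (cos_pi k))" for J m
    have "(\<lambda>J. P J m) \<longlonglongrightarrow> ip01 (W N) (\<lambda>x. q x * sin_pi m x)" for m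
      unfolding P_def c_def ip01_commute[of "W N" "\<lambda>x. q x * sin_pi m x"]
      by (rule cosine_series_ip01[OF W B qs])
    then show "(\<lambda>J. \<Sum>m<M. (real m powr s * P J m)\<^sup>2) \<longlonglongrightarrow> (\<Sum>m<M. (real m powr s * ip01 (W N) (\<lambda>x. q x * sin_pi m x))\<^sup>2)"
      by (intro tendsto_intros)
    have "(\<Sum>m<M. (real m powr s * P J m)\<^sup>2) \<le> C" for J
    proof -
      have "\<bar>real m powr s * P J m\<bar> \<le> B * (\<Sum>k<J. A k * (b (m + k) + b (ndist m k)))" for m
        unfolding P_def A_def b_def
        by (rule weight_sum_le[OF s(1) _ B0 cb abs_ip01_mult_cos_le[OF q]]) (simp add: ip01_eq)
      then have "(real m powr s * P J m)\<^sup>2 \<le> (B * (\<Sum>k<J. A k * (b (m + k) + b (ndist m k))))\<^sup>2" for m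
        by (metis abs_ge_zero power2_abs power_mono)
      then have "(\<Sum>m<M. (real m powr s * P J m)\<^sup>2) \<le> (\<Sum>m<M. (B * (\<Sum>k<J. A k * (b (m + k) + b (ndist m k))))\<^sup>2)"
        by (intro sum_mono)
      also have "\<dots> = B\<^sup>2 * (\<Sum>m<M. (\<Sum>k<J. A k * (b (m + k) + b (ndist m k)))\<^sup>2)"
        unfolding power_mult_distrib by (rule sum_distrib_left[symmetric])
      also have "\<dots> \<le> C" unfolding C_def by (intro mult_left_mono discrete_young A b2) simp
      finally show ?thesis .
    qed
    then show "\<exists>N. \<forall>J\<ge>N. (\<Sum>m<M. (real m powr s * P J m)\<^sup>2) \<le> C" by blast
  qed
  have wl: "(\<lambda>N. ip01 (W N) v) \<longlonglongrightarrow> ip01 w v" if v: "L2_01 v" for v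
    by (rule L2_limit_ip01[OF w L2_01_continuous[OF W] v lim])
  have "(\<Sum>m<M. (real m powr s * ip01 w (\<lambda>x. q x * sin_pi m x))\<^sup>2) \<le> C" for M
  proof (rule LIMSEQ_le_const2)
    show "(\<lambda>N. \<Sum>m<M. (real m powr s * ip01 (W N) (\<lambda>x. q x * sin_pi m x))\<^sup>2) \<longlonglongrightarrow> (\<Sum>m<M. (real m powr s * ip01 w (\<lambda>x. q x * sin_pi m x))\<^sup>2)"
      by (intro tendsto_intros wl qs)
  qed (use bW in blast)
  then show ?thesis by (intro summableI_nonneg_bounded) auto
qed

text \<open>The normalisation of the sines and the powers of \<pi> amount to a positive constant,
  and the added index \<open>0\<close> contributes a single term.\<close>

lemma Hdot_iff:
  assumes "L2_01 v"
  shows "Hdot s v \<longleftrightarrow> summable (\<lambda>m. (real m powr s * ip01 v (sin_pi m))\<^sup>2)"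
proof -
  have e: "(real (Suc n) * pi) powr (2 * s) * (ip01 v (\<lambda>x. sqrt 2 * sin (real (Suc n) * pi * x)))\<^sup>2 =
    2 * pi powr (2 * s) * (real (Suc n) powr s * ip01 v (sin_pi (Suc n)))\<^sup>2" for n
  proof -
    have "ip01 v (\<lambda>x. sqrt 2 * sin (real (Suc n) * pi * x)) = sqrt 2 * ip01 v (sin_pi (Suc n))"
      by (subst (1 2) ip01_commute) (rule ip01_cmult)
    moreover have "(real (Suc n) * pi) powr (2 * s) = (real (Suc n) powr s)\<^sup>2 * pi powr (2 * s)"
      by (simp add: powr_mult powr_power mult.commute)
    ultimately show ?thesis by (simp only: power_mult_distrib) simp
  qed
  have "Hdot s v \<longleftrightarrow> summable (\<lambda>n. 2 * pi powr (2 * s) * (real (Suc n) powr s * ip01 v (sin_pi (Suc n)))\<^sup>2)"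
    unfolding Hdot_def e using assms by simp
  also have "\<dots> \<longleftrightarrow> summable (\<lambda>n. (real (Suc n) powr s * ip01 v (sin_pi (Suc n)))\<^sup>2)"
    by (rule summable_cmult_iff[THEN trans]) simp
  also have "\<dots> \<longleftrightarrow> summable (\<lambda>m. (real m powr s * ip01 v (sin_pi m))\<^sup>2)"
    by (rule summable_Suc_iff)
  finally show ?thesis .
qed

lemma Hdot_mono:
  assumes "Hdot s v" "s' \<le> s"
  shows "Hdot s' v"
proof -
  have v: "L2_01 v" using assms by (simp add: Hdot_def)
  show ?thesis unfolding Hdot_iff[OF v]
  proof (rule summable_comparison_test'[of "\<lambda>m. (real m powr s * ip01 v (sin_pi m))\<^sup>2" 1])
    show "summable (\<lambda>m. (real m powr s * ip01 v (sin_pi m))\<^sup>2)" using assms(1) Hdot_iff[OF v] by blast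
    fix m :: nat assume "1 \<le> m"
    then have "real m powr s' \<le> real m powr s" using assms(2) by (intro powr_mono) auto
    then have "(real m powr s')\<^sup>2 \<le> (real m powr s)\<^sup>2" by (intro power_mono) auto
    then show "norm ((real m powr s' * ip01 v (sin_pi m))\<^sup>2) \<le> (real m powr s * ip01 v (sin_pi m))\<^sup>2"
      by (simp add: power_mult_distrib mult_right_mono)
  qed
qed

section \<open>The time-fractional solution operator\<close>

lemma L2_series_iff: "L2_series c phi w \<longleftrightarrow>
    L2_01 w \<and> (\<lambda>N. LINT x|M01. (w x - (\<Sum>n<N. c n * phi n x))\<^sup>2) \<longlonglongrightarrow> 0"
  by (simp add: L2_series_def integral_M01_eq)

lemma L2_series_diff:
  assumes "L2_series c phi v" "L2_series d phi w" and phi: "\<And>n. L2_01 (phi n)"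
  shows "L2_series (\<lambda>n. c n - d n) phi (\<lambda>x. v x - w x)"
proof -
  have L: "L2_01 v" "L2_01 w" using assms by (auto simp: L2_series_iff)
  have S: "L2_01 (\<lambda>x. \<Sum>n<N. c n * phi n x)" for c N by (intro L2_01_sum L2_01_cmult phi)
  have "(\<lambda>N. LINT x|M01. ((v x - w x) - (\<Sum>n<N. (c n - d n) * phi n x))\<^sup>2) \<longlonglongrightarrow> 0"
  proof (rule Lim_null_comparison)
    show "\<forall>\<^sub>F N in sequentially. norm (LINT x|M01. ((v x - w x) - (\<Sum>n<N. (c n - d n) * phi n x))\<^sup>2) \<le>
      2 * (LINT x|M01. (v x - (\<Sum>n<N. c n * phi n x))\<^sup>2) + 2 * (LINT x|M01. (w x - (\<Sum>n<N. d n * phi n x))\<^sup>2)"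
    proof (rule always_eventually, rule allI)
      fix N
      define a where "a x = v x - (\<Sum>n<N. c n * phi n x)" for x
      define b where "b x = w x - (\<Sum>n<N. d n * phi n x)" for x
      have ab: "L2_01 a" "L2_01 b" unfolding a_def[abs_def] b_def[abs_def] by (intro L2_01_diff L S)+
      have e: "(v x - w x) - (\<Sum>n<N. (c n - d n) * phi n x) = a x - b x" for x
        by (simp add: a_def b_def left_diff_distrib sum_subtractf)
      have "(LINT x|M01. (a x - b x)\<^sup>2) \<le> (LINT x|M01. 2 * (a x)\<^sup>2 + 2 * (b x)\<^sup>2)"
      proof (rule integral_mono)
        show "integrable M01 (\<lambda>x. (a x - b x)\<^sup>2)" using L2_01_diff[OF ab] by (simp add: L2_01_iff)
        show "integrable M01 (\<lambda>x. 2 * (a x)\<^sup>2 + 2 * (b x)\<^sup>2)" using ab by (simp add: L2_01_iff)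
        fix x
        have "0 \<le> (a x + b x)\<^sup>2" by simp
        then show "(a x - b x)\<^sup>2 \<le> 2 * (a x)\<^sup>2 + 2 * (b x)\<^sup>2" by (simp add: power2_sum power2_diff)
      qed
      also have "\<dots> = 2 * (LINT x|M01. (a x)\<^sup>2) + 2 * (LINT x|M01. (b x)\<^sup>2)" using ab by (simp add: L2_01_iff)
      finally show "norm (LINT x|M01. ((v x - w x) - (\<Sum>n<N. (c n - d n) * phi n x))\<^sup>2) \<le>
        2 * (LINT x|M01. (v x - (\<Sum>n<N. c n * phi n x))\<^sup>2) + 2 * (LINT x|M01. (w x - (\<Sum>n<N. d n * phi n x))\<^sup>2)"
        unfolding e by (simp add: a_def b_def)
    qed
    have "(\<lambda>N. 2 * (LINT x|M01. (v x - (\<Sum>n<N. c n * phi n x))\<^sup>2) + 2 * (LINT x|M01. (w x - (\<Sum>n<N. d n * phi n x))\<^sup>2)) \<longlonglongrightarrow> 2 * 0 + 2 * 0"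
      using assms by (intro tendsto_intros) (auto simp: L2_series_iff)
    then show "(\<lambda>N. 2 * (LINT x|M01. (v x - (\<Sum>n<N. c n * phi n x))\<^sup>2) + 2 * (LINT x|M01. (w x - (\<Sum>n<N. d n * phi n x))\<^sup>2)) \<longlonglongrightarrow> 0"
      by simp
  qed
  then show ?thesis using L2_01_diff[OF L] by (simp add: L2_series_iff)
qed

context dirichlet_system
begin

text \<open>If \<open>E = \<kappa> / \<lambda> + O(\<lambda>\<^sup>-\<^sup>2)\<close>, then the operator undoes the multiplier \<open>E\<close> up to the factor \<open>\<kappa>\<close> and an
  error that lies in its domain.\<close>

lemma multiplier_estimates:
  assumes v: "L2_01 v" and y: "L2_series (\<lambda>n. E n * ip01 v (phi n)) phi y"
    and E: "\<And>n. \<bar>lam n * E n - \<kappa>\<bar> * lam n \<le> C"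
  obtains W B where "\<And>N::nat. continuous_on {0..1} (W N)" "0 \<le> B"
    "(\<lambda>N. LINT x|M01. (y x - W N x)\<^sup>2) \<longlonglongrightarrow> 0"
    "\<And>N k. \<bar>ip01 (W N) (cos_pi k)\<bar> \<le> B"
    "\<And>N k. (real k * pi)\<^sup>2 * \<bar>ip01 (W N) (cos_pi k)\<bar> \<le> B"
    "\<And>m. (real m * pi)\<^sup>2 * \<bar>ip01 y (\<lambda>x. q x * sin_pi m x) + (real m * pi)\<^sup>2 * ip01 y (sin_pi m) - \<kappa> * ip01 v (sin_pi m)\<bar> \<le> B"
proof -
  define r where "r n = lam n * E n - \<kappa>" for n
  define vn where "vn n = ip01 v (phi n)" for n
  define W where "W N = psum (\<lambda>n. E n * vn n) {..<N}" for N
  define nv where "nv = sqrt (ip01 v v)"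
  have nv: "0 \<le> nv" "nv\<^sup>2 = ip01 v v" using ip01_self_nonneg[of v] by (auto simp: nv_def)
  have l1: "1 \<le> lam n" for n by (rule lam_ge_1)
  have rl: "\<bar>r n * lam n\<bar> \<le> C" for n using E[of n] l1[of n] by (simp add: r_def abs_mult)
  have C0: "0 \<le> C" using rl[of 0] by linarith
  have r1: "\<bar>r n\<bar> \<le> C" for n
  proof -
    have "\<bar>r n\<bar> * 1 \<le> \<bar>r n\<bar> * lam n" using l1[of n] by (intro mult_left_mono) auto
    then show ?thesis using rl[of n] l1[of n] by (simp add: abs_mult)
  qed
  \<comment> \<open>By Bessel's inequality, bounded multipliers keep the coefficients of
    \<open>v\<close> square-summable; this serves both \<open>lam n * E n\<close> and
    \<open>r n * lam n\<close>.\<close>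
  have sq: "(\<Sum>n<N. (d n * vn n)\<^sup>2) \<le> (D * nv)\<^sup>2" if d: "\<And>n. \<bar>d n\<bar> \<le> D" for d D and N :: nat
  proof -
    have "(\<Sum>n<N. (d n * vn n)\<^sup>2) \<le> (\<Sum>n<N. D\<^sup>2 * (vn n)\<^sup>2)"
    proof (rule sum_mono)
      fix n
      have "(d n)\<^sup>2 \<le> D\<^sup>2" using d[of n] by (metis abs_ge_zero power2_abs power_mono)
      then show "(d n * vn n)\<^sup>2 \<le> D\<^sup>2 * (vn n)\<^sup>2" by (simp add: power_mult_distrib mult_right_mono)
    qed
    also have "\<dots> = D\<^sup>2 * (\<Sum>n<N. (vn n)\<^sup>2)" by (simp add: sum_distrib_left)
    also have "\<dots> \<le> D\<^sup>2 * nv\<^sup>2" using bessel[OF v, of "{..<N}"] by (intro mult_left_mono) (auto simp: vn_def nv)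
    finally show ?thesis by (simp add: power_mult_distrib)
  qed
  have aW: "(\<Sum>n<N. (E n * vn n * lam n)\<^sup>2) \<le> ((\<bar>\<kappa>\<bar> + C) * nv)\<^sup>2" for N
  proof -
    have "\<bar>lam n * E n\<bar> \<le> \<bar>\<kappa>\<bar> + C" for n using r1[of n] unfolding r_def by linarith
    from sq[of "\<lambda>n. lam n * E n", OF this] show ?thesis by (simp add: mult_ac)
  qed
  have aR: "(\<Sum>n<N. (r n * vn n * lam n)\<^sup>2) \<le> (C * nv)\<^sup>2" for N
    using sq[of "\<lambda>n. r n * lam n", OF rl] by (simp add: mult_ac)
  have bn: "0 \<le> (\<bar>\<kappa>\<bar> + C) * nv" "0 \<le> C * nv" using C0 nv by auto
  define b1 where "b1 = (c0 + 1) * ((\<bar>\<kappa>\<bar> + C) * nv)"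
  define b2 where "b2 = (c0 + 1) * (C * nv)"
  have b0: "0 \<le> b1" "0 \<le> b2" unfolding b1_def b2_def using bn c0 by auto
  show ?thesis
  \<comment> \<open>\<open>5 * b1\<close> covers the cosine coefficients and the sup norm of
    \<open>W N\<close>, and \<open>b2\<close> the sine coefficients of the remainder.\<close>
  proof (rule that[of W "5 * b1 + b2"])
    show "continuous_on {0..1} (W N)" for N unfolding W_def by (rule psum_cont)
    show "0 \<le> 5 * b1 + b2" using b0 by simp
    show lim: "(\<lambda>N. LINT x|M01. (y x - W N x)\<^sup>2) \<longlonglongrightarrow> 0"
      using y by (simp add: L2_series_iff W_def psum_def vn_def)
    show "(real k * pi)\<^sup>2 * \<bar>ip01 (W N) (cos_pi k)\<bar> \<le> 5 * b1 + b2" for N k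
      using psum_estimates(3)[OF _ aW bn(1), of N k] b0 by (simp add: W_def b1_def)
    show "\<bar>ip01 (W N) (cos_pi k)\<bar> \<le> 5 * b1 + b2" for N k
    proof -
      have s: "\<bar>W N x\<bar> \<le> 2 * b1" if "x \<in> {0..1}" for x
        using psum_estimates(1)[OF _ aW bn(1) that, of N] by (simp add: W_def b1_def)
      have c: "continuous_on {0..1} (W N)" unfolding W_def by (rule psum_cont)
      have "\<bar>ip01 (cos_pi k) (W N)\<bar> \<le> 2 * b1 * (LINT x|M01. \<bar>cos_pi k x\<bar>)"
        unfolding ip01_eq by (intro abs_integral_mult_le integrable_M01_continuous continuous_cos_pi c s)
      also have "\<dots> \<le> 2 * b1 * (LINT x|M01. 1)"
        using b0 by (intro mult_left_mono integral_mono integrable_M01_continuous continuous_intros) auto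
      finally show ?thesis using b0 by (simp add: ip01_commute M01.prob_space[simplified])
    qed
    fix m
    define e2 where "e2 x = - ((real m * pi)\<^sup>2) * sin_pi m x" for x
    \<comment> \<open>\<open>Ae\<close> is the operator applied to the sine. Pairing
      \<open>y\<close> with \<open>Ae\<close> puts both derivatives on the test function, so
      \<open>y\<close> enters only as a square-integrable function.\<close>
    define Ae where "Ae x = q x * sin_pi m x - e2 x" for x
    have e: "twice_abs_cont01 (sin_pi m) (\<lambda>x. real m * pi * cos (real m * pi * x)) e2"
      unfolding e2_def[abs_def] by (rule twice_abs_cont01_sin)
    have e0: "sin_pi m 0 = 0" "sin_pi m 1 = 0" by (simp_all add: sin_npi)
    have sL: "L2_01 (sin_pi m)" by (rule L2_01_continuous[OF continuous_sin_pi])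
    have qsL: "L2_01 (\<lambda>x. q x * sin_pi m x)" by (rule L2_01_admissible_mult[OF adm sL])
    have e2L: "L2_01 e2" unfolding e2_def[abs_def] by (rule L2_01_cmult[OF sL])
    have AeL: "L2_01 Ae" unfolding Ae_def[abs_def] by (intro L2_01_diff qsL e2L)
    have yL: "L2_01 y" using y by (simp add: L2_series_iff)
    have dom: "lam n * ip01 (phi n) (sin_pi m) = ip01 (phi n) Ae" for n
      unfolding Ae_def[abs_def] by (rule ip_phi_domain[OF e e0 e2L])
    define t where "t n = ip01 (phi n) (sin_pi m)" for n
    \<comment> \<open>Symmetry brings out \<open>lam n * E n = \<kappa> + r n\<close>. The \<kappa>
      part tends to \<kappa> times the sine coefficient of \<open>v\<close>; the \<open>r\<close>
      part has coefficients that stay square-summable after multiplication by \<open>lam n\<close>,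
      hence sine coefficients of order \<open>m^(-2)\<close>.\<close>
    have WAe: "ip01 (W N) Ae = \<kappa> * (\<Sum>n<N. vn n * t n) + ip01 (psum (\<lambda>n. r n * vn n) {..<N}) (sin_pi m)" for N
    proof -
      have "ip01 (W N) Ae = (\<Sum>n<N. E n * vn n * (lam n * t n))"
        unfolding W_def by (simp only: ip_psum[OF AeL] dom t_def)
      also have "\<dots> = (\<Sum>n<N. \<kappa> * (vn n * t n) + r n * vn n * t n)"
        by (intro sum.cong refl) (simp add: r_def algebra_simps)
      also have "\<dots> = \<kappa> * (\<Sum>n<N. vn n * t n) + (\<Sum>n<N. r n * vn n * t n)"
        by (simp add: sum.distrib sum_distrib_left)
      finally show ?thesis by (simp only: ip_psum[OF sL] t_def)
    qed
    have "(\<lambda>N. ip01 (W N) Ae - \<kappa> * (\<Sum>n<N. vn n * t n)) \<longlonglongrightarrow> ip01 y Ae - \<kappa> * ip01 v (sin_pi m)"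
      unfolding vn_def t_def
      by (intro tendsto_intros L2_limit_ip01[OF yL _ AeL lim] eigen_expansion[OF e e0 e2L v])
        (simp add: W_def psum_L2)
    then have l: "(\<lambda>N. ip01 (psum (\<lambda>n. r n * vn n) {..<N}) (sin_pi m)) \<longlonglongrightarrow> ip01 y Ae - \<kappa> * ip01 v (sin_pi m)"
      unfolding WAe by simp
    have "(real m * pi)\<^sup>2 * \<bar>ip01 y Ae - \<kappa> * ip01 v (sin_pi m)\<bar> \<le> b2"
    proof (rule LIMSEQ_le_const2)
      show "(\<lambda>N. (real m * pi)\<^sup>2 * \<bar>ip01 (psum (\<lambda>n. r n * vn n) {..<N}) (sin_pi m)\<bar>) \<longlonglongrightarrow> (real m * pi)\<^sup>2 * \<bar>ip01 y Ae - \<kappa> * ip01 v (sin_pi m)\<bar>"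
        by (intro tendsto_intros l)
      show "\<exists>N. \<forall>n\<ge>N. (real m * pi)\<^sup>2 * \<bar>ip01 (psum (\<lambda>n. r n * vn n) {..<n}) (sin_pi m)\<bar> \<le> b2"
        unfolding b2_def using psum_estimates(2)[OF _ aR bn(2), of _ m] by blast
    qed
    moreover have "ip01 y Ae = ip01 y (\<lambda>x. q x * sin_pi m x) + (real m * pi)\<^sup>2 * ip01 y (sin_pi m)"
    proof -
      have "ip01 Ae y = ip01 (\<lambda>x. q x * sin_pi m x) y - ip01 e2 y"
        unfolding Ae_def[abs_def] by (rule ip01_diff[OF qsL e2L yL])
      also have "ip01 e2 y = - ((real m * pi)\<^sup>2) * ip01 (sin_pi m) y"
        unfolding e2_def[abs_def] by (rule ip01_cmult)
      finally show ?thesis by (simp add: ip01_commute[of y])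
    qed
    ultimately show "(real m * pi)\<^sup>2 * \<bar>ip01 y (\<lambda>x. q x * sin_pi m x) + (real m * pi)\<^sup>2 * ip01 y (sin_pi m) - \<kappa> * ip01 v (sin_pi m)\<bar> \<le> 5 * b1 + b2"
      using b0 by simp
  qed
qed

end

section \<open>Sine coefficients of the final state\<close>

text \<open>Merges the bound at \<open>k = 0\<close> with the decay for \<open>k \<ge> 1\<close>
  into one majorant in \<open>Suc k\<close>; \<open>real k powr (- 2)\<close> is zero at
  \<open>k = 0\<close> and could not serve there.\<close>

lemma quadratic_decay_powr:
  fixes X b :: real
  assumes "0 \<le> X" "X \<le> b" "(real k * pi)\<^sup>2 * X \<le> b"
  shows "X \<le> 4 * b * real (Suc k) powr (- 2)"
proof -
  have b: "0 \<le> b" using assms by linarith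
  have "(real (Suc k))\<^sup>2 * X \<le> 4 * b"
  proof (cases "k = 0")
    case True then show ?thesis using assms b by simp
  next
    case False
    have "real (Suc k) \<le> real k * pi"
    proof -
      have "real k * 2 \<le> real k * pi" using pi_ge_two by (intro mult_left_mono) auto
      then show ?thesis using False by linarith
    qed
    then have "(real (Suc k))\<^sup>2 \<le> (real k * pi)\<^sup>2" by (intro power_mono) auto
    then have "(real (Suc k))\<^sup>2 * X \<le> (real k * pi)\<^sup>2 * X" using assms(1) by (rule mult_right_mono)
    then show ?thesis using assms(3) b by linarith
  qed
  moreover have "real (Suc k) powr (- 2) = 1 / (real (Suc k))\<^sup>2"
    by (simp add: powr_minus_divide)
  moreover have "X \<le> 4 * b * (1 / n)" if "n * X \<le> 4 * b" "0 < n" for n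
    using that by (simp add: le_divide_eq mult.commute)
  ultimately show ?thesis by (simp del: of_nat_Suc)
qed

lemma linear_decay:
  fixes X c d :: real
  assumes "0 \<le> X" "0 \<le> c" "0 \<le> d" "(real m * pi)\<^sup>2 * X \<le> real m * pi * c + d"
  shows "real m * X \<le> pi * c + d"
proof (cases "m = 0")
  case True then show ?thesis using assms by simp
next
  case False
  then have m: "1 \<le> real m" by simp
  have "1 * 1 \<le> pi * pi" using pi_ge_two by (intro mult_mono) auto
  then have "real m * (real m * X) * 1 \<le> real m * (real m * X) * (pi * pi)"
    using assms by (intro mult_left_mono) auto
  also have "\<dots> \<le> real m * pi * c + d" using assms(4) by (simp add: power2_eq_square mult_ac)
  also have "\<dots> \<le> real m * (pi * c) + real m * d" using m assms(3) by (simp add: mult_le_cancel_right1)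
  finally have "real m * (real m * X) \<le> real m * (pi * c + d)" by (simp add: distrib_left)
  then show ?thesis using m by simp
qed

lemma bounded_cos_coeff:
  assumes "continuous_on {0..1} y"
  shows "\<bar>ip01 y (cos_pi k)\<bar> \<le> (LINT x|M01. \<bar>y x\<bar>)"
  using abs_integral_mult_le[OF integrable_M01_continuous[OF assms] continuous_cos_pi, of k 1]
  by (simp add: ip01_eq)

text \<open>The solution is \<open>p + g + y\<close>, where \<open>p\<close> and \<open>g\<close>
  are stationary and \<open>y\<close> is the multiplier applied to \<open>v = u0 - p - g\<close>.
  For \<open>p\<close> and \<open>g\<close> Green's identity is exact and yields the boundary term
  and \<open>f\<close>; \<open>y\<close> yields \<open>\<kappa> * v\<close> up to order
  \<open>m^(-2)\<close>. What is left, \<open>- \<kappa> * (p + g)\<close>, is of order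
  \<open>1/m\<close> because \<open>p\<close> need not vanish at the endpoints. The representative
  \<open>wt\<close> appears because \<open>w\<close> is determined only almost everywhere.\<close>

lemma (in dirichlet_system) solution_sine_identity:
  assumes \<alpha>: "0 < \<alpha>" "\<alpha> < 1" and T: "0 < T" and u0: "L2_01 u0" and f: "L2_01 f"
    and sol: "sol_at \<alpha> q lam phi a0 a1 u0 f T w"
  obtains wt W B where "L2_01 wt" "ae_eq01 w wt" "0 \<le> B"
    "\<And>N::nat. continuous_on {0..1} (W N)"
    "(\<lambda>N. LINT x|M01. (wt x - W N x)\<^sup>2) \<longlonglongrightarrow> 0"
    "\<And>N k. \<bar>ip01 (W N) (cos_pi k)\<bar> \<le> B * real (Suc k) powr (- 2)"
    "\<And>m. real m * \<bar>ip01 wt (\<lambda>x. q x * sin_pi m x) + (real m * pi)\<^sup>2 * ip01 wt (sin_pi m)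
        - (- (real m * pi) * (a1 * cos (real m * pi) - a0) + ip01 f (sin_pi m)
           + 1 / (Gamma (1 - \<alpha>) * T powr \<alpha>) * ip01 u0 (sin_pi m))\<bar> \<le> B"
proof -
  obtain p g w1 w2 w3 where p: "phi_q q a0 a1 p" and g: "Ainv q f g"
    and w1: "F_op \<alpha> lam phi T u0 w1" and w2: "F_op \<alpha> lam phi T p w2" and w3: "F_op \<alpha> lam phi T g w3"
    and w: "ae_eq01 w (\<lambda>x. w1 x + (p x - w2 x) + (g x - w3 x))"
    using sol unfolding sol_at_def by blast
  have p01: "p 0 = a0" "p 1 = a1" and g01: "g 0 = 0" "g 1 = 0"
    using p g by (auto simp: phi_q_def Ainv_def)
  define \<kappa> where "\<kappa> = 1 / (Gamma (1 - \<alpha>) * T powr \<alpha>)"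
  obtain Kp where Kp: "twice_abs_cont01 p Kp (\<lambda>z. q z * p z - 0)"
    using ode_sol_twice_abs_cont01[OF adm, of "\<lambda>_. 0" p] p by (auto simp: phi_q_def)
  obtain Kg where Kg: "twice_abs_cont01 g Kg (\<lambda>z. q z * g z - f z)"
    using ode_sol_twice_abs_cont01[OF adm L2_01_integrable[OF f], of g] g by (auto simp: Ainv_def)
  have pc: "continuous_on {0..1} p" and gc: "continuous_on {0..1} g"
    using twice_abs_cont01_continuous(1) Kp Kg by blast+
  have pL: "L2_01 p" and gL: "L2_01 g" using pc gc L2_01_continuous by blast+
  define E where "E n = mittag_leffler \<alpha> 1 (- lam n * T powr \<alpha>)" for n
  \<comment> \<open>Linearity gathers the three operator terms of the representation into a single
    series.\<close>
  define v where "v x = u0 x - p x - g x" for x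
  define y where "y x = w1 x - w2 x - w3 x" for x
  have vL: "L2_01 v" unfolding v_def[abs_def] by (intro L2_01_diff u0 pL gL)
  have y: "L2_series (\<lambda>n. E n * ip01 v (phi n)) phi y"
  proof -
    have "ip01 v (phi n) = ip01 u0 (phi n) - ip01 p (phi n) - ip01 g (phi n)" for n
      unfolding v_def[abs_def] using u0 pL gL phi_L2[of n] by (simp add: ip01_diff L2_01_diff)
    then have "(\<lambda>n. E n * ip01 v (phi n)) = (\<lambda>n. E n * ip01 u0 (phi n) - E n * ip01 p (phi n) - E n * ip01 g (phi n))"
      by (simp add: right_diff_distrib)
    moreover have "L2_series (\<lambda>n. E n * ip01 u0 (phi n) - E n * ip01 p (phi n) - E n * ip01 g (phi n)) phi y"
      unfolding y_def[abs_def] using w1 w2 w3 unfolding F_op_def E_def by (intro L2_series_diff phi_L2)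
    ultimately show ?thesis by simp
  qed
  have yL: "L2_01 y" using y by (simp add: L2_series_iff)
  obtain C where C: "0 \<le> C" "\<And>x. 0 < x \<Longrightarrow> \<bar>x * mittag_leffler \<alpha> 1 (- x) - 1 / Gamma (1 - \<alpha>)\<bar> \<le> C / x"
    using mittag_leffler_asymptotics[OF \<alpha>] by blast
  define \<tau> where "\<tau> = T powr \<alpha>"
  have \<tau>: "0 < \<tau>" using T by (simp add: \<tau>_def)
  \<comment> \<open>The asymptotics are applied at \<open>lam n * \<tau>\<close>; one power of
    \<tau> comes from the rescaling and one from the error term.\<close>
  have Eb: "\<bar>lam n * E n - \<kappa>\<bar> * lam n \<le> C / \<tau>\<^sup>2" for n
  proof -
    have l: "0 < lam n" using lam_ge_1[of n] by simp
    have "lam n * E n - \<kappa> = (lam n * \<tau> * mittag_leffler \<alpha> 1 (- (lam n * \<tau>)) - 1 / Gamma (1 - \<alpha>)) / \<tau>"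
      using \<tau> by (simp add: E_def \<kappa>_def \<tau>_def[symmetric] diff_divide_distrib)
    then have "\<bar>lam n * E n - \<kappa>\<bar> = \<bar>lam n * \<tau> * mittag_leffler \<alpha> 1 (- (lam n * \<tau>)) - 1 / Gamma (1 - \<alpha>)\<bar> / \<tau>"
      using \<tau> by (simp add: abs_divide)
    also have "\<dots> \<le> C / (lam n * \<tau>) / \<tau>"
      using C(2)[of "lam n * \<tau>"] l \<tau> by (intro divide_right_mono) auto
    finally have "\<bar>lam n * E n - \<kappa>\<bar> * lam n \<le> C / (lam n * \<tau>) / \<tau> * lam n"
      using l by (intro mult_right_mono) auto
    also have "\<dots> = C / \<tau>\<^sup>2" using l \<tau> by (simp add: power2_eq_square)
    finally show ?thesis .
  qed
  obtain V B where V: "\<And>N::nat. continuous_on {0..1} (V N)" and B0: "0 \<le> B"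
    and Vlim: "(\<lambda>N. LINT x|M01. (y x - V N x)\<^sup>2) \<longlonglongrightarrow> 0"
    and V1: "\<And>N k. \<bar>ip01 (V N) (cos_pi k)\<bar> \<le> B"
    and V2: "\<And>N k. (real k * pi)\<^sup>2 * \<bar>ip01 (V N) (cos_pi k)\<bar> \<le> B"
    and Ym: "\<And>m. (real m * pi)\<^sup>2 * \<bar>ip01 y (\<lambda>x. q x * sin_pi m x) + (real m * pi)\<^sup>2 * ip01 y (sin_pi m) - \<kappa> * ip01 v (sin_pi m)\<bar> \<le> B"
    using multiplier_estimates[OF vL y Eb] by blast
  define wt where "wt x = p x + g x + y x" for x
  define W where "W N x = p x + g x + V N x" for N x
  define Ip where "Ip = (LINT x|M01. \<bar>q x * p x - 0\<bar>)"
  define Ig where "Ig = (LINT x|M01. \<bar>q x * g x - f x\<bar>)"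
  have I0: "0 \<le> Ip" "0 \<le> Ig" by (simp_all add: Ip_def Ig_def)
  define bp where "bp = \<bar>Kp 0\<bar> + \<bar>Kp 1\<bar> + Ip + (LINT x|M01. \<bar>p x\<bar>)"
  define bg where "bg = \<bar>Kg 0\<bar> + \<bar>Kg 1\<bar> + Ig + (LINT x|M01. \<bar>g x\<bar>)"
  \<comment> \<open>\<open>B1\<close> serves the cosine bound and \<open>B2\<close> the sine bound;
    a single constant is asked for, so their sum is returned.\<close>
  define B1 where "B1 = 4 * (bp + bg + B)"
  define B2 where "B2 = B + \<bar>\<kappa>\<bar> * (pi * (\<bar>a0\<bar> + \<bar>a1\<bar>) + Ip + Ig)"
  have absnn: "0 \<le> (LINT x|M01. \<bar>h x\<bar>)" for h :: "real \<Rightarrow> real" by simp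
  have nn: "0 \<le> bp" "0 \<le> bg" unfolding bp_def bg_def using I0 absnn[of p] absnn[of g] by linarith+
  have B10: "0 \<le> B1" using nn B0 by (simp add: B1_def)
  have B20: "0 \<le> B2" using I0 B0 by (simp add: B2_def)
  show ?thesis
  proof (rule that[of wt "B1 + B2" W])
    show "L2_01 wt" unfolding wt_def[abs_def] by (intro L2_01_add pL gL yL)
    have "wt x = w1 x + (p x - w2 x) + (g x - w3 x)" for x by (simp add: wt_def y_def)
    then have "wt = (\<lambda>x. w1 x + (p x - w2 x) + (g x - w3 x))" by (rule ext)
    then show "ae_eq01 w wt" using w by simp
    show "0 \<le> B1 + B2" using B10 B20 by simp
    show "continuous_on {0..1} (W N)" for N unfolding W_def[abs_def] by (intro continuous_intros pc gc V)
    have "wt x - W N x = y x - V N x" for N x by (simp add: wt_def W_def)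
    then show "(\<lambda>N. LINT x|M01. (wt x - W N x)\<^sup>2) \<longlonglongrightarrow> 0" using Vlim by simp
    show "\<bar>ip01 (W N) (cos_pi k)\<bar> \<le> (B1 + B2) * real (Suc k) powr (- 2)" for N k
    proof -
      have cL: "L2_01 (cos_pi k)" and VL: "L2_01 (V N)" by (intro L2_01_continuous continuous_cos_pi V)+
      have "ip01 (W N) (cos_pi k) = ip01 p (cos_pi k) + ip01 g (cos_pi k) + ip01 (V N) (cos_pi k)"
        unfolding W_def[abs_def] using pL gL VL cL by (simp add: ip01_add L2_01_add)
      then have tri: "\<bar>ip01 (W N) (cos_pi k)\<bar> \<le> \<bar>ip01 p (cos_pi k)\<bar> + \<bar>ip01 g (cos_pi k)\<bar> + \<bar>ip01 (V N) (cos_pi k)\<bar>"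
        by linarith
      have p1: "\<bar>ip01 p (cos_pi k)\<bar> \<le> bp" using bounded_cos_coeff[OF pc, of k] I0 by (simp add: bp_def)
      have p2: "(real k * pi)\<^sup>2 * \<bar>ip01 p (cos_pi k)\<bar> \<le> bp"
        using cos_coeff_bound[OF Kp, of k] absnn[of p] unfolding bp_def Ip_def by linarith
      have g1: "\<bar>ip01 g (cos_pi k)\<bar> \<le> bg" using bounded_cos_coeff[OF gc, of k] I0 by (simp add: bg_def)
      have g2: "(real k * pi)\<^sup>2 * \<bar>ip01 g (cos_pi k)\<bar> \<le> bg"
        using cos_coeff_bound[OF Kg, of k] absnn[of g] unfolding bg_def Ig_def by linarith
      have "\<bar>ip01 p (cos_pi k)\<bar> + \<bar>ip01 g (cos_pi k)\<bar> + \<bar>ip01 (V N) (cos_pi k)\<bar> \<le> 4 * (bp + bg + B) * real (Suc k) powr (- 2)"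
      proof (rule quadratic_decay_powr)
        show "\<bar>ip01 p (cos_pi k)\<bar> + \<bar>ip01 g (cos_pi k)\<bar> + \<bar>ip01 (V N) (cos_pi k)\<bar> \<le> bp + bg + B"
          using p1 g1 V1[of N k] by linarith
        show "(real k * pi)\<^sup>2 * (\<bar>ip01 p (cos_pi k)\<bar> + \<bar>ip01 g (cos_pi k)\<bar> + \<bar>ip01 (V N) (cos_pi k)\<bar>) \<le> bp + bg + B"
          using p2 g2 V2[of k N] unfolding distrib_left by linarith
      qed simp
      also have "\<dots> \<le> (B1 + B2) * real (Suc k) powr (- 2)"
        using B20 by (intro mult_right_mono) (auto simp: B1_def)
      finally show ?thesis using tri by linarith
    qed
    fix m
    let ?s = "sin_pi m"
    have sL: "L2_01 ?s" by (rule L2_01_continuous[OF continuous_sin_pi])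
    have qsL: "L2_01 (\<lambda>x. q x * ?s x)" by (rule L2_01_admissible_mult[OF adm sL])
    have pe: "ip01 p (\<lambda>x. q x * ?s x) + (real m * pi)\<^sup>2 * ip01 p ?s = - (real m * pi) * (a1 * cos (real m * pi) - a0)"
      using sin_coeff_eq[OF Kp, of m] p01 by (simp add: ip01_eq mult_ac)
    have ge: "ip01 g (\<lambda>x. q x * ?s x) + (real m * pi)\<^sup>2 * ip01 g ?s = ip01 f ?s"
    proof -
      have "(q x * g x - f x) * ?s x = g x * (q x * ?s x) - f x * ?s x" for x
        by (simp add: algebra_simps)
      then have "(LINT x|M01. (q x * g x - f x) * ?s x) = ip01 g (\<lambda>x. q x * ?s x) - ip01 f ?s"
        using Bochner_Integration.integral_diff[OF L2_01_mult_integrable[OF gL qsL] L2_01_mult_integrable[OF f sL]]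
        by (simp only: ip01_eq)
      then show ?thesis using sin_coeff_eq[OF Kg, of m] g01 by simp
    qed
    have we: "ip01 wt h = ip01 p h + ip01 g h + ip01 y h" if "L2_01 h" for h
      unfolding wt_def[abs_def] using pL gL yL that by (simp add: ip01_add L2_01_add)
    have ve: "ip01 v ?s = ip01 u0 ?s - ip01 p ?s - ip01 g ?s"
      unfolding v_def[abs_def] using u0 pL gL sL by (simp add: ip01_diff L2_01_diff)
    define Y where "Y = ip01 y (\<lambda>x. q x * ?s x) + (real m * pi)\<^sup>2 * ip01 y ?s - \<kappa> * ip01 v ?s"
    have "ip01 wt (\<lambda>x. q x * ?s x) + (real m * pi)\<^sup>2 * ip01 wt ?s
        - (- (real m * pi) * (a1 * cos (real m * pi) - a0) + ip01 f ?s + \<kappa> * ip01 u0 ?s)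
      = Y - \<kappa> * (ip01 p ?s + ip01 g ?s)"
      unfolding pe[symmetric] ge[symmetric] we[OF qsL] we[OF sL] Y_def ve by (simp add: algebra_simps)
    then have "real m * \<bar>ip01 wt (\<lambda>x. q x * ?s x) + (real m * pi)\<^sup>2 * ip01 wt ?s
        - (- (real m * pi) * (a1 * cos (real m * pi) - a0) + ip01 f ?s + \<kappa> * ip01 u0 ?s)\<bar>
      = real m * \<bar>Y - \<kappa> * (ip01 p ?s + ip01 g ?s)\<bar>" by simp
    also have "\<dots> \<le> real m * (\<bar>Y\<bar> + \<bar>\<kappa>\<bar> * (\<bar>ip01 p ?s\<bar> + \<bar>ip01 g ?s\<bar>))"
    proof (rule mult_left_mono)
      have "\<bar>Y - \<kappa> * (ip01 p ?s + ip01 g ?s)\<bar> \<le> \<bar>Y\<bar> + \<bar>\<kappa>\<bar> * \<bar>ip01 p ?s + ip01 g ?s\<bar>"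
        unfolding abs_mult[symmetric] by linarith
      also have "\<dots> \<le> \<bar>Y\<bar> + \<bar>\<kappa>\<bar> * (\<bar>ip01 p ?s\<bar> + \<bar>ip01 g ?s\<bar>)"
        by (intro add_left_mono mult_left_mono abs_triangle_ineq) simp
      finally show "\<bar>Y - \<kappa> * (ip01 p ?s + ip01 g ?s)\<bar> \<le> \<bar>Y\<bar> + \<bar>\<kappa>\<bar> * (\<bar>ip01 p ?s\<bar> + \<bar>ip01 g ?s\<bar>)" .
    qed simp
    also have "\<dots> = real m * \<bar>Y\<bar> + \<bar>\<kappa>\<bar> * (real m * \<bar>ip01 p ?s\<bar> + real m * \<bar>ip01 g ?s\<bar>)"
      by (simp add: algebra_simps)
    also have "\<dots> \<le> B + \<bar>\<kappa>\<bar> * ((pi * (\<bar>a0\<bar> + \<bar>a1\<bar>) + Ip) + Ig)"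
    proof (intro add_mono mult_left_mono)
      show "real m * \<bar>Y\<bar> \<le> B"
        using linear_decay[of "\<bar>Y\<bar>" 0 B m] Ym[of m] B0 by (simp add: Y_def)
      show "real m * \<bar>ip01 p ?s\<bar> \<le> pi * (\<bar>a0\<bar> + \<bar>a1\<bar>) + Ip"
        using sin_coeff_bound[OF Kp, of m] I0 p01 by (intro linear_decay) (auto simp: Ip_def)
      show "real m * \<bar>ip01 g ?s\<bar> \<le> Ig"
        using linear_decay[of "\<bar>ip01 g ?s\<bar>" 0 Ig m] sin_coeff_bound[OF Kg, of m] I0 g01 by (simp add: Ig_def)
    qed simp
    also have "\<dots> \<le> B1 + B2" using B10 by (simp add: B2_def add.assoc)
    finally show "real m * \<bar>ip01 wt (\<lambda>x. q x * ?s x) + (real m * pi)\<^sup>2 * ip01 wt ?s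
        - (- (real m * pi) * (a1 * cos (real m * pi) - a0) + ip01 f ?s
           + 1 / (Gamma (1 - \<alpha>) * T powr \<alpha>) * ip01 u0 ?s)\<bar> \<le> B1 + B2"
      unfolding \<kappa>_def .
  qed
qed

section \<open>Comparison of the two problems\<close>

lemma summable_sum3_squares:
  fixes a b c :: "nat \<Rightarrow> real"
  assumes "summable (\<lambda>m. (a m)\<^sup>2)" "summable (\<lambda>m. (b m)\<^sup>2)" "summable (\<lambda>m. (c m)\<^sup>2)"
    and "\<And>m. \<bar>x m\<bar> \<le> \<bar>a m\<bar> + \<bar>b m\<bar> + \<bar>c m\<bar>"
  shows "summable (\<lambda>m. (x m)\<^sup>2)"
proof (rule summable_comparison_test'[where N = 0])
  show "summable (\<lambda>m. 3 * ((a m)\<^sup>2 + (b m)\<^sup>2 + (c m)\<^sup>2))"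
    using assms by (intro summable_mult summable_add)
  fix m
  have "(x m)\<^sup>2 \<le> (\<bar>a m\<bar> + \<bar>b m\<bar> + \<bar>c m\<bar>)\<^sup>2"
    using assms(4)[of m] by (metis abs_ge_zero power2_abs power_mono)
  also have "\<dots> \<le> 3 * ((a m)\<^sup>2 + (b m)\<^sup>2 + (c m)\<^sup>2)"
  proof -
    have "0 \<le> (\<bar>a m\<bar> - \<bar>b m\<bar>)\<^sup>2 + (\<bar>a m\<bar> - \<bar>c m\<bar>)\<^sup>2 + (\<bar>b m\<bar> - \<bar>c m\<bar>)\<^sup>2" by simp
    then show ?thesis by (simp add: power2_eq_square algebra_simps)
  qed
  finally show "norm ((x m)\<^sup>2) \<le> 3 * ((a m)\<^sup>2 + (b m)\<^sup>2 + (c m)\<^sup>2)" by simp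
qed

theorem mainTheorem8:
  fixes \<alpha> c0 a0 a1 s s' T T' :: real
    and u0 f q q' w w' :: "real \<Rightarrow> real"
    and lam lam' :: "nat \<Rightarrow> real" and phi phi' :: "nat \<Rightarrow> real \<Rightarrow> real"
  assumes "0 < \<alpha>" "\<alpha> < 1" "0 < c0" "0 < a0" "0 < a1"
    and "0 < s'" "s' < 1/2" "s' + 1/2 < s" "s < 1"
    and "L2_01 u0" "\<not> Hdot s' u0"
    and "Hdot s f"
    and "admissible c0 q" "Hdot s q" "admissible c0 q'" "Hdot s q'"
    and "dirichlet_eigensystem q lam phi" "dirichlet_eigensystem q' lam' phi'"
    and "0 < T" "0 < T'"
    and "sol_at \<alpha> q lam phi a0 a1 u0 f T w"
    and "sol_at \<alpha> q' lam' phi' a0 a1 u0 f T' w'"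
    and "ae_eq01 w w'"
  shows "T = T'"
proof (rule ccontr)
  assume ne: "T \<noteq> T'"
  have f: "L2_01 f" using assms(12) by (simp add: Hdot_def)
  interpret S: dirichlet_system c0 q lam phi by standard fact+
  interpret S': dirichlet_system c0 q' lam' phi' by standard fact+
  define \<kappa> where "\<kappa> = 1 / (Gamma (1 - \<alpha>) * T powr \<alpha>)"
  define \<kappa>' where "\<kappa>' = 1 / (Gamma (1 - \<alpha>) * T' powr \<alpha>)"
  \<comment> \<open>The part of the right-hand side that both problems share: boundary term and
    source.\<close>
  define d where "d m = - (real m * pi) * (a1 * cos (real m * pi) - a0) + ip01 f (sin_pi m)" for m
  obtain wt W B where wt: "L2_01 wt" "ae_eq01 w wt" "0 \<le> B"
    and W: "\<And>N::nat. continuous_on {0..1} (W N)"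
      "(\<lambda>N. LINT x|M01. (wt x - W N x)\<^sup>2) \<longlonglongrightarrow> 0"
      "\<And>N k. \<bar>ip01 (W N) (cos_pi k)\<bar> \<le> B * real (Suc k) powr (- 2)"
    and id: "\<And>m. real m * \<bar>ip01 wt (\<lambda>x. q x * sin_pi m x) + (real m * pi)\<^sup>2 * ip01 wt (sin_pi m)
        - (d m + \<kappa> * ip01 u0 (sin_pi m))\<bar> \<le> B"
    by (rule S.solution_sine_identity[OF assms(1,2,19,10) f assms(21), folded d_def \<kappa>_def]) (rule that)
  obtain wt' W' B' where wt': "L2_01 wt'" "ae_eq01 w' wt'" "0 \<le> B'"
      "\<And>N::nat. continuous_on {0..1} (W' N)"
      "(\<lambda>N. LINT x|M01. (wt' x - W' N x)\<^sup>2) \<longlonglongrightarrow> 0"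
      "\<And>N k. \<bar>ip01 (W' N) (cos_pi k)\<bar> \<le> B' * real (Suc k) powr (- 2)"
    and id': "\<And>m. real m * \<bar>ip01 wt' (\<lambda>x. q' x * sin_pi m x) + (real m * pi)\<^sup>2 * ip01 wt' (sin_pi m)
        - (d m + \<kappa>' * ip01 u0 (sin_pi m))\<bar> \<le> B'"
    by (rule S'.solution_sine_identity[OF assms(1,2,20,10) f assms(22), folded d_def \<kappa>'_def]) (rule that)
  have ae: "ae_eq01 wt wt'"
    using wt(2) wt'(2) assms(23) unfolding ae_eq01_iff by eventually_elim simp
  have eq: "ip01 wt' h = ip01 wt h" if "L2_01 h" for h
    using ip01_cong_AE[OF ae wt(1) wt'(1) that] by simp
  have sL: "L2_01 (sin_pi m)" for m by (rule L2_01_continuous[OF continuous_sin_pi])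
  define P where "P m = ip01 wt (\<lambda>x. q x * sin_pi m x)" for m
  define P' where "P' m = ip01 wt (\<lambda>x. q' x * sin_pi m x)" for m
  define D where "D m = (\<kappa> - \<kappa>') * ip01 u0 (sin_pi m)" for m
  \<comment> \<open>With one common representative, the terms
    \<open>(real m * pi)^2 * ip01 wt (sin_pi m)\<close> and \<open>d m\<close> cancel.\<close>
  have err: "real m * \<bar>P m - P' m - D m\<bar> \<le> B + B'" for m
  proof -
    define X where "X = P m + (real m * pi)\<^sup>2 * ip01 wt (sin_pi m) - (d m + \<kappa> * ip01 u0 (sin_pi m))"
    define X' where "X' = P' m + (real m * pi)\<^sup>2 * ip01 wt (sin_pi m) - (d m + \<kappa>' * ip01 u0 (sin_pi m))"
    have "P m - P' m - D m = X - X'" by (simp add: X_def X'_def D_def left_diff_distrib)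
    then have "real m * \<bar>P m - P' m - D m\<bar> \<le> real m * (\<bar>X\<bar> + \<bar>X'\<bar>)" by (intro mult_left_mono) auto
    also have "\<dots> = real m * \<bar>X\<bar> + real m * \<bar>X'\<bar>" by (simp add: distrib_left)
    also have "real m * \<bar>X\<bar> \<le> B" using id[of m] by (simp add: X_def P_def)
    also have "real m * \<bar>X'\<bar> \<le> B'"
      using id'[of m] by (simp add: X'_def P'_def eq[OF sL] eq[OF L2_01_admissible_mult[OF assms(15) sL]])
    finally show ?thesis by simp
  qed
  have qL: "L2_01 q" "L2_01 q'" using assms(14,16) by (auto simp: Hdot_def)
  have "Hdot s' q" "Hdot s' q'" using assms(14,16) assms(8) by (auto intro: Hdot_mono)
  then have Qs: "summable (\<lambda>j. (real j powr s' * ip01 q (sin_pi j))\<^sup>2)" "summable (\<lambda>j. (real j powr s' * ip01 q' (sin_pi j))\<^sup>2)"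
    using Hdot_iff qL by auto
  have s': "0 \<le> s'" "s' < 1" using assms(6,7) by auto
  have sP: "summable (\<lambda>m. (real m powr s' * P m)\<^sup>2)"
    unfolding P_def by (rule summable_sine_weight_mult[OF s' qL(1) wt(1) Qs(1) W(1,3,2)])
  \<comment> \<open>The approximants of the first problem serve again, since \<open>P'\<close> pairs
    \<open>q'\<close> with the same \<open>wt\<close>.\<close>
  have sP': "summable (\<lambda>m. (real m powr s' * P' m)\<^sup>2)"
    unfolding P'_def by (rule summable_sine_weight_mult[OF s' qL(2) wt(1) Qs(2) W(1,3,2)])
  \<comment> \<open>The squared exponent is \<open>2 * (s' - 1)\<close>, which lies below
    \<open>- 1\<close> exactly when \<open>s' < 1/2\<close>.\<close>
  have sE: "summable (\<lambda>m. ((B + B') * real m powr (s' - 1))\<^sup>2)"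
  proof -
    have "summable (\<lambda>m. (B + B')\<^sup>2 * real m powr (2 * (s' - 1)))"
      using assms(7) by (intro summable_mult) (simp add: summable_real_powr_iff)
    moreover have "(real m powr (s' - 1))\<^sup>2 = real m powr (2 * (s' - 1))" for m
    proof -
      have "2 * (s' - 1) = (s' - 1) + (s' - 1)" by simp
      then show ?thesis by (simp only: powr_add power2_eq_square)
    qed
    ultimately show ?thesis by (simp only: power_mult_distrib)
  qed
  have "summable (\<lambda>m. (real m powr s' * D m)\<^sup>2)"
  proof (rule summable_sum3_squares[OF sP sP' sE])
    fix m :: nat
    have e: "real m powr s' * \<bar>P m - P' m - D m\<bar> \<le> (B + B') * real m powr (s' - 1)"
    proof (cases "m = 0")
      case False
      then have "real m powr s' = real m powr (s' - 1) * real m" by (simp add: powr_diff)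
      then have "real m powr s' * \<bar>P m - P' m - D m\<bar> = real m powr (s' - 1) * (real m * \<bar>P m - P' m - D m\<bar>)"
        by simp
      also have "\<dots> \<le> real m powr (s' - 1) * (B + B')" by (intro mult_left_mono err) simp
      finally show ?thesis by (simp add: mult.commute)
    qed simp
    have "\<bar>D m\<bar> \<le> \<bar>P m\<bar> + \<bar>P' m\<bar> + \<bar>P m - P' m - D m\<bar>" by linarith
    then have "real m powr s' * \<bar>D m\<bar> \<le> real m powr s' * (\<bar>P m\<bar> + \<bar>P' m\<bar> + \<bar>P m - P' m - D m\<bar>)"
      by (intro mult_left_mono) auto
    then show "\<bar>real m powr s' * D m\<bar> \<le> \<bar>real m powr s' * P m\<bar> + \<bar>real m powr s' * P' m\<bar> + \<bar>(B + B') * real m powr (s' - 1)\<bar>"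
      using e abs_ge_self[of "(B + B') * real m powr (s' - 1)"] by (simp add: abs_mult distrib_left)
  qed
  then have "summable (\<lambda>m. (\<kappa> - \<kappa>')\<^sup>2 * (real m powr s' * ip01 u0 (sin_pi m))\<^sup>2)"
    by (simp add: D_def power_mult_distrib mult_ac)
  \<comment> \<open>\<open>T powr \<alpha>\<close> is strictly increasing in \<open>T\<close>, so
    different times give different factors.\<close>
  moreover have "\<kappa> \<noteq> \<kappa>'"
  proof
    assume "\<kappa> = \<kappa>'"
    moreover have "0 < Gamma (1 - \<alpha>)" using assms(2) by (intro Gamma_real_pos) simp
    ultimately have "T powr \<alpha> = T' powr \<alpha>"
      using assms(19,20) by (simp add: \<kappa>_def \<kappa>'_def)
    then show False
      using ne powr_less_mono2[of \<alpha> T T'] powr_less_mono2[of \<alpha> T' T] assms(1,19,20) by (cases "T < T'") auto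
  qed
  ultimately have "summable (\<lambda>m. (real m powr s' * ip01 u0 (sin_pi m))\<^sup>2)"
    by (simp add: summable_cmult_iff)
  then show False using Hdot_iff[OF assms(10)] assms(11) by blast
qed

end
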